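(* Let $n\geq 3$ and let $f\in\mathbb{Z}[t_1,\dots,t_n]$ be a nondegenerate quadratic form; if $n=3$ assume $f$ is isotropic over $\mathbb{Q}$. (a) The following are equivalent: (i) $f$ is locally universal, i.e. $f$ viewed over $\mathbb{Z}_p$ represents every element of $\mathbb{Z}_p\setminus\{0\}$, for every prime $p$; (ii) $f$ is locally ADC, i.e. $f$ viewed over $\mathbb{Z}_p$ is ADC for every prime $p$; (iii) $\delta(f)=1$. (b) If $f$ is maximal, then $\delta(f)=1$.
   Context: A quadratic form $f$ over $\mathbb{Z}_p$ is ADC if every $x\in\mathbb{Z}_p$ of the form $f(v)$ with $v\in\mathbb{Q}_p^n$ is also of the form $f(w)$ with $w\in\mathbb{Z}_p^n$. The form $f$ corresponds to a $\mathbb{Z}$-lattice $L$ in a quadratic space $(V,q)$ over $\mathbb{Q}$ on which $q$ is $\mathbb{Z}$-valued; $f$ is maximal if there is no $\mathbb{Z}$-lattice $M\supsetneq L$ in $V$ on which $q$ is $\mathbb{Z}$-valued. $D_f\coloneqq f(\mathbb{Z}^n)\setminus\{0\}$. For $S\subset\mathbb{Z}$: $S$ is positive if it contains no negative integers, negative if it contains no positive integers, indefinite otherwise. The density of $S$ is $\lim_{N\to\infty}\#(S\cap[1,N])/N$, $\lim_{N\to\infty}\#(S\cap[-N,-1])/N$, or $\lim_{N\to\infty}\#(S\cap[-N,N])/(2N)$ according as $S$ is positive, negative or indefinite. $\delta(f)$ denotes the density of $D_f$. *)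

theory Defs
  imports
    "HOL-Analysis.Analysis"
    "HOL-Algebra.QuotRing"
    "HOL-Computational_Algebra.Computational_Algebra"
begin

section \<open>The p-adic numbers\<close>

definition padic_val :: "nat \<Rightarrow> rat \<Rightarrow> int" where
  "padic_val p q =
     int (multiplicity (int p) (fst (quotient_of q))) -
     int (multiplicity (int p) (snd (quotient_of q)))"

definition padic_abs :: "nat \<Rightarrow> rat \<Rightarrow> real" where
  "padic_abs p q = (if q = 0 then 0 else real p powi (- padic_val p q))"

definition padic_Cauchy :: "nat \<Rightarrow> (nat \<Rightarrow> rat) \<Rightarrow> bool" where
  "padic_Cauchy p x \<longleftrightarrow>
     (\<forall>\<epsilon>>0. \<exists>N. \<forall>m\<ge>N. \<forall>k\<ge>N. padic_abs p (x m - x k) < \<epsilon>)"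

definition padic_Cauchy_ring :: "nat \<Rightarrow> (nat \<Rightarrow> rat) ring" where
  "padic_Cauchy_ring p =
     \<lparr>carrier = {x. padic_Cauchy p x},
      mult = (\<lambda>x y k. x k * y k),
      one = (\<lambda>k. 1),
      zero = (\<lambda>k. 0),
      add = (\<lambda>x y k. x k + y k)\<rparr>"

definition padic_null :: "nat \<Rightarrow> (nat \<Rightarrow> rat) set" where
  "padic_null p = {x. (\<lambda>k. padic_abs p (x k)) \<longlonglongrightarrow> 0}"

text \<open>The field of p-adic numbers is the completion of the rationals for the p-adic absolute
  value: Cauchy sequences modulo null sequences. The p-adic integers are its closed unit ball,
  the absolute value of a class being the limit of the absolute values along any
  representative.\<close>

definition padic_field :: "nat \<Rightarrow> (nat \<Rightarrow> rat) set ring" where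
  "padic_field p = padic_Cauchy_ring p Quot padic_null p"

definition padic_int :: "nat \<Rightarrow> (nat \<Rightarrow> rat) set set" where
  "padic_int p =
     {X \<in> carrier (padic_field p). \<exists>r\<le>1. \<forall>x\<in>X. (\<lambda>k. padic_abs p (x k)) \<longlonglongrightarrow> r}"

section \<open>Quadratic forms\<close>

text \<open>A square matrix \<open>A\<close>, not assumed symmetric or triangular, stands for the quadratic form
  \<open>\<Sum>i j. A\<^sub>i\<^sub>j t\<^sub>i t\<^sub>j\<close>. The coefficient of \<open>t\<^sub>i t\<^sub>j\<close> for \<open>i \<noteq> j\<close> is \<open>A\<^sub>i\<^sub>j + A\<^sub>j\<^sub>i\<close>, so integer
  matrices yield all quadratic forms with integer coefficients, including those with odd
  cross terms.\<close>

definition qform :: "int^'n^'n \<Rightarrow> 'a::comm_ring_1^'n \<Rightarrow> 'a" where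
  "qform A v = (\<Sum>i\<in>UNIV. \<Sum>j\<in>UNIV. of_int (A $ i $ j) * v $ i * v $ j)"

definition qform_nondegenerate :: "int^'n^'n \<Rightarrow> bool" where
  "qform_nondegenerate A \<longleftrightarrow>
     (\<forall>v::rat^'n. (\<forall>w. qform A (v + w) - qform A v - qform A w = 0) \<longrightarrow> v = 0)"

definition qform_isotropic :: "int^'n^'n \<Rightarrow> bool" where
  "qform_isotropic A \<longleftrightarrow> (\<exists>v::rat^'n. v \<noteq> 0 \<and> qform A v = 0)"

subsection \<open>Local conditions\<close>

definition ring_qform :: "('a, 'b) ring_scheme \<Rightarrow> ('n \<Rightarrow> 'n \<Rightarrow> 'a) \<Rightarrow> ('n \<Rightarrow> 'a) \<Rightarrow> 'a" where
  "ring_qform R a v =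
     finsum R (\<lambda>i. finsum R (\<lambda>j. a i j \<otimes>\<^bsub>R\<^esub> v i \<otimes>\<^bsub>R\<^esub> v j) UNIV) UNIV"

definition padic_coeffs :: "nat \<Rightarrow> int^'n^'n \<Rightarrow> 'n \<Rightarrow> 'n \<Rightarrow> (nat \<Rightarrow> rat) set" where
  "padic_coeffs p A i j = [A $ i $ j] \<cdot>\<^bsub>padic_field p\<^esub> \<one>\<^bsub>padic_field p\<^esub>"

definition padic_universal :: "nat \<Rightarrow> ('n \<Rightarrow> 'n \<Rightarrow> (nat \<Rightarrow> rat) set) \<Rightarrow> bool" where
  "padic_universal p a \<longleftrightarrow>
     (\<forall>x \<in> padic_int p - {\<zero>\<^bsub>padic_field p\<^esub>}.
        \<exists>w. (\<forall>i. w i \<in> padic_int p) \<and> ring_qform (padic_field p) a w = x)"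

definition padic_ADC :: "nat \<Rightarrow> ('n \<Rightarrow> 'n \<Rightarrow> (nat \<Rightarrow> rat) set) \<Rightarrow> bool" where
  "padic_ADC p a \<longleftrightarrow>
     (\<forall>x \<in> padic_int p.
        (\<exists>v. (\<forall>i. v i \<in> carrier (padic_field p)) \<and> ring_qform (padic_field p) a v = x) \<longrightarrow>
        (\<exists>w. (\<forall>i. w i \<in> padic_int p) \<and> ring_qform (padic_field p) a w = x))"

definition locally_universal :: "int^'n^'n \<Rightarrow> bool" where
  "locally_universal A \<longleftrightarrow> (\<forall>p. prime p \<longrightarrow> padic_universal p (padic_coeffs p A))"

definition locally_ADC :: "int^'n^'n \<Rightarrow> bool" where
  "locally_ADC A \<longleftrightarrow> (\<forall>p. prime p \<longrightarrow> padic_ADC p (padic_coeffs p A))"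

subsection \<open>Maximality\<close>

definition Z_lattice :: "(rat^'n) set \<Rightarrow> bool" where
  "Z_lattice M \<longleftrightarrow>
     (\<exists>B. finite B \<and> M = {\<Sum>b\<in>B. of_int (c b) *s b | c :: rat^'n \<Rightarrow> int. True}) \<and>
     vec.span M = UNIV"

definition standard_lattice :: "(rat^'n) set" where
  "standard_lattice = {v. \<forall>i. v $ i \<in> \<int>}"

definition qform_maximal :: "int^'n^'n \<Rightarrow> bool" where
  "qform_maximal A \<longleftrightarrow>
     \<not> (\<exists>M. Z_lattice M \<and> standard_lattice \<subset> M \<and> (\<forall>v\<in>M. qform A v \<in> \<int>))"

section \<open>Density of the set of represented integers\<close>

definition represented :: "int^'n^'n \<Rightarrow> int set" where
  "represented A = range (qform A :: int^'n \<Rightarrow> int) - {0}"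

definition positive_set :: "int set \<Rightarrow> bool" where
  "positive_set S \<longleftrightarrow> (\<forall>x\<in>S. \<not> x < 0)"

definition negative_set :: "int set \<Rightarrow> bool" where
  "negative_set S \<longleftrightarrow> (\<forall>x\<in>S. \<not> x > 0)"

text \<open>The limit need not exist, so the density is a relation. The first two cases overlap only
  for subsets of \<open>{0}\<close>, where both limits are 0.\<close>

definition has_density :: "int set \<Rightarrow> real \<Rightarrow> bool" where
  "has_density S d \<longleftrightarrow>
     (if positive_set S then
        (\<lambda>N. real (card (S \<inter> {1..int N})) / real N) \<longlonglongrightarrow> d
      else if negative_set S then
        (\<lambda>N. real (card (S \<inter> {- int N..-1})) / real N) \<longlonglongrightarrow> d
      else
        (\<lambda>N. real (card (S \<inter> {- int N..int N})) / (2 * real N)) \<longlonglongrightarrow> d)"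

end

theory Submission
  imports
    Defs
    "HOL-Number_Theory.Number_Theory"
    "HOL-Real_Asymp.Real_Asymp"
begin

text \<open>Write \<open>f\<close> for the form and \<open>B\<close> for its polar form. Every condition is compared with the
  statement that \<open>f\<close> represents all residue classes modulo every \<open>m\<close>. For the p-adic conditions
  this is compactness; density 1 implies it because a missed residue class costs density.

  Maximality implies it as follows. If \<open>f e \<equiv> 0\<close> modulo \<open>p\<^sup>2\<close> for a vector \<open>e\<close> that is nonzero modulo
  \<open>p\<close>, then either \<open>e/p\<close> enlarges the lattice, or \<open>B e\<close> is onto modulo \<open>p\<close> and Hensel's lemma applies.
  If there is no such \<open>e\<close>, then the zeros of \<open>f\<close> modulo \<open>p\<close> lie in the radical of \<open>B\<close>, and both \<open>f\<close> on
  the quotient and \<open>f/p\<close> on these zeros are anisotropic over the field with \<open>p\<close> elements, hence of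
  dimension at most 2; in dimension at least 4 both are anisotropic planes, which represent all nonzero
  elements. Enlarging the lattice until it is maximal at \<open>p\<close> shows that \<open>f\<close> represents
  every \<open>p\<^bsup>2j\<^esup>a\<close> for a suitable \<open>j\<close>, so that an ADC form is universal.

  Conversely, let \<open>f\<close> be onto modulo every \<open>m\<close>. On a suitable coset spanned by three orthogonal
  directions \<open>f\<close> becomes, up to scaling, a polynomial \<open>F\<^sub>1 k + F\<^sub>2 l + F\<^sub>3 m\<close> that is equidistributed at
  all small primes. Two representations of the same integer give a congruence between
  values of \<open>F\<^sub>2 + F\<^sub>3\<close> modulo \<open>w = F\<^sub>1' ((k + k')/2)\<close>, so the second moment of the number of
  representations weighted by \<open>F\<^sub>1' k\<close> is controlled by Weyl sums to the moduli \<open>w\<close>, and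
  the Cauchy-Schwarz inequality bounds the number of integers that are not represented.\<close>

section \<open>Exponential sums with quadratic phases\<close>

text \<open>Density 1 asks for a representation of most integers, not of all of them, so a variance
  bound can take the place of an asymptotic formula for the number of representations. Two losses
  have to be made arbitrarily small. The arithmetic one is a sum of \<open>1/d\<close> over the
  divisors \<open>d > 1\<close> of the modulus \<open>w = 2 a j + b\<close>. If \<open>a\<close> is
  divisible by all primes up to \<open>W\<close> and prime to \<open>b\<close>, then
  \<open>d > W\<close>, and averaging over \<open>j\<close> leaves a relative loss proportional to
  \<open>1/W\<close>, uniformly in \<open>a\<close>. The geometric one comes from \<open>l\<close>
  and \<open>m\<close>, which blur the ends of the interval of values. They take \<open>L\<close>
  values each, where \<open>L\<close> is a small fixed proportion of the range of \<open>k\<close>: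
  the blurred part is then small, while \<open>L\<close> is still comparable to \<open>w\<close>, so
  that the error from the Weyl sums is smaller than the main term by almost a full power. Locally,
  the polar form replaces a diagonalisation, so that no classification of forms is needed at 2 or at
  the primes dividing the discriminant. For \<open>n = 3\<close> isotropy supplies a vector that
  dimension counting provides only from \<open>n = 4\<close> on.\<close>

definition unit_exp :: "nat \<Rightarrow> int \<Rightarrow> complex" where
  "unit_exp w a = cis (2 * pi * of_int a / of_nat w)"

lemma unit_exp_add: "unit_exp w (a + b) = unit_exp w a * unit_exp w b"
  by (simp add: unit_exp_def cis_mult add_divide_distrib distrib_left)

lemma unit_exp_0 [simp]: "unit_exp w 0 = 1"
  by (simp add: unit_exp_def)

lemma norm_unit_exp [simp]: "norm (unit_exp w a) = 1"
  by (simp add: unit_exp_def)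

lemma cnj_unit_exp: "cnj (unit_exp w a) = unit_exp w (- a)"
  by (simp add: unit_exp_def cis_cnj)

lemma unit_exp_power: "unit_exp w (a * int k) = unit_exp w a ^ k"
  by (induction k) (simp_all add: distrib_left unit_exp_add)

lemma unit_exp_multiple: "w > 0 \<Longrightarrow> unit_exp w (int w * a) = 1"
proof -
  assume "w > 0"
  then have "2 * pi * of_int (int w * a) / real w = 2 * pi * of_int a" by simp
  then show ?thesis unfolding unit_exp_def by (simp only: cis_multiple_2pi[OF Ints_of_int])
qed

lemma unit_exp_mod: "w > 0 \<Longrightarrow> unit_exp w (a mod int w) = unit_exp w a"
  using unit_exp_add[of w "int w * (a div int w)" "a mod int w"] unit_exp_multiple[of w "a div int w"]
  by simp

section \<open>Geometric sums of additive characters and their averages\<close>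

lemma sin_ge_linear:
  assumes "0 \<le> x" "x \<le> pi / 2"
  shows "2 * x / pi \<le> sin x"
proof -
  \<comment> \<open>The sine is concave on this interval, so its graph lies above the chord from 0
    to \<open>pi / 2\<close> (Jordan's inequality).\<close>
  have "convex_on {0..pi} (\<lambda>x. - sin x)"
  proof (rule f''_ge0_imp_convex)
    show "\<And>x. x \<in> {0..pi} \<Longrightarrow> ((\<lambda>x. - sin x) has_real_derivative - cos x) (at x)"
      by (auto intro!: derivative_eq_intros)
    show "\<And>x. x \<in> {0..pi} \<Longrightarrow> ((\<lambda>x. - cos x) has_real_derivative sin x) (at x)"
      by (auto intro!: derivative_eq_intros)
    show "\<And>x. x \<in> {0..pi} \<Longrightarrow> 0 \<le> sin x" by (auto intro: sin_ge_zero)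
  qed auto
  then have "- sin ((1 - 2 * x / pi) *\<^sub>R 0 + (2 * x / pi) *\<^sub>R (pi / 2)) \<le>
      (1 - 2 * x / pi) * - sin 0 + 2 * x / pi * - sin (pi / 2)"
    using assms by (intro convex_onD) (auto simp: field_simps)
  then show ?thesis by simp
qed

lemma norm_one_minus_unit_exp: "norm (1 - unit_exp w a) = 2 * \<bar>sin (pi * of_int a / of_nat w)\<bar>"
proof -
  define t where "t = pi * of_int a / of_nat w"
  have "unit_exp w a = cis (2 * t)" by (simp add: unit_exp_def t_def mult.assoc)
  then have "(norm (1 - unit_exp w a))\<^sup>2 = (1 - cos (2*t))\<^sup>2 + (sin (2*t))\<^sup>2"
    by (simp add: cmod_power2)
  also have "\<dots> = 2 - 2 * cos (2*t)"
    using sin_cos_squared_add[of "2*t"] by (simp add: power2_eq_square algebra_simps)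
  also have "\<dots> = (2 * \<bar>sin t\<bar>)\<^sup>2"
    by (simp add: cos_double_sin power_mult_distrib)
  finally show ?thesis unfolding t_def by (rule power2_eq_imp_eq) auto
qed

text \<open>The bound is four times the distance of \<open>r / d\<close> from the nearest integer.
  The two cases of the proof are the two halves of the circle, exchanged by the symmetry of the sine
  about \<open>pi / 2\<close>.\<close>

lemma norm_one_minus_unit_exp_ge:
  fixes r d :: nat
  assumes "0 < r" "r < d"
  shows "norm (1 - unit_exp d (int r)) \<ge> 4 * min (real r) (real d - real r) / real d"
proof -
  have d: "real d > 0" using assms by simp
  have s: "sin (pi * real r / real d) \<ge> 2 * min (real r) (real d - real r) / real d"
  proof (cases "2 * r \<le> d")
    case True
    then have r: "2 * real r \<le> real d" by linarith
    have "pi * (2 * real r) \<le> pi * real d" using r by (intro mult_left_mono) auto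
    then have "2 * (pi * real r / real d) / pi \<le> sin (pi * real r / real d)"
      using d by (intro sin_ge_linear) (auto simp: field_simps)
    moreover have "min (real r) (real d - real r) = real r" using r by simp
    ultimately show ?thesis by simp
  next
    case False
    then have r: "2 * real r \<ge> real d" by linarith
    have "pi * (2 * real r) \<ge> pi * real d" using r by (intro mult_left_mono) auto
    moreover have "pi * real r \<le> pi * real d" using assms by (intro mult_left_mono) auto
    ultimately have "2 * (pi * (real d - real r) / real d) / pi \<le> sin (pi * (real d - real r) / real d)"
      using d by (intro sin_ge_linear) (auto simp: field_simps)
    moreover have "pi * (real d - real r) / real d = pi - pi * real r / real d"
      using d by (simp add: field_simps)
    moreover have "min (real r) (real d - real r) = real d - real r" using r by simp
    moreover have "2 * (pi * (real d - real r) / real d) / pi = 2 * (real d - real r) / real d"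
      by simp
    ultimately show ?thesis by (simp only: sin_pi_minus)
  qed
  have "min (real r) (real d - real r) / real d \<ge> 0" using assms d by simp
  then show ?thesis using s unfolding norm_one_minus_unit_exp by auto
qed

lemma norm_geometric_unit_exp:
  assumes "unit_exp d c \<noteq> 1"
  shows "norm (\<Sum>k\<in>{a..<b}. unit_exp d (c * k)) \<le> 2 / norm (1 - unit_exp d c)"
proof (cases "a \<le> b")
  case True
  have *: "(\<Sum>k\<in>{a..<a + int n}. unit_exp d (c * k)) * (1 - unit_exp d c) =
      unit_exp d (c * a) - unit_exp d (c * (a + int n))" for n
  proof (induction n)
    case (Suc n)
    have "{a..<a + int (Suc n)} = insert (a + int n) {a..<a + int n}" by auto
    then have "(\<Sum>k\<in>{a..<a + int (Suc n)}. unit_exp d (c * k)) * (1 - unit_exp d c) =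
        unit_exp d (c * (a + int n)) * (1 - unit_exp d c) + (unit_exp d (c * a) - unit_exp d (c * (a + int n)))"
      using Suc by (simp only:) (simp add: distrib_right)
    also have "\<dots> = unit_exp d (c * a) - unit_exp d (c * (a + int n)) * unit_exp d c"
      by (simp add: algebra_simps)
    also have "unit_exp d (c * (a + int n)) * unit_exp d c = unit_exp d (c * (a + int (Suc n)))"
      by (simp add: algebra_simps flip: unit_exp_add)
    finally show ?case .
  qed simp
  have "norm (\<Sum>k\<in>{a..<b}. unit_exp d (c * k)) * norm (1 - unit_exp d c) =
      norm (unit_exp d (c * a) - unit_exp d (c * b))"
    using *[of "nat (b - a)"] True by (simp flip: norm_mult)
  also have "\<dots> \<le> 2" by (rule order_trans[OF norm_triangle_ineq4]) simp
  finally show ?thesis using assms by (simp add: field_simps)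
qed simp

text \<open>A bound for a geometric sum of at most \<open>L\<close> terms whose ratio is the root of
  unity of \<open>c / d\<close>. The sharper \<open>d / (2 min r (d - r))\<close> is weakened to a
  sum of two fractions, so that summing over all residues produces harmonic numbers.\<close>

definition geom_bound :: "nat \<Rightarrow> nat \<Rightarrow> int \<Rightarrow> real" where
  "geom_bound L d c = (let r = nat (c mod int d) in
     if r = 0 then real L else real d / 2 * (1 / real r + 1 / real (d - r)))"

lemma geom_bound_nonneg: "geom_bound L d c \<ge> 0"
  by (auto simp: geom_bound_def Let_def)

lemma norm_sum_unit_exp_le_geom_bound:
  assumes "d > 0" and "b - a \<le> int L"
  shows "norm (\<Sum>k\<in>{a..<b}. unit_exp d (c * k)) \<le> geom_bound L d c"
proof -
  define r where "r = nat (c mod int d)"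
  have r: "int r = c mod int d" "r < d" using assms by (auto simp: r_def nat_less_iff)
  show ?thesis
  proof (cases "r = 0")
    case True
    have "norm (\<Sum>k\<in>{a..<b}. unit_exp d (c * k)) \<le> (\<Sum>k\<in>{a..<b}. norm (unit_exp d (c * k)))"
      by (rule norm_sum)
    also have "\<dots> \<le> real L" using assms by simp
    finally show ?thesis using True by (simp add: geom_bound_def r_def)
  next
    case False
    then have pos: "0 < min (real r) (real d - real r)" using r by simp
    have e: "unit_exp d c = unit_exp d (int r)" using r assms by (simp add: unit_exp_mod)
    have ge: "norm (1 - unit_exp d c) \<ge> 4 * min (real r) (real d - real r) / real d"
      unfolding e using False r by (intro norm_one_minus_unit_exp_ge) auto
    have gt: "4 * min (real r) (real d - real r) / real d > 0" using pos assms by simp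
    then have "unit_exp d c \<noteq> 1" using ge by auto
    then have "norm (\<Sum>k\<in>{a..<b}. unit_exp d (c * k)) \<le> 2 / norm (1 - unit_exp d c)"
      by (rule norm_geometric_unit_exp)
    also have "\<dots> \<le> 2 / (4 * min (real r) (real d - real r) / real d)"
      using ge gt by (intro divide_left_mono mult_pos_pos) auto
    also have "\<dots> = real d / 2 * (1 / min (real r) (real d - real r))" using pos by simp
    also have "\<dots> \<le> real d / 2 * (1 / real r + 1 / real (d - r))"
      using r False by (intro mult_left_mono) (auto simp: min_def of_nat_diff)
    finally show ?thesis using False by (simp add: geom_bound_def r_def[symmetric] Let_def)
  qed
qed

text \<open>Multiplication by \<open>a\<close> permutes the residues modulo \<open>d\<close>.
  Residue 0 contributes \<open>L\<close>, and each of the two families of fractions contributes at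
  most half of \<open>d * harm d\<close>.\<close>

lemma sum_geom_bound_period:
  assumes "d > 0" and "coprime a (int d)"
  shows "(\<Sum>u\<in>{x..<x + int d}. geom_bound L d (a * u)) \<le> real L + real d * harm d"
proof -
  let ?g = "\<lambda>r::nat. if r = 0 then real L else real d / 2 * (1 / real r + 1 / real (d - r))"
  let ?f = "\<lambda>u. nat (a * u mod int d)"
  have inj: "inj_on ?f {x..<x + int d}"
  proof (rule inj_onI)
    fix u v assume uv: "u \<in> {x..<x + int d}" "v \<in> {x..<x + int d}" "?f u = ?f v"
    then have "a * u mod int d = a * v mod int d"
      using assms by (metis eq_nat_nat_iff of_nat_0_less_iff pos_mod_sign)
    then have "int d dvd a * (u - v)" by (simp add: mod_eq_dvd_iff right_diff_distrib)
    then have "int d dvd u - v" using assms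
      by (simp add: coprime_commute coprime_dvd_mult_right_iff)
    moreover have "\<bar>u - v\<bar> < int d" using uv by auto
    ultimately show "u = v" using dvd_imp_le_int[of "u - v" "int d"] by fastforce
  qed
  have "?f ` {x..<x + int d} \<subseteq> {..<d}" using assms by (auto simp: nat_less_iff)
  moreover have "card (?f ` {x..<x + int d}) = card {..<d}" using card_image[OF inj] by simp
  ultimately have im: "?f ` {x..<x + int d} = {..<d}" by (intro card_subset_eq) auto
  have "(\<Sum>u\<in>{x..<x + int d}. geom_bound L d (a * u)) = (\<Sum>u\<in>{x..<x + int d}. ?g (?f u))"
    by (simp add: geom_bound_def Let_def)
  also have "\<dots> = (\<Sum>r<d. ?g r)" using sum.reindex[OF inj, of ?g] im by simp
  also have "\<dots> = real L + (\<Sum>r\<in>{1..<d}. ?g r)"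
    using assms by (simp add: lessThan_atLeast0 sum.atLeast_Suc_lessThan)
  also have "(\<Sum>r\<in>{1..<d}. ?g r) = real d / 2 * ((\<Sum>r\<in>{1..<d}. 1 / real r) + (\<Sum>r\<in>{1..<d}. 1 / real (d - r)))"
    by (simp add: sum_distrib_left flip: sum.distrib)
  also have "(\<Sum>r\<in>{1..<d}. 1 / real (d - r)) = (\<Sum>r\<in>{1..<d}. 1 / real r)"
    by (rule sum.reindex_bij_witness[of _ "\<lambda>r. d - r" "\<lambda>r. d - r"]) auto
  also have "real d / 2 * ((\<Sum>r\<in>{1..<d}. 1 / real r) + (\<Sum>r\<in>{1..<d}. 1 / real r)) = real d * (\<Sum>r\<in>{1..<d}. 1 / real r)"
    by simp
  also have "(\<Sum>r\<in>{1..<d}. 1 / real r) \<le> harm d"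
    unfolding harm_def by (simp add: inverse_eq_divide) (rule sum_mono2, auto)
  finally show ?thesis by (simp add: mult_left_mono)
qed

lemma sum_geom_bound_interval:
  assumes "d > 0" and "coprime a (int d)"
  shows "(\<Sum>u\<in>{x..<x + int n}. geom_bound L d (a * u)) \<le> (real n / real d + 1) * (real L + real d * harm d)"
proof -
  have *: "(\<Sum>u\<in>{x..<x + int (d * b)}. geom_bound L d (a * u)) \<le> real b * (real L + real d * harm d)" for b
  proof (induction b)
    case (Suc b)
    have "{x..<x + int (d * Suc b)} = {x..<x + int (d * b)} \<union> {x + int (d * b)..<x + int (d * b) + int d}"
      using ivl_disj_un_two(3)[of x "x + int (d * b)" "x + int (d * b) + int d"] by (simp add: algebra_simps)
    then have "(\<Sum>u\<in>{x..<x + int (d * Suc b)}. geom_bound L d (a * u)) =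
        (\<Sum>u\<in>{x..<x + int (d * b)}. geom_bound L d (a * u)) +
        (\<Sum>u\<in>{x + int (d * b)..<x + int (d * b) + int d}. geom_bound L d (a * u))"
      by (simp only:) (rule sum.union_disjoint, auto)
    also have "\<dots> \<le> real b * (real L + real d * harm d) + (real L + real d * harm d)"
      by (intro add_mono Suc sum_geom_bound_period assms)
    finally show ?case by (simp add: algebra_simps)
  qed simp
  have n: "n \<le> d * (n div d + 1)"
    using assms by (metis Suc_eq_plus1 dividend_less_times_div less_imp_le_nat mult_Suc_right add.commute)
  have "(\<Sum>u\<in>{x..<x + int n}. geom_bound L d (a * u)) \<le> (\<Sum>u\<in>{x..<x + int (d * (n div d + 1))}. geom_bound L d (a * u))"
    by (rule sum_mono2) (use n geom_bound_nonneg in \<open>auto simp del: of_nat_mult\<close>)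
  also have "\<dots> \<le> real (n div d + 1) * (real L + real d * harm d)" by (rule *)
  also have "\<dots> \<le> (real n / real d + 1) * (real L + real d * harm d)"
    using of_nat_div_le_of_nat[of n d, where 'a = real] harm_nonneg[where 'a = real, of d]
    by (intro mult_right_mono add_nonneg_nonneg mult_nonneg_nonneg) auto
  finally show ?thesis .
qed

text \<open>Weyl differencing. In the squared norm only differences \<open>u\<close> of two
  arguments matter; for fixed \<open>u\<close> the quadratic terms cancel, and a geometric sum with
  ratio \<open>2 a h u / w\<close> remains. Cancelling \<open>gcd h w\<close> brings this fraction
  to denominator \<open>d\<close> with a numerator \<open>2 a h' u\<close> in which
  \<open>2 a h'\<close> is prime to \<open>d\<close>, so the sum over the \<open>2 L\<close>
  differences is an average over residues modulo \<open>d\<close>.\<close>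

lemma weyl_bound:
  fixes a b h :: int
  assumes w: "w > 0" and cop: "coprime (2 * a) (int w)"
    and d: "d = w div nat (gcd h (int w))"
  shows "(norm (\<Sum>k\<in>{0..<int L}. unit_exp w (h * (a * k\<^sup>2 + b * k))))\<^sup>2 \<le>
    (2 * real L / real d + 1) * (real L + real d * harm d)"
proof -
  let ?I = "{0..<int L}"
  let ?P = "\<lambda>k. h * (a * k\<^sup>2 + b * k)"
  let ?S = "\<Sum>k\<in>?I. unit_exp w (?P k)"
  define g where "g = gcd h (int w)"
  have g: "g > 0" "g dvd h" "g dvd int w" using w by (auto simp: g_def)
  obtain h' where h': "h = g * h'" using g by (auto elim: dvdE)
  have wd: "int w = g * int d" using g d by (auto simp: g_def[symmetric] zdiv_int)
  then have d0: "d > 0" using w g by (cases d) auto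
  have "coprime h' (int d)"
  proof (rule gcd_coprime)
    show "gcd h (int w) \<noteq> 0" using w by simp
    show "h = h' * gcd h (int w)" "int w = int d * gcd h (int w)"
      using h' wd unfolding g_def[symmetric] by (simp_all only: mult.commute)
  qed
  moreover have "coprime (2 * a) (int d)" using cop wd by (metis coprime_mult_right_iff)
  ultimately have copd: "coprime (2 * a * h') (int d)" by simp
  have red: "unit_exp w (2 * h * a * c) = unit_exp d (2 * a * h' * c)" for c
  proof -
    have "2 * pi * of_int (2 * h * a * c) / real w = 2 * pi * of_int (2 * a * h' * c) / real d"
    proof -
      have "real w = of_int g * real d" using wd by (metis of_int_mult of_int_of_nat_eq)
      moreover have "2 * h * a * c = g * (2 * a * h' * c)" by (simp add: h' ac_simps)
      ultimately show ?thesis using g(1) by (simp only: of_int_mult) simp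
    qed
    then show ?thesis by (simp add: unit_exp_def)
  qed
  \<comment> \<open>The contribution of all pairs \<open>(k + u, k)\<close>; the bounds of the range
    keep both entries between 0 and \<open>L\<close>.\<close>
  define T where "T u = (\<Sum>k\<in>{max 0 (-u)..<min (int L) (int L - u)}. unit_exp w (?P (k + u) - ?P k))" for u
  have "complex_of_real ((norm ?S)\<^sup>2) = ?S * cnj ?S" by (simp only: complex_norm_square)
  also have "\<dots> = (\<Sum>k\<in>?I. \<Sum>l\<in>?I. unit_exp w (?P k - ?P l))"
    by (simp only: cnj_sum sum_product cnj_unit_exp) (simp flip: unit_exp_add)
  also have "\<dots> = (\<Sum>(k,l)\<in>?I \<times> ?I. unit_exp w (?P k - ?P l))"
    by (rule sum.cartesian_product)
  also have "\<dots> = (\<Sum>(u,k)\<in>Sigma {- int L..<int L} (\<lambda>u. {max 0 (-u)..<min (int L) (int L - u)}). unit_exp w (?P (k + u) - ?P k))"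
    by (rule sum.reindex_bij_witness[of _ "\<lambda>(u,k). (k + u, k)" "\<lambda>(k,l). (k - l, l)"]) auto
  also have "\<dots> = (\<Sum>u\<in>{- int L..<int L}. T u)" unfolding T_def by (rule sum.Sigma[symmetric]) auto
  finally have "(norm ?S)\<^sup>2 = norm (\<Sum>u\<in>{- int L..<int L}. T u)" by (metis abs_norm_cancel norm_of_real power_abs)
  also have "\<dots> \<le> (\<Sum>u\<in>{- int L..<int L}. norm (T u))" by (rule norm_sum)
  also have "\<dots> \<le> (\<Sum>u\<in>{- int L..<int L}. geom_bound L d (2 * a * h' * u))"
  proof (rule sum_mono)
    fix u assume "u \<in> {- int L..<int L}"
    have "T u = (\<Sum>k\<in>{max 0 (-u)..<min (int L) (int L - u)}. unit_exp w (h * (a * u\<^sup>2 + b * u)) * unit_exp d (2 * a * h' * u * k))"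
      unfolding T_def
    proof (rule sum.cong)
      fix k
      have "?P (k + u) - ?P k = h * (a * u\<^sup>2 + b * u) + 2 * h * a * (u * k)"
        by (simp add: algebra_simps power2_eq_square)
      then show "unit_exp w (?P (k + u) - ?P k) = unit_exp w (h * (a * u\<^sup>2 + b * u)) * unit_exp d (2 * a * h' * u * k)"
        by (simp only: unit_exp_add red) (simp add: mult.assoc)
    qed simp
    then have "norm (T u) = norm (\<Sum>k\<in>{max 0 (-u)..<min (int L) (int L - u)}. unit_exp d (2 * a * h' * u * k))"
      by (simp add: norm_mult flip: sum_distrib_left)
    also have "\<dots> \<le> geom_bound L d (2 * a * h' * u)"
      by (rule norm_sum_unit_exp_le_geom_bound[OF d0]) auto
    finally show "norm (T u) \<le> geom_bound L d (2 * a * h' * u)" .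
  qed
  also have "\<dots> \<le> (real (2 * L) / real d + 1) * (real L + real d * harm d)"
    using sum_geom_bound_interval[OF d0 copd, of L "- int L" "2 * L"] by simp
  finally show ?thesis by simp
qed

lemma sum_unit_exp_orthogonal:
  assumes "w > 0"
  shows "(\<Sum>h\<in>{0..<int w}. unit_exp w (h * c)) = (if int w dvd c then of_nat w else 0)"
proof (cases "int w dvd c")
  case True
  then obtain c' where "c = int w * c'" by (auto elim: dvdE)
  then have "unit_exp w (h * c) = 1" for h
    using unit_exp_multiple[OF assms, of "h * c'"] by (simp add: ac_simps)
  then show ?thesis using True by simp
next
  case False
  define r where "r = nat (c mod int w)"
  have r: "int r = c mod int w" "0 < r" "r < w"
    using assms False pos_mod_bound[of "int w" c] pos_mod_sign[of "int w" c]
    by (auto simp: r_def nat_less_iff dvd_eq_mod_eq_0 simp del: pos_mod_bound pos_mod_sign)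
  have "norm (1 - unit_exp w (int r)) \<ge> 4 * min (real r) (real w - real r) / real w"
    using r by (intro norm_one_minus_unit_exp_ge) auto
  moreover have "4 * min (real r) (real w - real r) / real w > 0" using r by simp
  ultimately have "unit_exp w (int r) \<noteq> 1" by auto
  then have "unit_exp w c \<noteq> 1" using r unit_exp_mod[OF assms, of c] by simp
  moreover have "(\<Sum>h\<in>{0..<int w}. unit_exp w (h * c)) = (\<Sum>h<w. unit_exp w c ^ h)"
    by (rule sum.reindex_bij_witness[of _ int nat]) (auto simp: mult.commute simp flip: unit_exp_power)
  moreover have "unit_exp w c ^ w = 1"
    using unit_exp_multiple[OF assms, of c] by (simp add: mult.commute flip: unit_exp_power)
  ultimately show ?thesis using False by (simp add: sum_gp_strict)
qed

section \<open>Values of diagonal ternary quadratic polynomials\<close>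

text \<open>The number \<open>w div gcd h w\<close> is the denominator of \<open>h / w\<close> in
  lowest terms. At most \<open>d\<close> of the \<open>h\<close> have denominator \<open>d\<close>,
  which costs one of the two powers.\<close>

lemma sum_inverse_square_order_le:
  fixes w :: nat
  assumes "w > 0"
  shows "(\<Sum>h\<in>{1..<int w}. 1 / (real (w div nat (gcd h (int w))))\<^sup>2) \<le>
    (\<Sum>d | d dvd w \<and> d > 1. 1 / real d)"
proof -
  let ?d = "\<lambda>h::int. w div nat (gcd h (int w))"
  let ?D = "{d. d dvd w \<and> d > 1}"
  have fin: "finite ?D" using assms by (auto intro: finite_subset[OF _ finite_divisors_nat])
  have eq: "int w = int (?d h) * gcd h (int w)" for h
  proof -
    have "int (nat (gcd h (int w))) = gcd h (int w)" by simp
    moreover have "nat (gcd h (int w)) dvd w" by (simp flip: int_dvd_int_iff)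
    ultimately show ?thesis by (metis dvd_div_mult_self of_nat_mult)
  qed
  have D: "?d h \<in> ?D" if "h \<in> {1..<int w}" for h
  proof -
    have "gcd h (int w) \<le> h" using that by (intro zdvd_imp_le) auto
    moreover have "h < int w" using that by simp
    ultimately have "gcd h (int w) < int w" by (rule order.strict_trans1)
    then have "?d h \<noteq> 1" using eq[of h] by auto
    moreover have "?d h \<noteq> 0" using eq[of h] assms by (intro notI) simp
    moreover have "?d h dvd w"
      using eq[of h] by (metis dvd_triv_left int_dvd_int_iff)
    ultimately show ?thesis by simp
  qed
  have "(\<Sum>h\<in>{1..<int w}. 1 / (real (?d h))\<^sup>2) =
      (\<Sum>d\<in>?D. \<Sum>h\<in>{h\<in>{1..<int w}. ?d h = d}. 1 / (real (?d h))\<^sup>2)"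
    by (rule sum.group[symmetric]) (use fin D in auto)
  also have "\<dots> \<le> (\<Sum>d\<in>?D. 1 / real d)"
  proof (rule sum_mono)
    fix d assume d: "d \<in> ?D"
    have "{h\<in>{1..<int w}. ?d h = d} \<subseteq> (\<lambda>x. (int w div int d) * x) ` {0..<int d}"
    proof
      fix h assume h: "h \<in> {h\<in>{1..<int w}. ?d h = d}"
      then have h1: "h \<ge> 1" "h < int w" by auto
      define G where "G = gcd h (int w)"
      have g: "int w = int d * G" using eq[of h] h by (simp add: G_def)
      have d0: "d > 0" using d by simp
      have gp: "G > 0" using assms by (simp add: G_def)
      have "G dvd h" by (simp add: G_def)
      then obtain x where x: "h = G * x" by (rule dvdE)
      have "0 < G * x" using h1 x by simp
      then have "0 \<le> x" using gp by (simp add: zero_less_mult_iff)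
      moreover have "x < int d"
      proof -
        have "G * x < G * int d" using h1 by (simp only: x g mult.commute)
        then show ?thesis using gp by simp
      qed
      moreover have "int w div int d = G" using g d0 by simp
      ultimately show "h \<in> (\<lambda>x. (int w div int d) * x) ` {0..<int d}" using x by auto
    qed
    then have "card {h\<in>{1..<int w}. ?d h = d} \<le> card ((\<lambda>x. (int w div int d) * x) ` {0..<int d})"
      by (rule card_mono[rotated]) simp
    also have "\<dots> \<le> d" using card_image_le[of "{0..<int d}" "\<lambda>x. (int w div int d) * x"] by simp
    finally have c: "card {h\<in>{1..<int w}. ?d h = d} \<le> d" .
    have "(\<Sum>h\<in>{h\<in>{1..<int w}. ?d h = d}. 1 / (real (?d h))\<^sup>2) =
        real (card {h\<in>{1..<int w}. ?d h = d}) * (1 / (real d)\<^sup>2)" by simp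
    also have "\<dots> \<le> real d * (1 / (real d)\<^sup>2)" using c by (intro mult_right_mono) auto
    also have "\<dots> = 1 / real d" using d by (simp add: power2_eq_square)
    finally show "(\<Sum>h\<in>{h\<in>{1..<int w}. ?d h = d}. 1 / (real (?d h))\<^sup>2) \<le> 1 / real d" .
  qed
  finally show ?thesis .
qed

text \<open>The congruence is detected by additive characters. Frequency 0 gives the main term. At
  any other \<open>h\<close> the two one-variable sums have the same denominator \<open>d\<close>,
  so the product of their squared norms gains \<open>1/d^2\<close>; counting the frequencies with
  this denominator leaves a divisor sum of \<open>1/d\<close>. Two variables are what makes this
  gain large enough.\<close>

lemma card_congruent_pairs_le:
  fixes a b a' b' :: int and w L :: nat
  assumes w: "w > 0" and cop: "coprime (2 * a) (int w)" "coprime (2 * a') (int w)"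
  defines "I \<equiv> {0..<int L}"
  defines "q \<equiv> \<lambda>(k, l). (a * k\<^sup>2 + b * k) + (a' * l\<^sup>2 + b' * l)"
  shows "real w * real (card {(x, y) \<in> (I \<times> I) \<times> (I \<times> I). int w dvd q x - q y}) \<le>
    real L ^ 4 + 8 * real L ^ 4 * (\<Sum>d | d dvd w \<and> d > 1. 1 / real d) +
    2 * real w * ((3 * real L + real w) * harm w)\<^sup>2"
proof -
  define S where "S h = (\<Sum>k\<in>I. unit_exp w (h * (a * k\<^sup>2 + b * k)))" for h
  define S' where "S' h = (\<Sum>k\<in>I. unit_exp w (h * (a' * k\<^sup>2 + b' * k)))" for h
  \<comment> \<open>A bound, uniform in \<open>d\<close>, for what the Weyl bound contains besides
    \<open>2 L^2 / d\<close>.\<close>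
  define \<rho> where "\<rho> = (3 * real L + real w) * harm w"
  let ?d = "\<lambda>h::int. w div nat (gcd h (int w))"
  let ?E = "{(x, y) \<in> (I \<times> I) \<times> (I \<times> I). int w dvd q x - q y}"
  have finI: "finite I" by (simp add: I_def)
  have SS: "(\<Sum>x\<in>I \<times> I. unit_exp w (h * q x)) = S h * S' h" for h
    unfolding S_def S'_def sum_product sum.cartesian_product
    by (intro sum.cong) (auto simp: q_def distrib_left unit_exp_add)
  have "of_nat w * complex_of_nat (card ?E) = (\<Sum>p\<in>(I \<times> I) \<times> (I \<times> I). if int w dvd q (fst p) - q (snd p) then of_nat w else 0)"
  proof -
    have "?E = {p \<in> (I \<times> I) \<times> (I \<times> I). int w dvd q (fst p) - q (snd p)}" by auto
    then show ?thesis using finI by (simp add: sum.If_cases Int_def)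
  qed
  also have "\<dots> = (\<Sum>p\<in>(I \<times> I) \<times> (I \<times> I). \<Sum>h\<in>{0..<int w}. unit_exp w (h * (q (fst p) - q (snd p))))"
    by (simp only: sum_unit_exp_orthogonal[OF w])
  also have "\<dots> = (\<Sum>h\<in>{0..<int w}. \<Sum>p\<in>(I \<times> I) \<times> (I \<times> I). unit_exp w (h * (q (fst p) - q (snd p))))"
    by (rule sum.swap)
  also have "\<dots> = (\<Sum>h\<in>{0..<int w}. (S h * S' h) * cnj (S h * S' h))"
    unfolding SS[symmetric] cnj_sum cnj_unit_exp sum_product sum.cartesian_product
    by (intro sum.cong) (auto simp: right_diff_distrib simp flip: unit_exp_add)
  also have "\<dots> = (\<Sum>h\<in>{0..<int w}. complex_of_real ((norm (S h))\<^sup>2 * (norm (S' h))\<^sup>2))"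
    by (intro sum.cong refl) (simp only: complex_norm_square[symmetric] norm_mult power_mult_distrib)
  finally have "complex_of_real (real w * real (card ?E)) = of_real (\<Sum>h\<in>{0..<int w}. (norm (S h))\<^sup>2 * (norm (S' h))\<^sup>2)"
    by simp
  then have main: "real w * real (card ?E) = (\<Sum>h\<in>{0..<int w}. (norm (S h))\<^sup>2 * (norm (S' h))\<^sup>2)"
    by (rule iffD1[OF of_real_eq_iff])
  have split: "{0..<int w} = insert 0 {1..<int w}" using w by auto
  have zero: "(norm (S 0))\<^sup>2 * (norm (S' 0))\<^sup>2 = real L ^ 4"
    by (simp add: S_def S'_def I_def flip: power_add)
  have each: "(norm (S h))\<^sup>2 * (norm (S' h))\<^sup>2 \<le> 8 * real L ^ 4 * (1 / (real (?d h))\<^sup>2) + 2 * \<rho>\<^sup>2"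
    if h: "h \<in> {1..<int w}" for h
  proof -
    define d where "d = ?d h"
    have dw: "d \<le> w" by (simp add: d_def)
    have d0: "d > 0"
    proof -
      have "gcd h (int w) \<le> int w" using w by (intro zdvd_imp_le) auto
      then show ?thesis unfolding d_def using w by (subst div_greater_zero_iff) (auto simp: nat_le_iff)
    qed
    have hd: "(1::real) \<le> harm d" "harm d \<le> (harm w :: real)"
      using harm_mono[of 1 d, where 'a = real] harm_mono[OF dw, where 'a = real] d0 by (auto simp: harm_def)
    have "(2 * real L / real d + 1) * (real L + real d * harm d) =
        2 * (real L)\<^sup>2 / real d + (2 * real L * harm d + real L + real d * harm d)"
      using d0 by (simp add: field_simps power2_eq_square)
    also have "2 * real L * harm d + real L + real d * harm d \<le> 2 * real L * harm w + real L * harm w + real w * harm w"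
      using hd dw by (intro add_mono mult_mono) (auto simp: mult_le_cancel_left1 intro: order_trans)
    also have "\<dots> = \<rho>" by (simp add: \<rho>_def algebra_simps)
    finally have le: "(2 * real L / real d + 1) * (real L + real d * harm d) \<le> 2 * (real L)\<^sup>2 / real d + \<rho>"
      by simp
    have b1: "(norm (S h))\<^sup>2 \<le> 2 * (real L)\<^sup>2 / real d + \<rho>"
      using order_trans[OF weyl_bound[OF w cop(1) d_def, of b L] le] unfolding S_def I_def .
    have b2: "(norm (S' h))\<^sup>2 \<le> 2 * (real L)\<^sup>2 / real d + \<rho>"
      using order_trans[OF weyl_bound[OF w cop(2) d_def, of b' L] le] unfolding S'_def I_def .
    have "(norm (S h))\<^sup>2 * (norm (S' h))\<^sup>2 \<le> (2 * (real L)\<^sup>2 / real d + \<rho>) * (2 * (real L)\<^sup>2 / real d + \<rho>)"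
      using order_trans[OF zero_le_power2 b1] by (intro mult_mono b1 b2) auto
    \<comment> \<open>The 8 is the square of the 2 in \<open>z\<close>, doubled by
      \<open>(z + \<rho>)^2 <= 2 z^2 + 2 \<rho>^2\<close>.\<close>
    also have "\<dots> \<le> 8 * real L ^ 4 * (1 / (real d)\<^sup>2) + 2 * \<rho>\<^sup>2"
    proof -
      define z where "z = 2 * (real L)\<^sup>2 / real d"
      have "(z + \<rho>) * (z + \<rho>) \<le> 2 * z\<^sup>2 + 2 * \<rho>\<^sup>2"
        using sum_squares_bound[of z \<rho>] by (simp add: power2_eq_square algebra_simps)
      moreover have "2 * z\<^sup>2 = 8 * real L ^ 4 * (1 / (real d)\<^sup>2)"
        by (simp add: z_def power_divide power_mult_distrib flip: power_mult)
      ultimately show ?thesis by (simp add: z_def)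
    qed
    finally show ?thesis by (simp add: d_def)
  qed
  have "real w * real (card ?E) \<le> real L ^ 4 + (\<Sum>h\<in>{1..<int w}. 8 * real L ^ 4 * (1 / (real (?d h))\<^sup>2) + 2 * \<rho>\<^sup>2)"
  proof -
    have "(\<Sum>h\<in>{1..<int w}. (norm (S h))\<^sup>2 * (norm (S' h))\<^sup>2) \<le>
        (\<Sum>h\<in>{1..<int w}. 8 * real L ^ 4 * (1 / (real (?d h))\<^sup>2) + 2 * \<rho>\<^sup>2)"
      by (rule sum_mono) (rule each)
    then show ?thesis unfolding main split using zero by simp
  qed
  also have "\<dots> = real L ^ 4 + 8 * real L ^ 4 * (\<Sum>h\<in>{1..<int w}. 1 / (real (?d h))\<^sup>2) + 2 * real (w - 1) * \<rho>\<^sup>2"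
    using w by (simp add: sum.distrib sum_distrib_left nat_diff_distrib')
  also have "\<dots> \<le> real L ^ 4 + 8 * real L ^ 4 * (\<Sum>d | d dvd w \<and> d > 1. 1 / real d) + 2 * real w * \<rho>\<^sup>2"
    using sum_inverse_square_order_le[OF w] by (intro add_mono mult_left_mono mult_right_mono) auto
  finally show ?thesis unfolding \<rho>_def .
qed

text \<open>The weights \<open>w k\<close> make the representation numbers of \<open>Q\<close> constant on average, and
  \<open>w k * w k' \<le> (w j)\<^sup>2\<close> for the midpoint \<open>j\<close> of \<open>k\<close> and \<open>k'\<close>. The parity conditions make
  \<open>j\<close> an integer whenever \<open>Q (k, l, m) = Q (k', l', m')\<close>.\<close>

lemma card_values_ge:
  fixes a b a2 b2 a3 b3 A0 A1 :: int and L :: nat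
  assumes a: "a > 0" "even a" "odd b" and ev: "even a2" "even b2" "even a3" "even b3"
    and cop: "\<And>j. coprime (2 * a2) (2 * a * j + b)" "\<And>j. coprime (2 * a3) (2 * a * j + b)"
    and pos: "2 * a * A0 + b > 0" and L: "L > 0"
  defines "w \<equiv> \<lambda>j. 2 * a * j + b"
  defines "V \<equiv> \<lambda>w::int. 8 * (\<Sum>d | d dvd nat w \<and> d > 1. 1 / real d) +
    2 * of_int w * ((3 * real L + of_int w) * harm (nat w))\<^sup>2 / real L ^ 4"
  defines "Q \<equiv> \<lambda>(k, l, m). (a * k\<^sup>2 + b * k) + ((a2 * l\<^sup>2 + b2 * l) + (a3 * m\<^sup>2 + b3 * m))"
  shows "real (card (Q ` ({A0..<A1} \<times> {0..<int L} \<times> {0..<int L}))) \<ge>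
    (\<Sum>j\<in>{A0..<A1}. of_int (w j)) - (\<Sum>j\<in>{A0..<A1}. of_int (w j) * V (w j))"
proof -
  define I where "I = {0..<int L}"
  define K where "K = {A0..<A1}"
  define X where "X = K \<times> I \<times> I"
  define q where "q = (\<lambda>(l, m). (a2 * l\<^sup>2 + b2 * l) + (a3 * m\<^sup>2 + b3 * m))"
  define r where "r N = (\<Sum>x\<in>{x\<in>X. Q x = N}. real_of_int (w (fst x)))" for N
  define S where "S = (\<Sum>j\<in>K. real_of_int (w j))"
  define Y where "Y = (\<Sum>j\<in>K. real_of_int (w j) * V (w j))"
  have Q: "Q x = (a * (fst x)\<^sup>2 + b * fst x) + q (snd x)" for x
    by (auto simp: Q_def q_def split: prod.splits)
  have evq: "even (q y)" for y using ev by (auto simp: q_def split: prod.splits)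
  have fin: "finite X" "finite K" "finite I" by (auto simp: X_def K_def I_def)
  have wpos: "w j > 0" if "j \<in> K" for j
  proof -
    have "2 * a * A0 \<le> 2 * a * j" using that a by (intro mult_left_mono) (auto simp: K_def)
    then show ?thesis using pos by (simp add: w_def)
  qed
  have Vnn: "V (w j) \<ge> 0" if "j \<in> K" for j
    unfolding V_def using wpos[OF that] harm_nonneg[where 'a = real]
    by (intro add_nonneg_nonneg mult_nonneg_nonneg divide_nonneg_nonneg sum_nonneg zero_le_power) auto
  have Snn: "S \<ge> 0" "Y \<ge> 0" unfolding S_def Y_def
    using wpos Vnn by (auto intro!: sum_nonneg mult_nonneg_nonneg simp: less_imp_le)
  have "(\<Sum>N\<in>Q ` X. r N) = (\<Sum>x\<in>X. real_of_int (w (fst x)))"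
    unfolding r_def by (rule sum.group) (use fin in auto)
  also have "\<dots> = (\<Sum>k\<in>K. \<Sum>y\<in>I \<times> I. real_of_int (w k))"
    unfolding X_def sum.cartesian_product by (intro sum.cong) auto
  also have "\<dots> = (real L)\<^sup>2 * S"
    by (simp add: S_def sum_distrib_left I_def power2_eq_square)
  finally have sum_r: "(\<Sum>N\<in>Q ` X. r N) = (real L)\<^sup>2 * S" .
  define E where "E = {(x, y) \<in> X \<times> X. Q x = Q y}"
  define J where "J = (\<lambda>(x::int \<times> int \<times> int, y::int \<times> int \<times> int). (fst x + fst y) div 2)"
  have finE: "finite E" unfolding E_def by (rule finite_subset[of _ "X \<times> X"]) (use fin in auto)
  have mid: "fst x + fst y = 2 * J (x, y)" "J (x, y) \<in> K"
      "(fst x - fst y) * w (J (x, y)) = q (snd y) - q (snd x)" if "(x, y) \<in> E" for x y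
  proof -
    have xy: "x \<in> X" "y \<in> X" "Q x = Q y" using that by (auto simp: E_def)
    have eq: "(fst x - fst y) * (a * (fst x + fst y) + b) = q (snd y) - q (snd x)"
      using xy(3) unfolding Q by (simp add: algebra_simps power2_eq_square)
    \<comment> \<open>Values of \<open>q\<close> are even, while the second factor is odd because
      \<open>a\<close> is even and \<open>b\<close> is odd. Hence the two first coordinates have the
      same parity.\<close>
    have "even ((fst x - fst y) * (a * (fst x + fst y) + b))" unfolding eq using evq by simp
    then have "even (fst x - fst y)" using a by simp
    then show s: "fst x + fst y = 2 * J (x, y)" by (auto simp: J_def)
    show "J (x, y) \<in> K" using xy s by (auto simp: X_def K_def)
    show "(fst x - fst y) * w (J (x, y)) = q (snd y) - q (snd x)"
      using eq unfolding s w_def by (simp add: mult.assoc mult.left_commute)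
  qed
  have "(\<Sum>N\<in>Q ` X. (r N)\<^sup>2) = (\<Sum>N\<in>Q ` X. \<Sum>(x, y)\<in>{e \<in> E. Q (fst e) = N}. real_of_int (w (fst x)) * real_of_int (w (fst y)))"
  proof (rule sum.cong[OF refl])
    fix N
    have "{x\<in>X. Q x = N} \<times> {x\<in>X. Q x = N} = {e \<in> E. Q (fst e) = N}" by (auto simp: E_def)
    then show "(r N)\<^sup>2 = (\<Sum>(x, y)\<in>{e \<in> E. Q (fst e) = N}. real_of_int (w (fst x)) * real_of_int (w (fst y)))"
      unfolding r_def power2_eq_square sum_product sum.cartesian_product by simp
  qed
  also have "\<dots> = (\<Sum>(x, y)\<in>E. real_of_int (w (fst x)) * real_of_int (w (fst y)))"
    by (rule sum.group) (use fin finE in \<open>auto simp: E_def\<close>)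
  also have "\<dots> \<le> (\<Sum>e\<in>E. (real_of_int (w (J e)))\<^sup>2)"
  proof (rule sum_mono)
    fix e assume "e \<in> E"
    then obtain x y where e: "e = (x, y)" "(x, y) \<in> E" by (cases e) auto
    have "w (fst x) + w (fst y) = 2 * a * (fst x + fst y) + 2 * b" by (simp add: w_def algebra_simps)
    also have "\<dots> = 2 * w (J e)" unfolding mid(1)[OF e(2)] e(1) w_def by (simp add: algebra_simps)
    finally have "real_of_int (w (fst x)) + real_of_int (w (fst y)) = 2 * real_of_int (w (J e))"
      by (metis of_int_add of_int_mult of_int_numeral)
    then have "real_of_int (w (J e)) = (real_of_int (w (fst x)) + real_of_int (w (fst y))) / 2" by simp
    then have "4 * (real_of_int (w (J e)))\<^sup>2 - 4 * (real_of_int (w (fst x)) * real_of_int (w (fst y))) =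
        (real_of_int (w (fst x)) - real_of_int (w (fst y)))\<^sup>2"
      by (simp only:) (simp add: power2_eq_square field_simps)
    then have "4 * (real_of_int (w (fst x)) * real_of_int (w (fst y))) \<le> 4 * (real_of_int (w (J e)))\<^sup>2"
      using zero_le_power2[of "real_of_int (w (fst x)) - real_of_int (w (fst y))"] by linarith
    then show "(case e of (x, y) \<Rightarrow> real_of_int (w (fst x)) * real_of_int (w (fst y))) \<le> (real_of_int (w (J e)))\<^sup>2"
      by (simp add: e(1))
  qed
  also have "\<dots> = (\<Sum>j\<in>K. \<Sum>e\<in>{e\<in>E. J e = j}. (real_of_int (w (J e)))\<^sup>2)"
    by (rule sum.group[symmetric]) (use fin finE mid(2) in auto)
  also have "\<dots> = (\<Sum>j\<in>K. real_of_int (w j) * (real_of_int (w j) * real (card {e\<in>E. J e = j})))"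
    by (simp add: power2_eq_square mult_ac)
  also have "\<dots> \<le> (\<Sum>j\<in>K. real_of_int (w j) * (real L ^ 4 * (1 + V (w j))))"
  proof (rule sum_mono)
    fix j assume j: "j \<in> K"
    let ?P = "{(x, y) \<in> (I \<times> I) \<times> (I \<times> I). int (nat (w j)) dvd q x - q y}"
    let ?g = "\<lambda>(x::int \<times> int \<times> int, y::int \<times> int \<times> int). (snd x, snd y)"
    \<comment> \<open>A pair over the midpoint \<open>j\<close> is determined by its last
      coordinates: its first coordinates have sum \<open>2 j\<close>, and their difference is the
      quotient of a difference of values of \<open>q\<close> by \<open>w j\<close>.\<close>
    have "inj_on ?g {e\<in>E. J e = j}"
    proof (rule inj_onI)
      fix e e' assume ee: "e \<in> {e\<in>E. J e = j}" "e' \<in> {e\<in>E. J e = j}" "?g e = ?g e'"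
      obtain x y where e: "e = (x, y)" by (cases e)
      obtain x' y' where e': "e' = (x', y')" by (cases e')
      have s: "snd x = snd x'" "snd y = snd y'" using ee e e' by auto
      have m: "fst x + fst y = 2 * j" "fst x' + fst y' = 2 * j"
          "(fst x - fst y) * w j = q (snd y) - q (snd x)" "(fst x' - fst y') * w j = q (snd y') - q (snd x')"
        using mid[of x y] mid[of x' y'] ee e e' by auto
      then have "(fst x - fst y) * w j = (fst x' - fst y') * w j" using s by simp
      then have "fst x - fst y = fst x' - fst y'" using wpos[OF j] by simp
      then have "fst x = fst x'" "fst y = fst y'" using m by linarith+
      then show "e = e'" using s e e' by (simp add: prod_eq_iff)
    qed
    moreover have "?g ` {e\<in>E. J e = j} \<subseteq> ?P"
    proof (rule image_subsetI)
      fix e assume "e \<in> {e\<in>E. J e = j}"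
      then obtain x y where e: "e = (x, y)" "(x, y) \<in> E" "J (x, y) = j" by (cases e) auto
      then have "(fst x - fst y) * w j = q (snd y) - q (snd x)" using mid(3)[OF e(2)] by simp
      then have "q (snd x) - q (snd y) = w j * (fst y - fst x)" by (simp add: algebra_simps)
      then have "int (nat (w j)) dvd q (snd x) - q (snd y)" using wpos[OF j] by simp
      then show "?g e \<in> ?P" using e(1,2) by (auto simp: E_def X_def)
    qed
    moreover have "finite ?P" by (rule finite_subset[of _ "(I \<times> I) \<times> (I \<times> I)"]) (use fin in auto)
    ultimately have "card {e\<in>E. J e = j} \<le> card ?P" by (rule card_inj_on_le)
    then have "real_of_int (w j) * real (card {e\<in>E. J e = j}) \<le> real (nat (w j)) * real (card ?P)"
      using wpos[OF j] by (intro mult_mono) auto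
    also have "\<dots> \<le> real L ^ 4 + 8 * real L ^ 4 * (\<Sum>d | d dvd nat (w j) \<and> d > 1. 1 / real d) +
        2 * real (nat (w j)) * ((3 * real L + real (nat (w j))) * harm (nat (w j)))\<^sup>2"
      unfolding I_def q_def
      by (rule card_congruent_pairs_le) (use wpos[OF j] cop in \<open>auto simp: w_def\<close>)
    also have "\<dots> = real L ^ 4 * (1 + V (w j))"
      using wpos[OF j] L by (simp add: V_def algebra_simps)
    finally show "real_of_int (w j) * (real_of_int (w j) * real (card {e\<in>E. J e = j})) \<le> real_of_int (w j) * (real L ^ 4 * (1 + V (w j)))"
      using wpos[OF j] by (intro mult_left_mono) auto
  qed
  also have "\<dots> = real L ^ 4 * (S + Y)"
    by (simp add: S_def Y_def sum_distrib_left sum_distrib_right sum.distrib algebra_simps)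
  finally have sum_r2: "(\<Sum>N\<in>Q ` X. (r N)\<^sup>2) \<le> real L ^ 4 * (S + Y)" .
  have "((real L)\<^sup>2 * S)\<^sup>2 \<le> real (card (Q ` X)) * (\<Sum>N\<in>Q ` X. (r N)\<^sup>2)"
    using Cauchy_Schwarz_ineq_sum[of "\<lambda>_. 1" r "Q ` X"] sum_r by simp
  also have "\<dots> \<le> real (card (Q ` X)) * (real L ^ 4 * (S + Y))"
    using sum_r2 by (intro mult_left_mono) auto
  finally have "real L ^ 4 * S\<^sup>2 \<le> real L ^ 4 * (real (card (Q ` X)) * (S + Y))"
    by (simp add: power_mult_distrib mult_ac flip: power_mult)
  then have main: "S\<^sup>2 \<le> real (card (Q ` X)) * (S + Y)" using L by simp
  \<comment> \<open>Cauchy-Schwarz bounds the number of values below by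
    \<open>S^2 / (S + Y)\<close>, which is at least \<open>S - Y\<close>.\<close>
  have "S - Y \<le> real (card (Q ` X))"
  proof (cases "S + Y > 0")
    case True
    have "(S - Y) * (S + Y) \<le> S\<^sup>2" by (simp add: algebra_simps power2_eq_square)
    then have "(S - Y) * (S + Y) \<le> real (card (Q ` X)) * (S + Y)" using main by linarith
    then show ?thesis using True by simp
  qed (use Snn in simp)
  then show ?thesis unfolding S_def Y_def X_def K_def I_def .
qed

text \<open>The solutions lie in one residue class modulo \<open>d\<close>, so the quotient of
  \<open>j - x\<close> by \<open>d\<close> determines \<open>j\<close>.\<close>

lemma card_linear_congruence_le:
  fixes c b x y d :: int
  assumes "coprime c d" "d > 0" "x \<le> y"
  shows "real (card {j\<in>{x..<y}. d dvd c * j + b}) \<le> of_int (y - x) / of_int d + 1"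
proof -
  let ?S = "{j\<in>{x..<y}. d dvd c * j + b}"
  have "inj_on (\<lambda>j. (j - x) div d) ?S"
  proof (rule inj_onI)
    fix i j assume ij: "i \<in> ?S" "j \<in> ?S" "(i - x) div d = (j - x) div d"
    then have "d dvd (c * i + b) - (c * j + b)" by (intro dvd_diff) auto
    then have "d dvd c * (i - j)" by (simp add: algebra_simps)
    then have "d dvd i - j" using assms by (simp add: coprime_commute coprime_dvd_mult_right_iff)
    then have "(i - x) mod d = (j - x) mod d" by (simp add: mod_eq_dvd_iff)
    then have "i - x = j - x" using ij(3) by (metis div_mult_mod_eq)
    then show "i = j" by simp
  qed
  then have "card ?S = card ((\<lambda>j. (j - x) div d) ` ?S)" by (simp add: card_image)
  also have "\<dots> \<le> card {0..(y - x) div d}"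
    using assms by (intro card_mono) (auto simp: pos_imp_zdiv_nonneg_iff intro!: zdiv_mono1)
  also have "\<dots> = nat ((y - x) div d + 1)" by simp
  finally have "real (card ?S) \<le> real (nat ((y - x) div d + 1))" by simp
  also have "\<dots> = of_int ((y - x) div d) + 1"
    using assms by (simp add: pos_imp_zdiv_nonneg_iff)
  also have "of_int ((y - x) div d) \<le> of_int (y - x) / (of_int d :: real)"
    using real_of_int_div4[of "y - x" d] by simp
  finally show ?thesis by simp
qed

text \<open>Telescoping with \<open>1 / (n + 1)^2 <= 1 / n - 1 / (n + 1)\<close>.\<close>

lemma sum_inverse_squares_le:
  assumes "W > 0"
  shows "(\<Sum>d\<in>{W<..n}. 1 / (real d)\<^sup>2) \<le> 1 / real W"
proof -
  have "(\<Sum>d\<in>{W<..n}. 1 / (real d)\<^sup>2) \<le> 1 / real W - 1 / real n" if "W \<le> n" for n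
    using that
  proof (induction n rule: dec_induct)
    case (step n)
    have "{W<..Suc n} = insert (Suc n) {W<..n}" using step by auto
    then have "(\<Sum>d\<in>{W<..Suc n}. 1 / (real d)\<^sup>2) = 1 / (real (Suc n))\<^sup>2 + (\<Sum>d\<in>{W<..n}. 1 / (real d)\<^sup>2)"
      by simp
    also have "1 / (real (Suc n))\<^sup>2 \<le> 1 / (real n * real (Suc n))"
      using step assms by (intro divide_left_mono) (auto simp: power2_eq_square intro!: mult_right_mono)
    also have "\<dots> = 1 / real n - 1 / real (Suc n)" using step assms by (simp add: field_simps)
    finally show ?case using step by linarith
  qed simp
  then show ?thesis
    using assms by (cases "W \<le> n") (fastforce intro: order_trans)+
qed

lemma coprime_intI:
  fixes x y :: int
  assumes "x \<noteq> 0" and "\<And>p. prime p \<Longrightarrow> p dvd x \<Longrightarrow> p dvd y \<Longrightarrow> False"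
  shows "coprime x y"
proof (rule ccontr)
  assume "\<not> coprime x y"
  then have "\<not> is_unit (gcd x y)" by (metis is_unit_gcd)
  moreover have "gcd x y \<noteq> 0" using assms by simp
  ultimately obtain p where "prime p" "p dvd gcd x y" using prime_divisor_exists by blast
  then show False using assms(2) by auto
qed

text \<open>A prime dividing both \<open>2 a\<close> and \<open>2 a j + b\<close> would divide
  \<open>a\<close> and \<open>b\<close>; so divisors \<open>d > 1\<close> of
  \<open>2 a j + b\<close> are prime to \<open>2 a\<close> and contain only primes above
  \<open>W\<close>, whence \<open>d > W\<close>. After exchanging the sums, each such
  \<open>d\<close> occurs for at most \<open>A1 / d + 1\<close> of the \<open>j\<close>, and the
  tail of the sum of \<open>1/d^2\<close> gives the factor \<open>1/W\<close>.\<close>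

lemma sum_divisors_linear_le:
  fixes a b A0 A1 :: int and W D :: nat
  assumes cop: "coprime a b" "even a" and small: "\<And>p::int. prime p \<Longrightarrow> p \<le> int W \<Longrightarrow> p dvd a"
    and pos: "\<And>j. j \<in> {A0..<A1} \<Longrightarrow> 0 < 2 * a * j + b \<and> 2 * a * j + b \<le> int D"
    and W: "W > 0" and A: "0 \<le> A0" "A0 \<le> A1" and a: "a > 0"
  shows "(\<Sum>j\<in>{A0..<A1}. \<Sum>d | d dvd nat (2 * a * j + b) \<and> d > 1. 1 / real d) \<le>
    of_int A1 / real W + harm D"
proof -
  have dW: "d > W \<and> d \<le> D \<and> coprime (2 * a) (int d)"
    if d: "d dvd nat (2 * a * j + b)" "d > 1" and j: "j \<in> {A0..<A1}" for d j
  proof -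
    have d': "int d dvd 2 * a * j + b" using d(1) pos[OF j] by (metis int_dvd_int_iff int_nat_eq less_le)
    have nop: False if "prime p" "p dvd a" "p dvd int d" for p :: int
    proof -
      have "p dvd 2 * a * j + b" using that d' dvd_trans by blast
      then have "p dvd b" using that by (simp add: dvd_add_right_iff)
      then show False using that cop(1) by (meson coprime_common_divisor not_prime_unit)
    qed
    have "\<not> is_unit (int d)" "int d \<noteq> 0" using d by auto
    then obtain p where p: "prime p" "p dvd int d" using prime_divisor_exists by blast
    have "p > int W" using nop small p by (meson not_le)
    moreover have "p \<le> int d" using p d by (intro zdvd_imp_le) auto
    moreover have "int d \<le> int D" using zdvd_imp_le[OF d'] pos[OF j] by auto
    moreover have "coprime (2 * a) (int d)"
    proof (rule coprime_intI)
      fix p :: int assume "prime p" "p dvd 2 * a" "p dvd int d"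
      moreover from this have "p dvd a" using cop(2) by (auto simp: prime_dvd_mult_iff intro: dvd_trans)
      ultimately show False using nop by blast
    qed (use a in auto)
    ultimately show ?thesis by auto
  qed
  have "(\<Sum>j\<in>{A0..<A1}. \<Sum>d | d dvd nat (2 * a * j + b) \<and> d > 1. 1 / real d) =
      (\<Sum>j\<in>{A0..<A1}. \<Sum>d\<in>{W<..D}. if coprime (2 * a) (int d) \<and> int d dvd 2 * a * j + b then 1 / real d else 0)"
  proof (rule sum.cong[OF refl])
    fix j assume j: "j \<in> {A0..<A1}"
    have "{d. d dvd nat (2 * a * j + b) \<and> d > 1} =
        {d\<in>{W<..D}. coprime (2 * a) (int d) \<and> int d dvd 2 * a * j + b}"
    proof -
      have "d dvd nat (2 * a * j + b) \<longleftrightarrow> int d dvd 2 * a * j + b" for d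
        using pos[OF j] by (simp flip: int_dvd_int_iff)
      then show ?thesis using dW[OF _ _ j] W by auto
    qed
    then show "(\<Sum>d | d dvd nat (2 * a * j + b) \<and> d > 1. 1 / real d) =
      (\<Sum>d\<in>{W<..D}. if coprime (2 * a) (int d) \<and> int d dvd 2 * a * j + b then 1 / real d else 0)"
      by (simp only:) (rule sum.inter_filter, simp)
  qed
  also have "\<dots> = (\<Sum>d\<in>{W<..D}. \<Sum>j\<in>{A0..<A1}. if coprime (2 * a) (int d) \<and> int d dvd 2 * a * j + b then 1 / real d else 0)"
    by (rule sum.swap)
  also have "\<dots> \<le> (\<Sum>d\<in>{W<..D}. of_int A1 * (1 / (real d)\<^sup>2) + 1 / real d)"
  proof (rule sum_mono)
    fix d assume d: "d \<in> {W<..D}"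
    show "(\<Sum>j\<in>{A0..<A1}. if coprime (2 * a) (int d) \<and> int d dvd 2 * a * j + b then 1 / real d else 0)
        \<le> of_int A1 * (1 / (real d)\<^sup>2) + 1 / real d"
    proof (cases "coprime (2 * a) (int d)")
      case True
      have "(\<Sum>j\<in>{A0..<A1}. if coprime (2 * a) (int d) \<and> int d dvd 2 * a * j + b then 1 / real d else 0) =
          (\<Sum>j\<in>{j\<in>{A0..<A1}. int d dvd 2 * a * j + b}. 1 / real d)"
        using True by (simp only: simp_thms) (rule sum.inter_filter[symmetric], simp)
      also have "\<dots> = real (card {j\<in>{A0..<A1}. int d dvd 2 * a * j + b}) * (1 / real d)" by simp
      also have "\<dots> \<le> (of_int (A1 - A0) / of_int (int d) + 1) * (1 / real d)"
        using d A by (intro mult_right_mono card_linear_congruence_le True) auto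
      also have "\<dots> \<le> (of_int A1 / of_int (int d) + 1) * (1 / real d)"
        using A by (intro mult_right_mono add_mono divide_right_mono) auto
      also have "\<dots> = of_int A1 * (1 / (real d)\<^sup>2) + 1 / real d"
        by (simp add: add_divide_distrib power2_eq_square)
      finally show ?thesis .
    next
      case False
      then have "(\<Sum>j\<in>{A0..<A1}. if coprime (2 * a) (int d) \<and> int d dvd 2 * a * j + b then 1 / real d else 0) = 0"
        by (intro sum.neutral) auto
      then show ?thesis using A by simp
    qed
  qed
  also have "\<dots> = of_int A1 * (\<Sum>d\<in>{W<..D}. 1 / (real d)\<^sup>2) + (\<Sum>d\<in>{W<..D}. 1 / real d)"
    by (simp add: sum.distrib sum_distrib_left)
  also have "\<dots> \<le> of_int A1 * (1 / real W) + harm D"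
  proof (intro add_mono mult_left_mono sum_inverse_squares_le W)
    show "(\<Sum>d\<in>{W<..D}. 1 / real d) \<le> harm D"
      unfolding harm_def inverse_eq_divide by (rule sum_mono2) (use W in auto)
  qed (use A in auto)
  finally show ?thesis by simp
qed

lemma harm_le_ln: "n > 0 \<Longrightarrow> harm n \<le> 1 + ln (real n)"
proof (induction n rule: nat_induct_non_zero)
  case (Suc n)
  have "ln (real (Suc n)) - ln (real n) = - ln (real n / real (Suc n))"
    using Suc by (simp add: ln_div)
  moreover have "ln (real n / real (Suc n)) \<le> real n / real (Suc n) - 1"
    using Suc by (intro ln_le_minus_one) simp
  moreover have "real n / real (Suc n) - 1 = - inverse (real (Suc n))" by (simp add: field_simps)
  ultimately show ?case using Suc by (simp add: harm_Suc)
qed (simp add: harm_def)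

definition ternary_poly :: "int \<Rightarrow> int \<Rightarrow> int \<Rightarrow> int \<Rightarrow> int \<Rightarrow> int \<Rightarrow> int \<times> int \<times> int \<Rightarrow> int" where
  "ternary_poly a b a2 b2 a3 b3 = (\<lambda>(k, l, m). (a * k\<^sup>2 + b * k) + ((a2 * l\<^sup>2 + b2 * l) + (a3 * m\<^sup>2 + b3 * m)))"

text \<open>The values taken on the box lie between \<open>lo\<close> and \<open>hi\<close>, an
  interval whose length is close to the sum of the weights, and \<open>card_values_ge\<close> shows
  that they nearly fill it. The bound collects the initial segment up to the value at
  \<open>A0\<close>, the widening \<open>2 C L^2\<close> of the interval, the difference between the
  sum of the derivative and the increment of the polynomial, and the variance term.\<close>

lemma card_nonvalues_le:
  fixes a b a2 b2 a3 b3 A0 A1 X :: int and L W D :: nat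
  assumes a: "a > 0" "even a" "odd b" "coprime a b"
    and ev: "even a2" "even b2" "even a3" "even b3" "a2 \<noteq> 0" "a3 \<noteq> 0"
    and pr: "\<And>p. prime p \<Longrightarrow> p dvd a2 * a3 \<Longrightarrow> p dvd a"
    and small: "\<And>p::int. prime p \<Longrightarrow> p \<le> int W \<Longrightarrow> p dvd a" and W: "W > 0"
    and pos: "2 * a * A0 + b > 0" "0 \<le> A0" "A0 \<le> A1" "0 \<le> a * A0 + b"
    and D: "2 * a * A1 + b \<le> int D" and L: "L > 0"
    and X: "X \<le> a * A1\<^sup>2 + b * A1"
  defines "C \<equiv> \<bar>a2\<bar> + \<bar>b2\<bar> + \<bar>a3\<bar> + \<bar>b3\<bar>"
  shows "real (card {N\<in>{1..X}. N \<notin> range (ternary_poly a b a2 b2 a3 b3)}) \<le>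
    of_int (a * A0\<^sup>2 + b * A0 + a * A1 + 2 * C * (int L)\<^sup>2 + 1) +
    real D * (8 * (of_int A1 / real W + harm D) +
      of_int A1 * (2 * real D * ((3 * real L + real D) * harm D)\<^sup>2 / real L ^ 4))"
proof -
  let ?Q = "ternary_poly a b a2 b2 a3 b3"
  let ?F = "\<lambda>k. a * k\<^sup>2 + b * k"
  let ?w = "\<lambda>j. 2 * a * j + b"
  let ?K = "{A0..<A1}"
  define V where "V = (\<lambda>w::int. 8 * (\<Sum>d | d dvd nat w \<and> d > 1. 1 / real d) +
    2 * of_int w * ((3 * real L + of_int w) * harm (nat w))\<^sup>2 / real L ^ 4)"
  define Im where "Im = ?Q ` (?K \<times> {0..<int L} \<times> {0..<int L})"
  have cop: "coprime (2 * c) (2 * a * j + b)" if c: "c = a2 \<or> c = a3" for c j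
  proof (rule coprime_intI)
    fix p :: int assume p: "prime p" "p dvd 2 * c" "p dvd 2 * a * j + b"
    have "p dvd a"
    proof (cases "p dvd 2")
      case True then show ?thesis using a(2) by (rule dvd_trans)
    next
      case False
      then have "p dvd c" using p by (simp add: prime_dvd_mult_iff)
      then show ?thesis using pr[OF p(1)] c by auto
    qed
    moreover from this have "p dvd b" using p(3) by (simp add: dvd_add_right_iff)
    ultimately show False using a(4) p(1) by (meson coprime_common_divisor not_prime_unit)
  qed (use c ev in auto)
  have w: "0 < ?w j \<and> ?w j \<le> int D" if "j \<in> ?K" for j
  proof -
    have "2 * a * A0 \<le> 2 * a * j" "2 * a * j \<le> 2 * a * A1"
      using that a by (auto intro!: mult_left_mono)
    then show ?thesis using pos D by linarith
  qed
  have F: "?F y - ?F x = (y - x) * (a * (x + y) + b)" for x y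
    by (simp add: algebra_simps power2_eq_square)
  have Fmono: "?F x \<le> ?F y" if "A0 \<le> x" "x \<le> y" for x y
  proof -
    have "a * (2 * A0) \<le> a * (x + y)" using that a by (intro mult_left_mono) auto
    then have "0 \<le> (y - x) * (a * (x + y) + b)" using that pos(1) by (intro mult_nonneg_nonneg) auto
    then show ?thesis using F[of y x] by linarith
  qed
  \<comment> \<open>Together the polynomials in \<open>l\<close> and \<open>m\<close> are at most
    \<open>C L^2\<close> in absolute value on the box.\<close>
  define lo where "lo = ?F A0 - C * (int L)\<^sup>2"
  define hi where "hi = ?F A1 + C * (int L)\<^sup>2"
  have poly: "\<bar>e * l\<^sup>2 + g * l\<bar> \<le> (\<bar>e\<bar> + \<bar>g\<bar>) * (int L)\<^sup>2" if "l \<in> {0..<int L}" for e g l :: int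
  proof -
    have "int L \<le> (int L)\<^sup>2" using L by (intro self_le_power) auto
    moreover have "l \<le> int L" "0 \<le> l" using that by auto
    ultimately have l2: "l\<^sup>2 \<le> (int L)\<^sup>2" "l \<le> (int L)\<^sup>2"
      by (auto intro: power_mono order_trans simp del: of_nat_power_eq_of_nat_cancel_iff)
    have "\<bar>e * l\<^sup>2 + g * l\<bar> \<le> \<bar>e\<bar> * l\<^sup>2 + \<bar>g\<bar> * l"
      using abs_triangle_ineq[of "e * l\<^sup>2" "g * l"] that by (simp add: abs_mult)
    also have "\<dots> \<le> \<bar>e\<bar> * (int L)\<^sup>2 + \<bar>g\<bar> * (int L)\<^sup>2"
      using l2 by (intro add_mono mult_left_mono) auto
    finally show ?thesis by (simp add: distrib_right)
  qed
  have Im: "Im \<subseteq> {lo..hi}"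
  proof
    fix N assume "N \<in> Im"
    then obtain k l m where k: "k \<in> ?K" "l \<in> {0..<int L}" "m \<in> {0..<int L}"
        "N = ?F k + ((a2 * l\<^sup>2 + b2 * l) + (a3 * m\<^sup>2 + b3 * m))"
      by (auto simp: Im_def ternary_poly_def)
    have "\<bar>a2 * l\<^sup>2 + b2 * l\<bar> + \<bar>a3 * m\<^sup>2 + b3 * m\<bar> \<le> C * (int L)\<^sup>2"
      using poly[OF k(2), of a2 b2] poly[OF k(3), of a3 b3] by (simp add: C_def algebra_simps)
    moreover have "?F A0 \<le> ?F k" "?F k \<le> ?F A1" using k Fmono by auto
    ultimately show "N \<in> {lo..hi}" unfolding lo_def hi_def k(4) by auto
  qed
  have finIm: "finite Im" by (rule finite_subset[OF Im]) simp
  have C0: "C * (int L)\<^sup>2 \<ge> 0" by (simp add: C_def)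
  have sub: "{N\<in>{1..X}. N \<notin> range ?Q} \<subseteq> {1..?F A0} \<union> ({lo..hi} - Im)"
    using X C0 by (auto simp: lo_def hi_def Im_def)
  have F0: "?F A0 \<ge> 0" using pos(2,4) by (simp add: power2_eq_square flip: mult.assoc distrib_right)
  have "card {N\<in>{1..X}. N \<notin> range ?Q} \<le> card ({1..?F A0} \<union> ({lo..hi} - Im))"
    by (rule card_mono[OF _ sub]) simp
  also have "\<dots> \<le> card {1..?F A0} + card ({lo..hi} - Im)" by (rule card_Un_le)
  also have "card ({lo..hi} - Im) = card {lo..hi} - card Im" by (rule card_Diff_subset[OF finIm Im])
  finally have "card {N\<in>{1..X}. N \<notin> range ?Q} \<le> nat (?F A0) + (card {lo..hi} - card Im)" by simp
  then have "real (card {N\<in>{1..X}. N \<notin> range ?Q}) \<le> real (nat (?F A0)) + real (card {lo..hi} - card Im)"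
    by (metis of_nat_add of_nat_mono)
  also have "real (nat (?F A0)) = of_int (?F A0)" using F0 by simp
  also have "real (card {lo..hi} - card Im) = real (card {lo..hi}) - real (card Im)"
    by (intro of_nat_diff card_mono Im) simp
  also have "real (card {lo..hi}) = of_int (?F A1 - ?F A0 + 2 * (C * (int L)\<^sup>2) + 1)"
    using Fmono[OF order_refl pos(3)] C0 by (simp add: lo_def hi_def)
  \<comment> \<open>One step from \<open>j\<close> to \<open>j + 1\<close> increases the polynomial
    by \<open>2 a j + b + a\<close>, that is, by the weight plus \<open>a\<close>.\<close>
  also have "?F A1 - ?F A0 = (\<Sum>j\<in>?K. ?w j) + a * (A1 - A0)"
  proof -
    have "?F (A0 + int n) - ?F A0 = (\<Sum>j\<in>{A0..<A0 + int n}. ?w j) + a * int n" for n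
    proof (induction n)
      case (Suc n)
      have "{A0..<A0 + int (Suc n)} = insert (A0 + int n) {A0..<A0 + int n}" by auto
      then show ?case using Suc by (simp add: algebra_simps power2_eq_square)
    qed simp
    from this[of "nat (A1 - A0)"] show ?thesis using pos(3) by simp
  qed
  finally have 1: "real (card {N\<in>{1..X}. N \<notin> range ?Q}) \<le> of_int (?F A0) +
      (of_int ((\<Sum>j\<in>?K. ?w j) + a * (A1 - A0) + 2 * (C * (int L)\<^sup>2) + 1) - real (card Im))" by simp
  have 2: "(\<Sum>j\<in>?K. of_int (?w j)) - (\<Sum>j\<in>?K. of_int (?w j) * V (?w j)) \<le> real (card Im)"
    unfolding Im_def V_def ternary_poly_def
    by (rule card_values_ge) (use a ev cop pos L in auto)
  have "(\<Sum>j\<in>?K. of_int (?w j) * V (?w j)) \<le> (\<Sum>j\<in>?K. real D * (8 * (\<Sum>d | d dvd nat (?w j) \<and> d > 1. 1 / real d) +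
      2 * real D * ((3 * real L + real D) * harm D)\<^sup>2 / real L ^ 4))"
  proof (rule sum_mono)
    fix j assume j: "j \<in> ?K"
    have r: "real_of_int (?w j) \<le> real D" "0 < real_of_int (?w j)"
      using w[OF j] by (metis of_int_le_iff of_int_of_nat_eq, metis of_int_0_less_iff)
    have h: "harm (nat (?w j)) \<le> (harm D :: real)" using w[OF j] by (intro harm_mono) (auto simp: nat_le_iff)
    have hn: "0 \<le> (harm n :: real)" for n by (rule harm_nonneg)
    show "of_int (?w j) * V (?w j) \<le> real D * (8 * (\<Sum>d | d dvd nat (?w j) \<and> d > 1. 1 / real d) +
      2 * real D * ((3 * real L + real D) * harm D)\<^sup>2 / real L ^ 4)"
      unfolding V_def
      using r h hn[of D] hn[of "nat (?w j)"]
      by (intro mult_mono add_mono divide_right_mono power_mono order_refl add_nonneg_nonneg mult_nonneg_nonneg divide_nonneg_nonneg sum_nonneg zero_le_power) auto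
  qed
  also have "\<dots> = real D * (8 * (\<Sum>j\<in>?K. \<Sum>d | d dvd nat (?w j) \<and> d > 1. 1 / real d) +
      of_int (A1 - A0) * (2 * real D * ((3 * real L + real D) * harm D)\<^sup>2 / real L ^ 4))"
    using pos(3) by (simp add: sum.distrib flip: sum_distrib_left)
  also have "\<dots> \<le> real D * (8 * (of_int A1 / real W + harm D) +
      of_int A1 * (2 * real D * ((3 * real L + real D) * harm D)\<^sup>2 / real L ^ 4))"
    using pos by (intro mult_left_mono add_mono mult_right_mono sum_divisors_linear_le a(1,2,4) small w W divide_nonneg_nonneg) auto
  finally have 3: "(\<Sum>j\<in>?K. of_int (?w j) * V (?w j)) \<le> real D * (8 * (of_int A1 / real W + harm D) +
      of_int A1 * (2 * real D * ((3 * real L + real D) * harm D)\<^sup>2 / real L ^ 4))" .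
  have "real_of_int (a * (A1 - A0)) \<le> of_int (a * A1)"
    using a pos by (simp add: mult_left_mono)
  then show ?thesis using 1 2 3 by simp
qed

text \<open>Here \<open>k\<close> runs from \<open>L = A div t\<close> to \<open>A\<close>. Starting
  at \<open>L\<close> keeps the derivative positive, and a large fixed \<open>t\<close> makes all
  terms of order \<open>L^2\<close> at most \<open>\<delta> / 2\<close> times \<open>A^2\<close>. As
  \<open>L >= A / (2 t)\<close>, the Weyl error is of order \<open>A log^2 A\<close> for fixed
  \<open>t\<close>; \<open>R\<close> collects it with the other terms of lower order. The divisor
  sums produce the term with \<open>1/W\<close>.\<close>

lemma card_nonvalues_asymptotic:
  fixes a b a2 b2 a3 b3 :: int and W :: nat and \<delta> :: real
  assumes a: "a > 0" "even a" "odd b" "coprime a b"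
    and ev: "even a2" "even b2" "even a3" "even b3" "a2 \<noteq> 0" "a3 \<noteq> 0"
    and pr: "\<And>p. prime p \<Longrightarrow> p dvd a2 * a3 \<Longrightarrow> p dvd a"
    and small: "\<And>p::int. prime p \<Longrightarrow> p \<le> int W \<Longrightarrow> p dvd a" and W: "W > 0"
    and \<delta>: "\<delta> > 0"
  shows "\<forall>\<^sub>F A in sequentially. \<forall>X \<le> a * (int A)\<^sup>2 + b * int A.
    real (card {N\<in>{1..X}. N \<notin> range (ternary_poly a b a2 b2 a3 b3)}) \<le> (24 * of_int a / real W + \<delta>) * (real A)\<^sup>2"
proof -
  define C where "C = \<bar>a2\<bar> + \<bar>b2\<bar> + \<bar>a3\<bar> + \<bar>b3\<bar>"
  \<comment> \<open>The total coefficient of \<open>L^2\<close>; \<open>t\<close> is chosen so that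
    \<open>c / t^2 <= \<delta> / 2\<close>.\<close>
  define c where "c = real_of_int a + 2 * of_int C"
  have c0: "c > 0" using a by (simp add: c_def C_def add_pos_nonneg)
  obtain t0 :: nat where t0: "2 * c / \<delta> < real t0" using reals_Archimedean2 by blast
  define t where "t = Suc t0"
  have t: "t > 0" by (simp add: t_def)
  have tc: "c / (real t)\<^sup>2 \<le> \<delta> / 2"
  proof -
    have "2 * c / \<delta> \<le> real t * 1" using t0 by (simp add: t_def)
    also have "\<dots> \<le> real t * real t" using t by (intro mult_left_mono) auto
    finally show ?thesis using t \<delta> by (simp add: field_simps power2_eq_square)
  qed
  define al where "al = real_of_int a"
  have al: "al \<ge> 1" using a by (simp add: al_def)
  define h where "h A = 1 + ln (3 * al * real A)" for A :: nat
  \<comment> \<open>With \<open>D = 3 a A\<close> the factor \<open>2 D^2\<close> is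
    \<open>18 a^2 A^2\<close>; the square of \<open>3 + 3 a\<close> bounds \<open>3 L + D\<close>
    relative to \<open>A\<close>, and \<open>16 t^4\<close> comes from
    \<open>L >= A / (2 t)\<close>.\<close>
  define k1 where "k1 = 18 * al\<^sup>2 * (3 + 3 * al)\<^sup>2 * 16 * real t ^ 4"
  define R where "R A = 1 + (real_of_int \<bar>b\<bar> + al) * real A + 24 * al * real A * h A + k1 * real A * (h A)\<^sup>2" for A
  have lim: "(\<lambda>A. R A / (real A)\<^sup>2) \<longlonglongrightarrow> 0"
  proof -
    have c4: "3 * al > 0" using al by simp
    have 1: "(\<lambda>A::nat. 1 / (real A)\<^sup>2) \<longlonglongrightarrow> 0" by real_asymp
    have 2: "(\<lambda>A::nat. real A / (real A)\<^sup>2) \<longlonglongrightarrow> 0" by real_asymp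
    have 3: "(\<lambda>A::nat. real A * (1 + ln (3 * al * real A)) / (real A)\<^sup>2) \<longlonglongrightarrow> 0"
      using c4 by real_asymp
    have 4: "(\<lambda>A::nat. real A * (1 + ln (3 * al * real A))\<^sup>2 / (real A)\<^sup>2) \<longlonglongrightarrow> 0"
      using c4 by real_asymp
    have "(\<lambda>A. 1 / (real A)\<^sup>2 + (real_of_int \<bar>b\<bar> + al) * (real A / (real A)\<^sup>2) +
        24 * al * (real A * (1 + ln (3 * al * real A)) / (real A)\<^sup>2) +
        k1 * (real A * (1 + ln (3 * al * real A))\<^sup>2 / (real A)\<^sup>2)) \<longlonglongrightarrow>
        0 + (real_of_int \<bar>b\<bar> + al) * 0 + 24 * al * 0 + k1 * 0"
      by (intro tendsto_intros 1 2 3 4)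
    then show ?thesis by (simp add: R_def h_def add_divide_distrib mult.assoc)
  qed
  have "\<forall>\<^sub>F A in sequentially. R A / (real A)\<^sup>2 < \<delta> / 2"
    using \<delta> by (intro order_tendstoD(2)[OF lim]) simp
  moreover have "\<forall>\<^sub>F A in sequentially. A \<ge> 2 * t * (nat \<bar>b\<bar> + 1)" by (rule eventually_ge_at_top)
  ultimately show ?thesis
  proof eventually_elim
    case (elim A)
    define L where "L = A div t"
    \<comment> \<open>\<open>3 a A\<close> exceeds the derivative \<open>2 a A + b\<close> because
      \<open>|b| < L <= A\<close>. This 3 times the 8 of the divisor sums is the 24 of the
      statement.\<close>
    define D where "D = nat (3 * a * int A)"
    have "t * 2 \<le> t * (2 * (nat \<bar>b\<bar> + 1))" by (intro mult_left_mono) auto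
    then have At: "2 * t \<le> A" using elim(2) by (simp add: algebra_simps)
    have A0: "A > 0" using At t by simp
    have Lb: "nat \<bar>b\<bar> + 1 \<le> L"
    proof -
      have "(nat \<bar>b\<bar> + 1) * t \<le> A" using elim(2) by (simp add: algebra_simps)
      then show ?thesis unfolding L_def using t by (simp add: less_eq_div_iff_mult_less_eq)
    qed
    have Lb': "\<bar>b\<bar> < int L" using Lb by linarith
    have LA: "L \<le> A" by (simp add: L_def)
    have Lle: "real L \<le> real A / real t" unfolding L_def by (rule of_nat_div_le_of_nat)
    have Lge: "real A / (2 * real t) \<le> real L"
    proof -
      have "A < t * (L + 1)" unfolding L_def using t dividend_less_times_div[OF t, of A] by simp
      then have "real A < real t * (real L + 1)" by (metis of_nat_less_iff of_nat_mult of_nat_add of_nat_1)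
      then have "real A / real t < real L + 1" using t by (simp add: field_simps)
      moreover have "2 \<le> real A / real t" using At t by (simp add: field_simps)
      moreover have "real A / (2 * real t) = (real A / real t) / 2" by simp
      ultimately show ?thesis by argo
    qed
    have aL: "int L \<le> a * int L" "int A \<le> a * int A"
      using mult_right_mono[of 1 a "int L"] mult_right_mono[of 1 a "int A"] a(1) by auto
    have D: "real D = 3 * al * real A" using a by (simp add: D_def al_def)
    have D0: "D > 0" using a A0 by (simp add: D_def)
    have harmD: "harm D \<le> h A" using harm_le_ln[OF D0] D by (simp add: h_def)
    have harm0: "0 \<le> (harm D :: real)" by (rule harm_nonneg)
    have Rle: "R A \<le> \<delta> / 2 * (real A)\<^sup>2"
      using elim(1) A0 by (simp add: field_simps)
    show ?case
    proof (intro allI impI)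
      fix X assume X: "X \<le> a * (int A)\<^sup>2 + b * int A"
      have "2 * a * int A + b \<le> int D"
        using Lb' LA aL(2) a(1) by (simp add: D_def)
      then have "real (card {N\<in>{1..X}. N \<notin> range (ternary_poly a b a2 b2 a3 b3)}) \<le>
        of_int (a * (int L)\<^sup>2 + b * int L + a * int A + 2 * C * (int L)\<^sup>2 + 1) +
        real D * (8 * (of_int (int A) / real W + harm D) +
        of_int (int A) * (2 * real D * ((3 * real L + real D) * harm D)\<^sup>2 / real L ^ 4))"
        unfolding C_def using Lb' LA aL
        by (intro card_nonvalues_le a ev pr small W X) (auto; linarith)+
      also have "of_int (a * (int L)\<^sup>2 + b * int L + a * int A + 2 * C * (int L)\<^sup>2 + 1) =
          c * (real L)\<^sup>2 + of_int b * real L + al * real A + 1"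
        by (simp add: c_def al_def algebra_simps)
      also have "\<dots> \<le> c * (real A / real t)\<^sup>2 + of_int \<bar>b\<bar> * real A + al * real A + 1"
        using c0 Lle LA by (intro add_mono mult_left_mono mult_mono power_mono order_refl) auto
      also have "c * (real A / real t)\<^sup>2 = c / (real t)\<^sup>2 * (real A)\<^sup>2" by (simp add: power_divide)
      also have "\<dots> \<le> \<delta> / 2 * (real A)\<^sup>2" using tc by (intro mult_right_mono) auto
      also have "real D * (8 * (of_int (int A) / real W + harm D) +
        of_int (int A) * (2 * real D * ((3 * real L + real D) * harm D)\<^sup>2 / real L ^ 4)) \<le>
        24 * al / real W * (real A)\<^sup>2 + 24 * al * real A * h A + k1 * real A * (h A)\<^sup>2"
      proof -
        have "((3 * real L + real D) * harm D)\<^sup>2 / real L ^ 4 \<le>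
            (((3 + 3 * al) * real A) * h A)\<^sup>2 / (real A / (2 * real t)) ^ 4"
          using LA Lge harmD harm0 al A0 t D
          by (intro frac_le power_mono mult_mono) (auto simp: algebra_simps)
        also have "\<dots> = (3 + 3 * al)\<^sup>2 * 16 * real t ^ 4 * (h A)\<^sup>2 / (real A)\<^sup>2"
        proof -
          have "((g * x) * y)\<^sup>2 / (x / (2 * z)) ^ 4 = g\<^sup>2 * 16 * z ^ 4 * y\<^sup>2 / x\<^sup>2"
            if "x > 0" "z > 0" for g x y z :: real
            using that by (simp add: power_divide power_mult_distrib field_simps flip: power_add)
          then show ?thesis using A0 t by simp
        qed
        finally have "18 * al\<^sup>2 * real A ^ 3 * (((3 * real L + real D) * harm D)\<^sup>2 / real L ^ 4) \<le>
            18 * al\<^sup>2 * real A ^ 3 * ((3 + 3 * al)\<^sup>2 * 16 * real t ^ 4 * (h A)\<^sup>2 / (real A)\<^sup>2)"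
          by (intro mult_left_mono) auto
        also have "\<dots> = k1 * real A * (h A)\<^sup>2"
          using A0 by (simp add: k1_def field_simps power2_eq_square power3_eq_cube)
        finally have 1: "18 * al\<^sup>2 * real A ^ 3 * (((3 * real L + real D) * harm D)\<^sup>2 / real L ^ 4) \<le> k1 * real A * (h A)\<^sup>2" .
        have 2: "24 * al * real A * harm D \<le> 24 * al * real A * h A"
          using harmD al by (intro mult_left_mono) auto
        define Z where "Z = ((3 * real L + real D) * harm D)\<^sup>2 / real L ^ 4"
        have "real D * (8 * (of_int (int A) / real W + harm D) + of_int (int A) * (2 * real D * Z)) =
            24 * al / real W * (real A)\<^sup>2 + 24 * al * real A * harm D + 18 * al\<^sup>2 * real A ^ 3 * Z"
          unfolding D using W by (simp add: field_simps power2_eq_square power3_eq_cube)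
        then show ?thesis using 1 2 unfolding Z_def by simp
      qed
      finally have "real (card {N\<in>{1..X}. N \<notin> range (ternary_poly a b a2 b2 a3 b3)}) \<le>
          \<delta> / 2 * (real A)\<^sup>2 + R A + 24 * al / real W * (real A)\<^sup>2"
        by (simp add: R_def algebra_simps)
      also have "\<dots> \<le> (24 * of_int a / real W + \<delta>) * (real A)\<^sup>2"
        using Rle by (simp add: al_def algebra_simps)
      finally show "real (card {N\<in>{1..X}. N \<notin> range (ternary_poly a b a2 b2 a3 b3)}) \<le>
        (24 * of_int a / real W + \<delta>) * (real A)\<^sup>2" .
    qed
  qed
qed

text \<open>With \<open>A\<close> of size \<open>sqrt (X / a)\<close>, the product
  \<open>a A^2\<close> is a multiple of \<open>X\<close>, so the missed proportion is bounded in
  terms of \<open>W\<close> alone. This matters since \<open>a\<close> depends on \<open>W\<close>: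
  it must be divisible by all primes up to \<open>W\<close>. The 96 is 24 times the square of the 2
  in \<open>A <= 2 s X\<close>.\<close>

theorem ternary_nonvalues_sparse:
  fixes a b a2 b2 a3 b3 :: int and W :: nat and \<epsilon> :: real
  assumes a: "a > 0" "even a" "odd b" "coprime a b"
    and ev: "even a2" "even b2" "even a3" "even b3" "a2 \<noteq> 0" "a3 \<noteq> 0"
    and pr: "\<And>p. prime p \<Longrightarrow> p dvd a2 * a3 \<Longrightarrow> p dvd a"
    and small: "\<And>p::int. prime p \<Longrightarrow> p \<le> int W \<Longrightarrow> p dvd a" and W: "W > 0"
    and \<epsilon>: "\<epsilon> > 0"
  shows "\<forall>\<^sub>F X in sequentially.
    real (card {N\<in>{1..int X}. N \<notin> range (ternary_poly a b a2 b2 a3 b3)}) \<le> (96 / real W + \<epsilon>) * real X"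
proof -
  define \<delta> where "\<delta> = \<epsilon> * of_int a / 4"
  have "\<delta> > 0" using \<epsilon> a by (simp add: \<delta>_def)
  from card_nonvalues_asymptotic[OF a ev pr small W this]
  obtain A1 where A1: "\<And>A X. A \<ge> A1 \<Longrightarrow> X \<le> a * (int A)\<^sup>2 + b * int A \<Longrightarrow>
    real (card {N\<in>{1..X}. N \<notin> range (ternary_poly a b a2 b2 a3 b3)}) \<le> (24 * of_int a / real W + \<delta>) * (real A)\<^sup>2"
    by (auto simp: eventually_sequentially)
  define s where "s X = sqrt (real X / of_int a)" for X :: nat
  have "filterlim s at_top sequentially"
    unfolding s_def using a by real_asymp
  then have "\<forall>\<^sub>F X in sequentially. s X \<ge> max (real A1) (1 + real_of_int \<bar>b\<bar>)"
    unfolding filterlim_at_top by blast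
  then show ?thesis
  proof eventually_elim
    case (elim X)
    \<comment> \<open>Adding \<open>|b|\<close> to the rounded root compensates a negative linear
      coefficient: \<open>a A + b >= a s\<close>.\<close>
    define A where "A = nat \<lceil>s X\<rceil> + nat \<bar>b\<bar>"
    have s0: "s X \<ge> 0" and s2: "(s X)\<^sup>2 = real X / of_int a" using a by (auto simp: s_def)
    have "real A = of_int \<lceil>s X\<rceil> + of_int \<bar>b\<bar>" using s0 by (simp add: A_def)
    then have Alo: "s X + of_int \<bar>b\<bar> \<le> real A" and Ahi: "real A \<le> 2 * s X"
      using elim by linarith+
    have "A \<ge> A1" using Alo elim by linarith
    moreover have "int X \<le> a * (int A)\<^sup>2 + b * int A"
    proof -
      have "of_int a * s X \<le> of_int a * (real A - of_int \<bar>b\<bar>)"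
        using Alo a by (intro mult_left_mono) auto
      moreover have "real_of_int \<bar>b\<bar> \<le> of_int a * of_int \<bar>b\<bar>" using a by (simp add: mult_le_cancel_right1)
      moreover have "- real_of_int \<bar>b\<bar> \<le> of_int b" by linarith
      ultimately have 1: "of_int a * s X \<le> of_int a * real A + of_int b" by (simp add: algebra_simps)
      have "real X = s X * (of_int a * s X)" using s2 a by (simp add: power2_eq_square field_simps)
      also have "\<dots> \<le> real A * (of_int a * real A + of_int b)"
        using 1 Alo s0 a by (intro mult_mono) auto
      finally have "real X \<le> real_of_int (a * (int A)\<^sup>2 + b * int A)" by (simp add: power2_eq_square algebra_simps)
      then show ?thesis by linarith
    qed
    ultimately have "real (card {N\<in>{1..int X}. N \<notin> range (ternary_poly a b a2 b2 a3 b3)}) \<le>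
        (24 * of_int a / real W + \<delta>) * (real A)\<^sup>2" by (rule A1)
    also have "\<dots> \<le> (24 * of_int a / real W + \<delta>) * (2 * s X)\<^sup>2"
      using Ahi a \<open>\<delta> > 0\<close> by (intro mult_left_mono power_mono) auto
    also have "\<dots> = (96 / real W + \<epsilon>) * real X"
      using a W by (simp add: power_mult_distrib s2 \<delta>_def field_simps)
    finally show ?case .
  qed
qed

section \<open>Quadratic forms modulo prime powers\<close>

text \<open>Written as a symmetric sum without halving, so that it is integral and meaningful at the
  prime 2; on the diagonal it is twice the form.\<close>

definition qpolar :: "int^'n^'n \<Rightarrow> 'a::comm_ring_1^'n \<Rightarrow> 'a^'n \<Rightarrow> 'a" where
  "qpolar A v w = (\<Sum>i\<in>UNIV. \<Sum>j\<in>UNIV. of_int (A $ i $ j) * (v $ i * w $ j + w $ i * v $ j))"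

lemma qform_add: "qform A (v + w) = qform A v + qpolar A v w + qform A w"
  by (simp add: qform_def qpolar_def algebra_simps flip: sum.distrib)

lemma qform_scale: "qform A (c *s v) = c\<^sup>2 * qform A v"
  by (simp add: qform_def sum_distrib_left power2_eq_square ac_simps)

lemma qform_zero [simp]: "qform A 0 = 0"
  by (simp add: qform_def)

lemma qpolar_commute: "qpolar A v w = qpolar A w v"
  by (simp add: qpolar_def add.commute)

lemma qpolar_self: "qpolar A v v = 2 * qform A v"
  by (simp add: qpolar_def qform_def sum_distrib_left algebra_simps)

lemma qpolar_add_left: "qpolar A (u + v) w = qpolar A u w + qpolar A v w"
  by (simp add: qpolar_def algebra_simps flip: sum.distrib)

lemma qpolar_add_right: "qpolar A w (u + v) = qpolar A w u + qpolar A w v"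
  by (simp add: qpolar_commute[of A w] qpolar_add_left)

lemma qpolar_scale_left: "qpolar A (c *s v) w = c * qpolar A v w"
  by (simp add: qpolar_def sum_distrib_left algebra_simps)

lemma qpolar_scale_right: "qpolar A w (c *s v) = c * qpolar A w v"
  by (simp add: qpolar_commute[of A w] qpolar_scale_left)

lemma qpolar_zero [simp]: "qpolar A 0 w = 0" "qpolar A w 0 = 0"
  by (simp_all add: qpolar_def)

lemmas qpolar_bilinear = qpolar_add_left qpolar_add_right qpolar_scale_left qpolar_scale_right

lemma qpolar_eq_diff: "qpolar A v w = qform A (v + w) - qform A v - qform A w"
  by (simp add: qform_add)

section \<open>Quadratic congruences in one, two and three unknowns\<close>

lemma prime_solve_linear:
  fixes p b c :: int
  assumes "prime p" "\<not> p dvd b"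
  obtains s where "p dvd b * s - c"
proof -
  have "coprime b p" using prime_imp_coprime[OF assms] by (simp add: coprime_commute)
  then obtain x where "[b * x = 1] (mod p)" using cong_solve_coprime_int by blast
  then have "p dvd b * x - 1" by (simp add: cong_iff_dvd_diff)
  then have "p dvd (b * x - 1) * c" by simp
  then have "p dvd b * (x * c) - c" by (simp add: algebra_simps)
  then show thesis by (rule that)
qed

text \<open>Newton's method near the root 0 modulo \<open>p\<close>: at every \<open>t\<close>
  divisible by \<open>p\<close> the derivative \<open>2 a t + b\<close> is a unit modulo
  \<open>p\<close>, and one linear congruence improves the precision by one power.\<close>

lemma hensel_quadratic:
  fixes a b c p :: int
  assumes "prime p" "\<not> p dvd b" "p dvd c"
  shows "\<exists>t. p dvd t \<and> p ^ K dvd a * t\<^sup>2 + b * t + c"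
proof (induction K)
  case 0
  then show ?case by (intro exI[of _ 0]) simp
next
  case (Suc K)
  show ?case
  proof (cases "K = 0")
    case True
    then show ?thesis using assms by (intro exI[of _ 0]) simp
  next
    case False
    from Suc obtain t g where t: "p dvd t" "a * t\<^sup>2 + b * t + c = p ^ K * g" by (meson dvdE)
    have nd: "\<not> p dvd 2 * a * t + b" using assms t(1) by (simp add: dvd_add_right_iff)
    obtain s where s: "p dvd (2 * a * t + b) * s - (- g)" using prime_solve_linear[OF assms(1) nd] .
    obtain s' where "(2 * a * t + b) * s - (- g) = p * s'" using s by (rule dvdE)
    then have s': "g + (2 * a * t + b) * s = p * s'" by simp
    obtain K' where K': "K = Suc K'" using False by (cases K) auto
    have "a * (t + p ^ K * s)\<^sup>2 + b * (t + p ^ K * s) + c =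
        (a * t\<^sup>2 + b * t + c) + p ^ K * ((2 * a * t + b) * s) + p ^ K * p ^ K * (a * s\<^sup>2)"
      by (simp add: algebra_simps power2_eq_square)
    also have "\<dots> = p ^ K * (g + (2 * a * t + b) * s) + p ^ K * p ^ K * (a * s\<^sup>2)"
      unfolding t(2) by (simp add: algebra_simps)
    also have "\<dots> = p ^ Suc K * (s' + p ^ K' * (a * s\<^sup>2))"
      unfolding s' by (simp add: K' algebra_simps)
    finally have "p ^ Suc K dvd a * (t + p ^ K * s)\<^sup>2 + b * (t + p ^ K * s) + c" by simp
    moreover have "p dvd t + p ^ K * s" using t(1) K' by simp
    ultimately show ?thesis by blast
  qed
qed

lemma qform_line: "qform A (v + t *s w) = qform A w * t\<^sup>2 + qpolar A v w * t + qform A v"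
  by (simp add: qform_add qform_scale qpolar_bilinear algebra_simps)

text \<open>On the line in direction \<open>w\<close> with parameter \<open>p^\<tau> y\<close>, the
  congruence divided by \<open>p^(2 \<tau>)\<close> is a quadratic in \<open>y\<close> with unit
  linear coefficient \<open>b\<close>. This is Hensel's condition that the error exceed twice the
  valuation of the derivative.\<close>

lemma hensel_qform:
  fixes A :: "int^'n^'n" and p n :: int
  assumes p: "prime p" and b: "qpolar A v w = p ^ \<tau> * b" "\<not> p dvd b"
    and c: "p ^ (2 * \<tau> + 1) dvd qform A v - n"
  shows "\<exists>t. p ^ (\<tau> + 1) dvd t \<and> p ^ K dvd qform A (v + t *s w) - n"
proof -
  obtain c' where c': "qform A v - n = p ^ (2 * \<tau> + 1) * c'" using c by (rule dvdE)
  obtain y where y: "p dvd y" "p ^ K dvd qform A w * y\<^sup>2 + b * y + p * c'"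
    using hensel_quadratic[OF p b(2), of "p * c'" K "qform A w"] by auto
  have "qform A (v + (p ^ \<tau> * y) *s w) - n = p ^ (2 * \<tau>) * (qform A w * y\<^sup>2 + b * y + p * c')"
    unfolding qform_line b(1) using c'
    by (simp add: algebra_simps power_mult_distrib power_add power2_eq_square power_mult)
  then show ?thesis using y by (intro exI[of _ "p ^ \<tau> * y"]) (auto simp: mult_dvd_mono)
qed

text \<open>Pigeonhole principle: \<open>a x^2 + c\<close> and \<open>- b y^2\<close> take
  \<open>(p + 1) / 2\<close> residues each, so they share one.\<close>

lemma binary_diagonal_mod_prime:
  fixes p a b c :: int
  assumes p: "prime p" "odd p" and ab: "\<not> p dvd a" "\<not> p dvd b"
  shows "\<exists>x y. p dvd a * x\<^sup>2 + b * y\<^sup>2 + c"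
proof -
  define I where "I = {0..(p - 1) div 2}"
  have p1: "p > 1" using p by (simp add: prime_gt_1_int)
  have inj: "inj_on (\<lambda>x. (e * x\<^sup>2 + g) mod p) I" if e: "\<not> p dvd e" for e g
  proof (rule inj_onI)
    fix x y assume xy: "x \<in> I" "y \<in> I" "(e * x\<^sup>2 + g) mod p = (e * y\<^sup>2 + g) mod p"
    then have "p dvd (e * x\<^sup>2 + g) - (e * y\<^sup>2 + g)" by (simp add: mod_eq_dvd_iff)
    then have "p dvd e * ((x - y) * (x + y))" by (simp add: algebra_simps power2_eq_square)
    then have "p dvd x - y \<or> p dvd x + y" using e p(1) by (simp add: prime_dvd_mult_iff)
    moreover have "\<bar>x - y\<bar> < p" "0 \<le> x + y" "x + y < p" using xy p1 by (auto simp: I_def)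
    ultimately show "x = y"
      using xy zdvd_not_zless[of "x + y" p] dvd_imp_le_int[of "x - y" p] by (fastforce simp: I_def)
  qed
  have nb: "\<not> p dvd - b" using ab by simp
  let ?S = "(\<lambda>x. (a * x\<^sup>2 + c) mod p) ` I" and ?T = "(\<lambda>x. (- b * x\<^sup>2 + 0) mod p) ` I"
  have "card I = nat ((p + 1) div 2)" using p by (auto simp: I_def elim!: oddE)
  then have cards: "card ?S + card ?T = nat (p + 1)"
    using p card_image[OF inj[OF ab(1), of c]] card_image[OF inj[OF nb, of 0]] p1 by (auto elim!: oddE)
  have "?S \<inter> ?T \<noteq> {}"
  proof
    assume "?S \<inter> ?T = {}"
    then have "card (?S \<union> ?T) = nat (p + 1)" using cards by (subst card_Un_disjoint) (auto simp: I_def)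
    moreover have "card (?S \<union> ?T) \<le> card {0..<p}" using p1 by (intro card_mono) auto
    ultimately show False using p1 by simp
  qed
  then obtain x y where "(a * x\<^sup>2 + c) mod p = (- b * y\<^sup>2 + 0) mod p" by blast
  then have "p dvd (a * x\<^sup>2 + c) - (- b * y\<^sup>2 + 0)" by (simp add: mod_eq_dvd_iff)
  then show ?thesis by (auto simp: algebra_simps)
qed

text \<open>The case of Chevalley's theorem used below. For odd \<open>p\<close> two completions of
  the square reduce it to \<open>binary_diagonal_mod_prime\<close>, unless a coefficient to divide
  by vanishes, which itself gives a zero. At 2 the square cannot be completed, and one of the seven
  nonzero vectors modulo 2 is a zero.\<close>

lemma ternary_form_zero_mod_prime:
  fixes p a b c d e f :: int
  assumes p: "prime p"
  shows "\<exists>r s t. \<not> (p dvd r \<and> p dvd s \<and> p dvd t) \<and>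
    p dvd a * r\<^sup>2 + b * s\<^sup>2 + c * t\<^sup>2 + d * r * s + e * r * t + f * s * t"
proof (cases "p = 2")
  case True
  let ?q = "\<lambda>(r, s, t). a * r\<^sup>2 + b * s\<^sup>2 + c * t\<^sup>2 + d * r * s + e * r * t + f * s * t"
  let ?X = "{(1,0,0), (0,1,0), (0,0,1), (1,1,0), (1,0,1), (0,1,1), (1,1,1)} :: (int \<times> int \<times> int) set"
  have "\<exists>x\<in>?X. even (?q x)" by auto
  then obtain x where "x \<in> ?X" "even (?q x)" by (rule bexE)
  moreover obtain r s t where "x = (r, s, t)" by (cases x)
  ultimately have x: "(r, s, t) \<in> ?X" "even (?q (r, s, t))" by simp_all
  have "\<not> (p dvd r \<and> p dvd s \<and> p dvd t)" unfolding True using x(1) by auto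
  moreover have "p dvd a * r\<^sup>2 + b * s\<^sup>2 + c * t\<^sup>2 + d * r * s + e * r * t + f * s * t"
    unfolding True using x(2) by (simp only: prod.case)
  ultimately show ?thesis by blast
next
  case False
  have odd: "odd p" using p False by (simp add: prime_odd_int prime_ge_2_int order_less_le)
  have p2: "\<not> p dvd 2" using primes_dvd_imp_eq[OF p, of 2] False by auto
  have nu: "\<not> p dvd 1" using p by (meson not_prime_unit)
  define P where "P = 4 * a * b - d\<^sup>2"
  define R where "R = 4 * a * c - e\<^sup>2"
  define S where "S = 2 * (2 * a * f - d * e)"
  have sq: "4 * a * (a * r\<^sup>2 + b * s\<^sup>2 + c * t\<^sup>2 + d * r * s + e * r * t + f * s * t) =
      (2 * a * r + d * s + e * t)\<^sup>2 + P * s\<^sup>2 + R * t\<^sup>2 + S * s * t" for r s t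
    by (simp add: P_def R_def S_def algebra_simps power2_eq_square)
  show ?thesis
  proof (cases "p dvd a")
    case True
    then show ?thesis using nu by (intro exI[of _ 1] exI[of _ 0]) simp
  next
    case na: False
    have n2a: "\<not> p dvd 2 * a" using na p2 p by (simp add: prime_dvd_mult_iff)
    have n4: "\<not> p dvd 4 * a"
      using n2a p2 p prime_dvd_mult_iff[OF p, of 2 "2 * a"] by simp
    show ?thesis
    proof (cases "p dvd P")
      case True
      obtain r where r: "p dvd 2 * a * r - (- d)" using prime_solve_linear[OF p n2a] .
      have "p dvd (2 * a * r + d * 1 + e * 0)\<^sup>2 + P * 1\<^sup>2 + R * 0\<^sup>2 + S * 1 * 0"
        using r True by (simp add: dvd_power power2_eq_square)
      then have "p dvd 4 * a * (a * r\<^sup>2 + b * 1\<^sup>2 + c * 0\<^sup>2 + d * r * 1 + e * r * 0 + f * 1 * 0)"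
        unfolding sq .
      then have "p dvd a * r\<^sup>2 + b * 1\<^sup>2 + c * 0\<^sup>2 + d * r * 1 + e * r * 0 + f * 1 * 0"
        using n4 p prime_dvd_mult_iff by blast
      then show ?thesis using nu by blast
    next
      case nP: False
      have n2P: "\<not> p dvd 2 * P" using nP p2 p by (simp add: prime_dvd_mult_iff)
      have n4P: "\<not> p dvd 4 * P" using n2P p2 p prime_dvd_mult_iff[OF p, of 2 "2 * P"] by simp
      \<comment> \<open>Put \<open>t = 1\<close>. Multiplying by \<open>4 P\<close> completes the
        second square, with unknowns \<open>X = 2 a r + d s + e\<close> and
        \<open>Y = 2 P s + S\<close>; both substitutions can be undone modulo
        \<open>p\<close>.\<close>
      obtain X Y where XY: "p dvd 4 * P * X\<^sup>2 + 1 * Y\<^sup>2 + (4 * P * R - S\<^sup>2)"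
        using binary_diagonal_mod_prime[OF p odd n4P nu] by blast
      obtain s where "p dvd 2 * P * s - (Y - S)" using prime_solve_linear[OF p n2P] .
      then obtain y where "2 * P * s - (Y - S) = p * y" by (rule dvdE)
      then have y: "2 * P * s + S = Y + p * y" by simp
      obtain r where "p dvd 2 * a * r - (X - d * s - e)" using prime_solve_linear[OF p n2a] .
      then obtain x where "2 * a * r - (X - d * s - e) = p * x" by (rule dvdE)
      then have x: "2 * a * r + d * s + e = X + p * x" by simp
      let ?q = "a * r\<^sup>2 + b * s\<^sup>2 + c * 1\<^sup>2 + d * r * s + e * r * 1 + f * s * 1"
      have "4 * P * (4 * a * ?q) = 4 * P * (2 * a * r + d * s + e)\<^sup>2 + (2 * P * s + S)\<^sup>2 + (4 * P * R - S\<^sup>2)"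
        unfolding sq by (simp add: algebra_simps power2_eq_square)
      also have "\<dots> = (4 * P * X\<^sup>2 + 1 * Y\<^sup>2 + (4 * P * R - S\<^sup>2)) +
          p * (4 * P * (2 * X * x + p * x\<^sup>2) + 2 * Y * y + p * y\<^sup>2)"
        unfolding x y by (simp add: algebra_simps power2_eq_square)
      finally have "p dvd 4 * P * (4 * a * ?q)" using XY by simp
      then have "p dvd ?q" using n4P n4 p prime_dvd_mult_iff by metis
      then show ?thesis using nu by blast
    qed
  qed
qed

lemma qform_comb3:
  "qform A (r *s x + s *s y + t *s z) = qform A x * r\<^sup>2 + qform A y * s\<^sup>2 + qform A z * t\<^sup>2 +
    qpolar A x y * r * s + qpolar A x z * r * t + qpolar A y z * s * t"
  by (simp add: qform_add qform_scale qpolar_bilinear algebra_simps)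

section \<open>Integer vectors modulo p and dimension counting\<close>

definition vec_dvd :: "int \<Rightarrow> int^'n \<Rightarrow> bool" where
  "vec_dvd m v \<longleftrightarrow> (\<forall>i. m dvd v $ i)"

lemma vec_dvdE:
  assumes "vec_dvd m v" obtains u where "v = m *s u"
proof -
  from assms have "\<forall>i. \<exists>k. v $ i = m * k" by (auto simp: vec_dvd_def dvd_def)
  then obtain k where "\<And>i. v $ i = m * k i" by metis
  then have "v = m *s (\<chi> i. k i)" by (simp add: vec_eq_iff)
  then show thesis by (rule that)
qed

lemma vec_dvd_smult [simp]: "vec_dvd m (m *s u)"
  by (simp add: vec_dvd_def)

lemma vec_dvd_add: "vec_dvd m u \<Longrightarrow> vec_dvd m v \<Longrightarrow> vec_dvd m (u + v)"
  by (simp add: vec_dvd_def)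

lemma vec_dvd_scale: "vec_dvd m u \<Longrightarrow> vec_dvd m (c *s u)"
  by (simp add: vec_dvd_def)

text \<open>The quotient of \<open>S\<close> by \<open>U\<close> is a vector space over the field with \<open>p\<close> elements. The second
  alternative covers the dimensions 0 and 1.\<close>

lemma dimension_le_two_cases:
  fixes S U :: "(int^'n) set" and p :: int
  assumes p: "prime p"
    and S: "\<And>x y s t. x \<in> S \<Longrightarrow> y \<in> S \<Longrightarrow> s *s x + t *s y \<in> S"
    and U: "\<And>x y s t. x \<in> U \<Longrightarrow> y \<in> U \<Longrightarrow> s *s x + t *s y \<in> U"
    and pU: "\<And>x. x \<in> S \<Longrightarrow> p *s x \<in> U"
    and S0: "0 \<in> S"
    and dep: "\<And>x y z. x \<in> S \<Longrightarrow> y \<in> S \<Longrightarrow> z \<in> S \<Longrightarrow>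
      \<exists>r s t. \<not> (p dvd r \<and> p dvd s \<and> p dvd t) \<and> r *s x + s *s y + t *s z \<in> U"
  shows "(\<exists>x\<in>S. \<exists>y\<in>S. (\<forall>s t. s *s x + t *s y \<in> U \<longrightarrow> p dvd s \<and> p dvd t) \<and>
            (\<forall>v\<in>S. \<exists>s t. v - s *s x - t *s y \<in> U)) \<or>
         (\<exists>x\<in>S. \<forall>v\<in>S. \<exists>s. v - s *s x \<in> U)"
proof -
  have solve: "\<exists>c. v - (c * s) *s x - (c * t) *s y \<in> U"
    if "x \<in> S" "y \<in> S" "v \<in> S" "s *s x + t *s y + r *s v \<in> U" "\<not> p dvd r" for x y v s t r
  proof -
    \<comment> \<open>As \<open>c\<close> inverts \<open>- r\<close> modulo \<open>p\<close>, the
      relation can be solved for \<open>v\<close>; the remaining multiple \<open>p k\<close> of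
      \<open>v\<close> lies in \<open>U\<close> by \<open>pU\<close>.\<close>
    obtain c where "p dvd r * c - (- 1)" using prime_solve_linear[OF p \<open>\<not> p dvd r\<close>] .
    then obtain k where k: "r * c - (- 1) = p * k" by (rule dvdE)
    have "(- c) *s (s *s x + t *s y + r *s v) + 0 *s (p *s v) \<in> U" using that pU by (intro U) auto
    then have "1 *s ((- c) *s (s *s x + t *s y + r *s v) + 0 *s (p *s v)) + k *s (p *s v) \<in> U" using that pU by (intro U) auto
    moreover have "1 *s ((- c) *s (s *s x + t *s y + r *s v) + 0 *s (p *s v)) + k *s (p *s v) =
        v - (c * s) *s x - (c * t) *s y"
    proof (subst vec_eq_iff, intro allI)
      fix i
      have "(k * p - c * r) * v $ i = v $ i" using k by (simp add: mult.commute)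
      then show "(1 *s ((- c) *s (s *s x + t *s y + r *s v) + 0 *s (p *s v)) + k *s (p *s v)) $ i =
          (v - (c * s) *s x - (c * t) *s y) $ i"
        by (simp add: algebra_simps)
    qed
    ultimately show ?thesis by auto
  qed
  show ?thesis
  proof (cases "\<exists>x\<in>S. \<exists>y\<in>S. \<forall>s t. s *s x + t *s y \<in> U \<longrightarrow> p dvd s \<and> p dvd t")
    case True
    then obtain x y where xy: "x \<in> S" "y \<in> S" "\<And>s t. s *s x + t *s y \<in> U \<Longrightarrow> p dvd s \<and> p dvd t" by blast
    have "\<exists>s t. v - s *s x - t *s y \<in> U" if v: "v \<in> S" for v
    proof -
      obtain s t r where r: "\<not> (p dvd s \<and> p dvd t \<and> p dvd r)" "s *s x + t *s y + r *s v \<in> U"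
        using dep[OF xy(1,2) v] by blast
      have "\<not> p dvd r"
      proof
        assume "p dvd r"
        then obtain r' where r': "r = p * r'" by (rule dvdE)
        have "1 *s (s *s x + t *s y + r *s v) + (- r') *s (p *s v) \<in> U" by (rule U[OF r(2) pU[OF v]])
        moreover have "1 *s (s *s x + t *s y + r *s v) + (- r') *s (p *s v) = s *s x + t *s y"
          by (simp add: vec_eq_iff r' algebra_simps)
        ultimately have "s *s x + t *s y \<in> U" by (simp only:)
        then show False using xy(3) r(1) \<open>p dvd r\<close> by blast
      qed
      then show ?thesis using solve[OF xy(1,2) v r(2)] by blast
    qed
    then show ?thesis using xy by blast
  next
    case False
    show ?thesis
    proof (cases "S \<subseteq> U")
      case True
      then have "\<forall>v\<in>S. \<exists>s. v - s *s 0 \<in> U" by auto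
      then show ?thesis using S0 by blast
    next
      case nS: False
      then obtain x where x: "x \<in> S" "x \<notin> U" by blast
      have "\<exists>s. v - s *s x \<in> U" if v: "v \<in> S" for v
      proof -
        obtain s t where st: "s *s x + t *s v \<in> U" "\<not> (p dvd s \<and> p dvd t)" using False x v by blast
        have "\<not> p dvd t"
        proof
          assume "p dvd t"
          then obtain t' where t': "t = p * t'" by (rule dvdE)
          have "1 *s (s *s x + t *s v) + (- t') *s (p *s v) \<in> U" by (rule U[OF st(1) pU[OF v]])
          moreover have "1 *s (s *s x + t *s v) + (- t') *s (p *s v) = 0 *s 0 + 0 *s 0 + s *s x"
            by (simp add: vec_eq_iff t' algebra_simps)
          ultimately have sx: "0 *s 0 + 0 *s 0 + s *s x \<in> U" by (simp only:)
          have "\<not> p dvd s" using st \<open>p dvd t\<close> by blast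
          from solve[OF S0 S0 x(1) sx this] have "x \<in> U" by simp
          then show False using x by blast
        qed
        moreover have "s *s x + 0 *s x + t *s v \<in> U" using st by simp
        ultimately obtain c where "v - (c * s) *s x - (c * 0) *s x \<in> U" using solve[OF x(1) x(1) v] by blast
        then show ?thesis by auto
      qed
      then show ?thesis using x by blast
    qed
  qed
qed

lemma card_int_box:
  fixes p :: int
  assumes "p \<ge> 0"
  shows "card {v::int^'n. \<forall>i. v $ i \<in> {0..<p}} = nat p ^ CARD('n)"
proof -
  have "bij_betw (\<lambda>f. \<chi> i. f i) (UNIV \<rightarrow>\<^sub>E {0..<p}) {v::int^'n. \<forall>i. v $ i \<in> {0..<p}}"
    by (rule bij_betwI[where g = vec_nth]) (auto simp: PiE_def extensional_def)
  then have "card {v::int^'n. \<forall>i. v $ i \<in> {0..<p}} = card (UNIV \<rightarrow>\<^sub>E {0..<p} :: ('n \<Rightarrow> int) set)"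
    by (simp add: bij_betw_same_card)
  also have "\<dots> = nat p ^ CARD('n)" by (subst card_PiE) auto
  finally show ?thesis .
qed

text \<open>Three generators reach at most \<open>p^3\<close> of the \<open>p^n\<close> residue
  vectors modulo \<open>p\<close>.\<close>

lemma generators_mod_prime_card:
  fixes p :: int and x y z :: "int^'n"
  assumes p: "p > 1" and gen: "\<And>v. \<exists>r s t. vec_dvd p (v - r *s x - s *s y - t *s z)"
  shows "CARD('n) \<le> 3"
proof -
  let ?B = "{v::int^'n. \<forall>i. v $ i \<in> {0..<p}}"
  let ?g = "\<lambda>(r, s, t). \<chi> i. (r * x $ i + s * y $ i + t * z $ i) mod p"
  have B: "card ?B = nat p ^ CARD('n)" using p by (intro card_int_box) simp
  have "?B \<subseteq> ?g ` ({0..<p} \<times> {0..<p} \<times> {0..<p})"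
  proof
    fix v assume v: "v \<in> ?B"
    obtain r s t where d: "vec_dvd p (v - r *s x - s *s y - t *s z)" using gen by blast
    have "v = ?g (r mod p, s mod p, t mod p)"
    proof (subst vec_eq_iff, intro allI)
      fix i
      have "p dvd v $ i - (r * x $ i + s * y $ i + t * z $ i)"
        using spec[OF d[unfolded vec_dvd_def], of i] by (simp add: diff_diff_eq)
      then have "v $ i mod p = (r * x $ i + s * y $ i + t * z $ i) mod p" by (simp add: mod_eq_dvd_iff)
      also have "\<dots> = (r mod p * x $ i + s mod p * y $ i + t mod p * z $ i) mod p"
        by (intro mod_add_cong) (simp_all add: mod_mult_left_eq)
      finally show "v $ i = ?g (r mod p, s mod p, t mod p) $ i" using v by simp
    qed
    moreover have "(r mod p, s mod p, t mod p) \<in> {0..<p} \<times> {0..<p} \<times> {0..<p}" using p by simp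
    ultimately show "v \<in> ?g ` ({0..<p} \<times> {0..<p} \<times> {0..<p})" by blast
  qed
  then have "nat p ^ CARD('n) \<le> card (?g ` ({0..<p} \<times> {0..<p} \<times> {0..<p}))"
    unfolding B[symmetric] by (intro card_mono) auto
  also have "\<dots> \<le> card ({0..<p} \<times> {0..<p} \<times> {0..<p})" by (intro card_image_le) auto
  also have "\<dots> = nat p ^ 3" by (simp add: card_cartesian_product power3_eq_cube)
  finally have "nat p ^ CARD('n) \<le> nat p ^ 3" .
  then show ?thesis using p by (subst (asm) power_increasing_iff) auto
qed

text \<open>These are the vectors \<open>e\<close> for which adjoining \<open>e/p\<close> to the standard lattice gives a strictly larger
  lattice on which the form is still integral.\<close>

definition enlarging :: "int \<Rightarrow> int^'n^'n \<Rightarrow> int^'n \<Rightarrow> bool" where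
  "enlarging p A e \<longleftrightarrow> \<not> vec_dvd p e \<and> p\<^sup>2 dvd qform A e \<and> (\<forall>g. p dvd qpolar A e g)"

text \<open>Divided by \<open>p^m\<close>, the form is anisotropic modulo \<open>p\<close> on the
  plane of \<open>x\<close> and \<open>y\<close>. Subtracting \<open>a' r^2\<close> gives a ternary
  form, which has a nontrivial zero modulo \<open>p\<close>; anisotropy makes \<open>r\<close> a
  unit there, and dividing by it solves the congruence for \<open>a'\<close>. It is applied with
  \<open>m = 0\<close> to the form modulo its zeros and with \<open>m = 1\<close> to
  \<open>f/p\<close> on them.\<close>

lemma anisotropic_represents:
  fixes A :: "int^'n^'n" and p a :: int
  assumes p: "prime p" and q: "p ^ Suc m dvd a \<Longrightarrow> False" "p ^ m dvd a"
    and x: "p ^ m dvd qform A x" "p ^ m dvd qform A y" "p ^ m dvd qpolar A x y"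
    and ind: "\<And>s t. p ^ Suc m dvd qform A (s *s x + t *s y) \<Longrightarrow> p dvd s \<and> p dvd t"
  shows "\<exists>v. p ^ K dvd qform A v - a"
proof -
  obtain a' where a': "a = p ^ m * a'" using q(2) by (rule dvdE)
  obtain X where X: "qform A x = p ^ m * X" using x(1) by (rule dvdE)
  obtain Y where Y: "qform A y = p ^ m * Y" using x(2) by (rule dvdE)
  obtain Z where Z: "qpolar A x y = p ^ m * Z" using x(3) by (rule dvdE)
  have pm: "p ^ m \<noteq> 0" using p by auto
  have na: "\<not> p dvd a'" using q(1) pm by (auto simp: a' mult.commute)
  have q: "qform A (s *s x + t *s y) = p ^ m * (X * s\<^sup>2 + Y * t\<^sup>2 + Z * s * t)" for s t
    using qform_comb3[of A s x t y 0 0] X Y Z by (simp add: algebra_simps)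
  have ind': "p dvd s \<and> p dvd t" if "p dvd X * s\<^sup>2 + Y * t\<^sup>2 + Z * s * t" for s t
    using that by (intro ind) (simp add: q mult.commute)
  have nu: "\<not> p dvd 1" using p by (meson not_prime_unit)
  obtain r s t where rst: "\<not> (p dvd r \<and> p dvd s \<and> p dvd t)"
      "p dvd (- a') * r\<^sup>2 + X * s\<^sup>2 + Y * t\<^sup>2 + 0 * r * s + 0 * r * t + Z * s * t"
    using ternary_form_zero_mod_prime[OF p, of "- a'" X Y 0 0 Z] by blast
  have nr: "\<not> p dvd r"
  proof
    assume "p dvd r"
    then have "p dvd a' * r\<^sup>2" by (simp add: power2_eq_square)
    then have "p dvd ((- a') * r\<^sup>2 + X * s\<^sup>2 + Y * t\<^sup>2 + 0 * r * s + 0 * r * t + Z * s * t) + a' * r\<^sup>2"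
      using rst(2) by (rule dvd_add[rotated])
    then have "p dvd X * s\<^sup>2 + Y * t\<^sup>2 + Z * s * t" by (simp add: add.assoc)
    then show False using ind' rst(1) \<open>p dvd r\<close> by blast
  qed
  obtain c where "p dvd r * c - 1" using prime_solve_linear[OF p nr] .
  then obtain k where k: "r * c = 1 + p * k" by (metis diff_eq_eq dvdE add.commute)
  define s' where "s' = c * s"
  define t' where "t' = c * t"
  have "c\<^sup>2 * ((- a') * r\<^sup>2 + X * s\<^sup>2 + Y * t\<^sup>2 + 0 * r * s + 0 * r * t + Z * s * t) =
      X * s'\<^sup>2 + Y * t'\<^sup>2 + Z * s' * t' - a' * (r * c)\<^sup>2"
    by (simp add: s'_def t'_def algebra_simps power2_eq_square)
  also have "\<dots> = (X * s'\<^sup>2 + Y * t'\<^sup>2 + Z * s' * t' - a') - p * (a' * (2 * k + p * k\<^sup>2))"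
    unfolding k by (simp add: algebra_simps power2_eq_square)
  finally have eq: "X * s'\<^sup>2 + Y * t'\<^sup>2 + Z * s' * t' - a' = c\<^sup>2 * ((- a') * r\<^sup>2 + X * s\<^sup>2 + Y * t\<^sup>2 + 0 * r * s + 0 * r * t + Z * s * t)
      + p * (a' * (2 * k + p * k\<^sup>2))" by simp
  have sol: "p dvd X * s'\<^sup>2 + Y * t'\<^sup>2 + Z * s' * t' - a'"
    unfolding eq by (rule dvd_add, rule dvd_mult, rule rst(2), simp)
  have nX: "\<not> p dvd X" using ind'[of 1 0] nu by auto
  have nY: "\<not> p dvd Y" using ind'[of 0 1] nu by auto
  have "\<exists>v w B c0. qpolar A v w = p ^ m * B \<and> \<not> p dvd B \<and> qform A v - a = p ^ m * c0 \<and> p dvd c0 \<and> p ^ m dvd qform A w"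
  \<comment> \<open>Lifting needs a direction with unit polar value. For odd \<open>p\<close> it is
    \<open>v\<close> itself, since \<open>B v v = 2 f v\<close>. For \<open>p = 2\<close> the three
    values \<open>X\<close>, \<open>Y\<close> and \<open>X + Y + Z\<close> are odd, so
    \<open>Z\<close> is odd and \<open>y\<close> is a direction at \<open>x\<close>, which solves
    the congruence because all units agree modulo 2.\<close>
  proof (cases "p = 2")
    case True
    have "\<not> p dvd X * 1\<^sup>2 + Y * 1\<^sup>2 + Z * 1 * 1" using ind'[of 1 1] nu by auto
    then have Zodd: "\<not> p dvd Z" using nX nY unfolding True by simp
    have "p dvd X - a'" using nX na unfolding True by simp
    moreover have "qform A x - a = p ^ m * (X - a')" by (simp add: X a' right_diff_distrib)
    ultimately show ?thesis using Z Zodd x by blast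
  next
    case False
    define v where "v = s' *s x + t' *s y"
    define F where "F = X * s'\<^sup>2 + Y * t'\<^sup>2 + Z * s' * t'"
    have fv: "qform A v = p ^ m * F" by (simp add: v_def F_def q)
    have "\<not> p dvd F"
    proof
      assume "p dvd F"
      then have "p dvd F - (F - a')" using sol unfolding F_def[symmetric] by (rule dvd_diff)
      then show False using na by simp
    qed
    moreover have "\<not> p dvd 2" using primes_dvd_imp_eq[OF p, of 2] False by auto
    ultimately have "\<not> p dvd 2 * F" using p by (simp add: prime_dvd_mult_iff)
    moreover have "qpolar A v v = p ^ m * (2 * F)" by (simp add: qpolar_self fv)
    moreover have "qform A v - a = p ^ m * (F - a')" by (simp add: fv a' right_diff_distrib)
    moreover have "p dvd F - a'" "p ^ m dvd qform A v" using sol fv by (auto simp: F_def)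
    ultimately show ?thesis by blast
  qed
  then obtain v w B c0 where B: "qpolar A v w = p ^ m * B" "\<not> p dvd B"
    and c0: "qform A v - a = p ^ m * c0" "p dvd c0" and w: "p ^ m dvd qform A w" by blast
  obtain G where G: "qform A w = p ^ m * G" using w by (rule dvdE)
  obtain t where t: "p ^ K dvd G * t\<^sup>2 + B * t + c0" using hensel_quadratic[OF p B(2) c0(2)] by blast
  have "qform A (v + t *s w) - a = p ^ m * (G * t\<^sup>2 + B * t + c0)"
    unfolding qform_line B(1) G using c0(1) by (simp add: algebra_simps)
  then show ?thesis using t by (intro exI[of _ "v + t *s w"]) simp
qed

theorem no_enlarging_represents:
  fixes A :: "int^'n^'n" and p :: int
  assumes p: "prime p" and max: "\<And>e. \<not> enlarging p A e"
    and dim: "CARD('n) \<ge> 4 \<or> (\<exists>e. \<not> vec_dvd p e \<and> qform A e = 0)"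
  shows "\<exists>v. p ^ K dvd qform A v - a"
proof (cases "\<exists>e. \<not> vec_dvd p e \<and> p\<^sup>2 dvd qform A e")
  case True
  then obtain e where e: "\<not> vec_dvd p e" "p\<^sup>2 dvd qform A e" by blast
  then obtain g where g: "\<not> p dvd qpolar A e g" using max[of e] unfolding enlarging_def by blast
  have fe: "p dvd qform A e" using e(2) by (metis dvd_mult_left power2_eq_square)
  \<comment> \<open>Modulo \<open>p\<close> the form is linear along \<open>e\<close>, as
    \<open>p\<close> divides \<open>f e\<close>; hence every residue is reached from
    \<open>g\<close>.\<close>
  obtain t where t: "p dvd qpolar A e g * t - (a - qform A g)" using prime_solve_linear[OF p g] .
  have "qform A (g + t *s e) - a = qform A e * t\<^sup>2 + (qpolar A e g * t - (a - qform A g))"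
    unfolding qform_line by (simp add: qpolar_commute[of A g])
  then have "p ^ (2 * 0 + 1) dvd qform A (g + t *s e) - a" using fe t by (simp only: dvd_add dvd_mult2 mult_zero_right add_0 power_one_right)
  moreover have "qpolar A (g + t *s e) e = p ^ 0 * (qpolar A e g + 2 * t * qform A e)"
    by (simp add: qpolar_bilinear qpolar_self qpolar_commute[of A g])
  moreover have "\<not> p dvd qpolar A e g + 2 * t * qform A e" using g fe by (simp add: dvd_add_left_iff)
  ultimately show ?thesis using hensel_qform[OF p] by blast
next
  case False
  then have aniso: "vec_dvd p e" if "p\<^sup>2 dvd qform A e" for e using that by blast
  have n4: "CARD('n) \<ge> 4" using dim aniso by (metis dvd_0_right)
  define Z where "Z = {v::int^'n. p dvd qform A v}"
  \<comment> \<open>Otherwise Hensel's lemma in direction \<open>g\<close> gives a zero modulo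
    \<open>p^2\<close> congruent to \<open>v\<close> modulo \<open>p\<close>. By
    \<open>aniso\<close> it is 0 modulo \<open>p\<close>, and so is \<open>v\<close>, which makes
    all its polar values divisible by \<open>p\<close>.\<close>
  have rad: "p dvd qpolar A v g" if v: "v \<in> Z" for v g
  proof (rule ccontr)
    assume n: "\<not> p dvd qpolar A v g"
    then have nv: "\<not> vec_dvd p v"
      by (auto elim!: vec_dvdE simp: qpolar_bilinear)
    have "p ^ (2 * 0 + 1) dvd qform A v - 0" using v by (simp add: Z_def)
    then obtain t where t: "p ^ (0 + 1) dvd t" "p\<^sup>2 dvd qform A (v + t *s g) - 0"
      using hensel_qform[OF p, of A v g 0 "qpolar A v g" 0 2] n by auto
    have "vec_dvd p (v + t *s g)" using aniso t(2) by simp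
    moreover have "vec_dvd p ((- t) *s g)" using t(1) by (simp add: vec_dvd_def)
    ultimately have "vec_dvd p ((v + t *s g) + (- t) *s g)" by (rule vec_dvd_add)
    then show False using nv by (simp add: vec_dvd_def)
  qed
  have Zc: "s *s x + t *s y \<in> Z" if "x \<in> Z" "y \<in> Z" for x y s t
    using that rad[OF that(1), of y] by (simp add: Z_def qform_add qform_scale qpolar_bilinear)
  have pZ: "p *s x \<in> Z" for x by (simp add: Z_def qform_scale power2_eq_square)
  define P where "P = {v::int^'n. vec_dvd p v}"
  have Pc: "s *s x + t *s y \<in> P" if "x \<in> P" "y \<in> P" for x y s t
    using that by (simp add: P_def vec_dvd_add vec_dvd_scale)
  have dep1: "\<exists>r s t. \<not> (p dvd r \<and> p dvd s \<and> p dvd t) \<and> r *s x + s *s y + t *s z \<in> Z" for x y z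
    using ternary_form_zero_mod_prime[OF p] unfolding Z_def mem_Collect_eq qform_comb3 by blast
  have dep2: "\<exists>r s t. \<not> (p dvd r \<and> p dvd s \<and> p dvd t) \<and> r *s x + s *s y + t *s z \<in> P"
    if "x \<in> Z" "y \<in> Z" "z \<in> Z" for x y z
  proof -
    have "p dvd qform A x" "p dvd qform A y" "p dvd qform A z" using that by (auto simp: Z_def)
    moreover have "p dvd qpolar A x y" "p dvd qpolar A x z" "p dvd qpolar A y z" using that rad by auto
    ultimately obtain a b c d e f where c: "qform A x = p * a" "qform A y = p * b" "qform A z = p * c"
        "qpolar A x y = p * d" "qpolar A x z = p * e" "qpolar A y z = p * f"
      by (meson dvdE)
    obtain r s t where rst: "\<not> (p dvd r \<and> p dvd s \<and> p dvd t)"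
        "p dvd a * r\<^sup>2 + b * s\<^sup>2 + c * t\<^sup>2 + d * r * s + e * r * t + f * s * t"
      using ternary_form_zero_mod_prime[OF p] by blast
    have "qform A (r *s x + s *s y + t *s z) = p * (a * r\<^sup>2 + b * s\<^sup>2 + c * t\<^sup>2 + d * r * s + e * r * t + f * s * t)"
      unfolding qform_comb3 c by (simp add: algebra_simps)
    then have "p\<^sup>2 dvd qform A (r *s x + s *s y + t *s z)"
      using rst(2) by (simp add: power2_eq_square)
    then show ?thesis using rst(1) aniso by (auto simp: P_def)
  qed
  have c1: "(\<exists>x\<in>UNIV. \<exists>y\<in>UNIV. (\<forall>s t. s *s x + t *s y \<in> Z \<longrightarrow> p dvd s \<and> p dvd t) \<and>
            (\<forall>v\<in>UNIV. \<exists>s t. v - s *s x - t *s y \<in> Z)) \<or>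
         (\<exists>x\<in>UNIV. \<forall>v\<in>UNIV. \<exists>s. v - s *s x \<in> Z)"
    by (rule dimension_le_two_cases[OF p]) (use Zc pZ dep1 in auto)
  have c2: "(\<exists>x\<in>Z. \<exists>y\<in>Z. (\<forall>s t. s *s x + t *s y \<in> P \<longrightarrow> p dvd s \<and> p dvd t) \<and>
            (\<forall>v\<in>Z. \<exists>s t. v - s *s x - t *s y \<in> P)) \<or>
         (\<exists>x\<in>Z. \<forall>v\<in>Z. \<exists>s. v - s *s x \<in> P)"
    by (rule dimension_le_two_cases[OF p]) (use Zc Pc dep2 in \<open>auto simp: P_def Z_def\<close>)
  have p1: "p > 1" using p by (simp add: prime_gt_1_int)
  \<comment> \<open>The quotients of the lattice by \<open>Z\<close> and of \<open>Z\<close> by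
    \<open>P\<close> have at most two generators each. If one of them had a single generator, three
    vectors would generate the lattice modulo \<open>p\<close>.\<close>
  have no3: False if "\<And>v. \<exists>r s t. v - r *s x - s *s y - t *s z \<in> P" for x y z :: "int^'n"
    using generators_mod_prime_card[OF p1, of x y z] that n4 by (force simp: P_def)
  have gen1: "\<exists>x y. \<forall>v. \<exists>s t. v - s *s x - t *s y \<in> Z"
    using c1
  proof (elim disjE bexE)
    fix x assume "\<forall>v\<in>UNIV. \<exists>s. v - s *s x \<in> Z"
    then have "\<forall>v. \<exists>s t. v - s *s x - t *s 0 \<in> Z" by simp
    then show ?thesis by blast
  qed blast
  have gen2: "\<exists>x y. \<forall>v\<in>Z. \<exists>s t. v - s *s x - t *s y \<in> P"
    using c2
  proof (elim disjE bexE)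
    fix x assume "\<forall>v\<in>Z. \<exists>s. v - s *s x \<in> P"
    then have "\<forall>v\<in>Z. \<exists>s t. v - s *s x - t *s 0 \<in> P" by simp
    then show ?thesis by blast
  qed blast
  have ind1: "\<exists>x y. \<forall>s t. s *s x + t *s y \<in> Z \<longrightarrow> p dvd s \<and> p dvd t"
    using c1
  proof (elim disjE bexE)
    fix x assume x: "\<forall>v\<in>UNIV. \<exists>s. v - s *s x \<in> Z"
    obtain y z where yz: "\<forall>v\<in>Z. \<exists>s t. v - s *s y - t *s z \<in> P" using gen2 by blast
    have "\<exists>r s t. v - r *s x - s *s y - t *s z \<in> P" for v
    proof -
      obtain r where "v - r *s x \<in> Z" using x by blast
      then show ?thesis using yz by blast
    qed
    then show ?thesis using no3[of x y z] by blast
  qed blast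
  have ind2: "\<exists>x\<in>Z. \<exists>y\<in>Z. \<forall>s t. s *s x + t *s y \<in> P \<longrightarrow> p dvd s \<and> p dvd t"
    using c2
  proof (elim disjE bexE)
    fix z assume z: "\<forall>v\<in>Z. \<exists>s. v - s *s z \<in> P"
    obtain x y where xy: "\<forall>v. \<exists>s t. v - s *s x - t *s y \<in> Z" using gen1 by blast
    have "\<exists>r s t. v - r *s x - s *s y - t *s z \<in> P" for v
    proof -
      obtain r s where "v - r *s x - s *s y \<in> Z" using xy by blast
      then show ?thesis using z by blast
    qed
    then show ?thesis using no3[of x y z] by blast
  qed blast
  obtain x1 y1 where i1: "\<And>s t. s *s x1 + t *s y1 \<in> Z \<Longrightarrow> p dvd s \<and> p dvd t" using ind1 by blast
  obtain x2 y2 where i2: "x2 \<in> Z" "y2 \<in> Z" "\<And>s t. s *s x2 + t *s y2 \<in> P \<Longrightarrow> p dvd s \<and> p dvd t"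
    using ind2 by blast
  show ?thesis
  \<comment> \<open>The two planes serve \<open>a\<close> of valuation 0 and 1. A factor
    \<open>p^2\<close> of \<open>a\<close> is absorbed by scaling the vector with \<open>p\<close>,
    which leaves a congruence modulo \<open>p^(K - 2)\<close>.\<close>
  proof (induction K arbitrary: a rule: less_induct)
    case (less K)
    consider "\<not> p dvd a" | "p dvd a" "\<not> p\<^sup>2 dvd a" | "p\<^sup>2 dvd a" by blast
    then show ?case
    proof cases
      case a: 1
      show ?thesis
      proof (rule anisotropic_represents[OF p, of 0 a A x1 y1])
        fix s t assume "p ^ Suc 0 dvd qform A (s *s x1 + t *s y1)"
        then show "p dvd s \<and> p dvd t" using i1[of s t] by (simp add: Z_def)
      qed (use a in auto)
    next
      case a: 2
      show ?thesis
      proof (rule anisotropic_represents[OF p, of 1 a A x2 y2])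
        show "p ^ 1 dvd qpolar A x2 y2" using rad i2(1) by simp
        show "p ^ 1 dvd qform A x2" "p ^ 1 dvd qform A y2" using i2 by (auto simp: Z_def)
        fix s t assume "p ^ Suc 1 dvd qform A (s *s x2 + t *s y2)"
        then have "s *s x2 + t *s y2 \<in> P"
          unfolding P_def mem_Collect_eq by (intro aniso) (simp add: power2_eq_square)
        then show "p dvd s \<and> p dvd t" by (rule i2(3))
      qed (use a in \<open>auto simp: power2_eq_square\<close>)
    next
      case 3
      then obtain a' where a': "a = p\<^sup>2 * a'" by (rule dvdE)
      show ?thesis
      proof (cases "K \<le> 2")
        case True
        then have "p ^ K dvd p\<^sup>2" by (rule le_imp_power_dvd)
        then have "p ^ K dvd qform A 0 - a" using 3 by (simp add: dvd_trans)
        then show ?thesis by blast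
      next
        case False
        then obtain v where "p ^ (K - 2) dvd qform A v - a'" using less.IH[of "K - 2" a'] by auto
        then have "p\<^sup>2 * p ^ (K - 2) dvd p\<^sup>2 * (qform A v - a')" by (rule mult_dvd_mono[OF dvd_refl])
        moreover have "p\<^sup>2 * p ^ (K - 2) = p ^ K" using False by (metis le_add_diff_inverse nat_le_linear power_add)
        ultimately have "p ^ K dvd qform A (p *s v) - a"
          by (simp only: qform_scale a' right_diff_distrib)
        then show ?thesis by blast
      qed
    qed
  qed
qed

section \<open>Enlarging the lattice\<close>

definition vec_of_int :: "int^'n \<Rightarrow> 'a::ring_1^'n" where
  "vec_of_int v = (\<chi> i. of_int (v $ i))"

lemma qform_of_int: "qform A (vec_of_int v) = of_int (qform A v)"
  by (simp add: qform_def vec_of_int_def)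

lemma qpolar_of_int: "qpolar A (vec_of_int v) (vec_of_int w) = of_int (qpolar A v w)"
  by (simp add: qpolar_def vec_of_int_def)

lemma standard_lattice_iff: "v \<in> standard_lattice \<longleftrightarrow> (\<exists>u. v = vec_of_int u)"
proof
  assume "v \<in> standard_lattice"
  then have "\<forall>i. \<exists>k. v $ i = of_int k" by (auto simp: standard_lattice_def elim: Ints_cases)
  then obtain k where "\<And>i. v $ i = of_int (k i)" by metis
  then have "v = vec_of_int (\<chi> i. k i)" by (simp add: vec_of_int_def vec_eq_iff)
  then show "\<exists>u. v = vec_of_int u" by blast
qed (auto simp: standard_lattice_def vec_of_int_def)

lemma maximal_no_enlarging:
  fixes A :: "int^'n^'n"
  assumes max: "qform_maximal A" and p: "prime p"
  shows "\<not> enlarging p A e"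
proof
  assume "enlarging p A e"
  then have e: "\<not> vec_dvd p e" "p\<^sup>2 dvd qform A e" "\<And>g. p dvd qpolar A e g" by (auto simp: enlarging_def)
  define d :: "rat^'n" where "d = (1 / of_int p) *s vec_of_int e"
  have p0: "p \<noteq> 0" using p by auto
  have d: "d \<notin> standard_lattice"
  proof
    assume "d \<in> standard_lattice"
    then obtain u where u: "d = vec_of_int u" by (auto simp: standard_lattice_iff)
    have "e $ i = p * u $ i" for i
    proof -
      have "d $ i = of_int (u $ i)" by (simp add: u vec_of_int_def)
      then have "of_int (e $ i) = (of_int (p * u $ i) :: rat)"
        using p0 by (simp add: d_def vec_of_int_def field_simps)
      then show ?thesis by (simp only: of_int_eq_iff)
    qed
    then show False using e(1) by (auto simp: vec_dvd_def)
  qed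
  define M where "M = {vec_of_int u + of_int k *s d | u k. True}"
  have sub: "standard_lattice \<subset> M"
  proof
    show "standard_lattice \<subseteq> M"
    proof
      fix v :: "rat^'n" assume "v \<in> standard_lattice"
      then obtain u where "v = vec_of_int u + of_int 0 *s d" by (auto simp: standard_lattice_iff)
      then show "v \<in> M" unfolding M_def by blast
    qed
    have "d = vec_of_int 0 + of_int 1 *s d" by (simp add: vec_of_int_def vec_eq_iff)
    then have "d \<in> M" unfolding M_def by blast
    then show "standard_lattice \<noteq> M" using d by blast
  qed
  have int: "qform A v \<in> \<int>" if "v \<in> M" for v
  proof -
    obtain u k where v: "v = vec_of_int u + of_int k *s d" using \<open>v \<in> M\<close> by (auto simp: M_def)
    obtain f where f: "qform A e = p\<^sup>2 * f" using e(2) by (rule dvdE)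
    obtain g where g: "qpolar A e u = p * g" using e(3) by (rule dvdE)
    have "qform A d = of_int f"
      using p0 unfolding d_def qform_scale qform_of_int f by (simp add: power2_eq_square)
    moreover have "qpolar A (vec_of_int u) d = of_int g"
      using p0 unfolding d_def qpolar_scale_right qpolar_of_int qpolar_commute[of A u] g by simp
    ultimately have "qform A v = of_int (f * k\<^sup>2 + g * k + qform A u)"
      unfolding v qform_line qform_of_int by simp
    then show ?thesis by (simp only: Ints_of_int)
  qed
  let ?X = "range (\<lambda>i. axis i 1 :: rat^'n)"
  have X: "?X \<subseteq> standard_lattice" by (auto simp: standard_lattice_def axis_def)
  have fin: "finite ?X" by simp
  \<comment> \<open>In \<open>Z_lattice\<close> the coefficients are indexed by the generating
    vectors themselves, so \<open>d\<close> has to differ from the unit vectors.\<close>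
  have dX: "d \<notin> ?X" using X d by blast
  have inj: "inj (\<lambda>i. axis i 1 :: rat^'n)" by (auto simp: inj_def axis_eq_axis)
  have ins: "(\<Sum>b\<in>insert d ?X. of_int (c b) *s b) = vec_of_int (\<chi> i. c (axis i 1)) + of_int (c d) *s d" for c
  proof -
    have "(\<Sum>b\<in>?X. of_int (c b) *s b) = (\<Sum>i\<in>UNIV. of_int (c (axis i 1)) *s (axis i 1 :: rat^'n))"
      using sum.reindex[OF inj] by simp
    also have "\<dots> = vec_of_int (\<chi> i. c (axis i 1))"
      by (simp add: vec_eq_iff vec_of_int_def axis_def if_distrib cong: if_cong)
    finally show ?thesis using dX fin by (simp add: add.commute)
  qed
  have "M = {\<Sum>b\<in>insert d ?X. of_int (c b) *s b | c :: rat^'n \<Rightarrow> int. True}"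
  proof (intro equalityI subsetI)
    fix v assume "v \<in> M"
    then obtain u k where v: "v = vec_of_int u + of_int k *s d" by (auto simp: M_def)
    define c where "c b = (if b = d then k else u $ (THE i. b = axis i 1))" for b :: "rat^'n"
    have "c (axis i 1) = u $ i" for i
    proof -
      have "(THE j. axis i 1 = (axis j 1 :: rat^'n)) = i" by (rule the_equality) (auto simp: axis_eq_axis)
      moreover have "axis i 1 \<noteq> d" using dX by blast
      ultimately show ?thesis by (simp add: c_def)
    qed
    then have "v = (\<Sum>b\<in>insert d ?X. of_int (c b) *s b)"
      unfolding ins v by (simp add: c_def)
    then show "v \<in> {\<Sum>b\<in>insert d ?X. of_int (c b) *s b | c :: rat^'n \<Rightarrow> int. True}" by blast
  next
    fix v assume "v \<in> {\<Sum>b\<in>insert d ?X. of_int (c b) *s b | c :: rat^'n \<Rightarrow> int. True}"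
    then show "v \<in> M" unfolding ins M_def by blast
  qed
  moreover have "vec.span M = UNIV"
  proof -
    have "?X = cart_basis" by (auto simp: cart_basis_def)
    then have "vec.span ?X = UNIV" by simp
    moreover have "vec.span ?X \<subseteq> vec.span M" using X sub by (intro vec.span_mono) blast
    ultimately show ?thesis by blast
  qed
  ultimately have "Z_lattice M"
    unfolding Z_lattice_def using fin by (intro conjI exI[of _ "insert d ?X"]) simp_all
  then show False using max sub int unfolding qform_maximal_def by blast
qed

section \<open>Gram determinants and passage to a larger lattice\<close>

lemma sum_axis_mult: "(\<Sum>r\<in>UNIV. axis j 1 $ r * f r) = (f j :: 'a::semiring_1)"
proof -
  have "(\<Sum>r\<in>UNIV. axis j 1 $ r * f r) = (\<Sum>r\<in>UNIV. if r = j then f r else 0)"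
    by (intro sum.cong) (auto simp: axis_def)
  then show ?thesis by simp
qed

text \<open>The matrix of the polar form. Its determinant shrinks under every enlargement of the
  lattice and thereby bounds their number.\<close>

definition gram :: "int^'n^'n \<Rightarrow> int^'n^'n" where
  "gram A = (\<chi> i j. A $ i $ j + A $ j $ i)"

lemma qpolar_eq_sum:
  "qpolar A v w = (\<Sum>r\<in>UNIV. v $ r * (\<Sum>c\<in>UNIV. of_int (gram A $ r $ c) * w $ c))"
proof -
  have "qpolar A v w = (\<Sum>i\<in>UNIV. \<Sum>j\<in>UNIV. of_int (A $ i $ j) * (v $ i * w $ j)) +
      (\<Sum>i\<in>UNIV. \<Sum>j\<in>UNIV. of_int (A $ i $ j) * (w $ i * v $ j))"
    by (simp add: qpolar_def distrib_left sum.distrib)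
  also have "(\<Sum>i\<in>UNIV. \<Sum>j\<in>UNIV. of_int (A $ i $ j) * (w $ i * v $ j)) =
      (\<Sum>j\<in>UNIV. \<Sum>i\<in>UNIV. of_int (A $ i $ j) * (w $ i * v $ j))" by (rule sum.swap)
  finally show ?thesis
    by (simp add: gram_def sum_distrib_left algebra_simps flip: sum.distrib)
qed

lemma qpolar_eq_gram: "qpolar A v w = (\<Sum>r\<in>UNIV. v $ r * (gram A *v w) $ r)"
  by (simp add: qpolar_eq_sum matrix_vector_mult_def)

lemma det_of_int:
  fixes M :: "int^'n^'n"
  shows "det (\<chi> i j. of_int (M $ i $ j)) = (of_int (det M) :: 'a::comm_ring_1)"
  by (simp add: det_def)

lemma nondegenerate_det_gram:
  fixes A :: "int^'n^'n"
  assumes "qform_nondegenerate A"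
  shows "det (gram A) \<noteq> 0"
proof -
  define G :: "rat^'n^'n" where "G = (\<chi> i j. of_int (gram A $ i $ j))"
  have "x = 0" if "G *v x = 0" for x
  proof -
    have "qpolar A w x = 0" for w
    proof -
      have "(\<Sum>c\<in>UNIV. of_int (gram A $ r $ c) * x $ c) = (G *v x) $ r" for r
        by (simp add: G_def matrix_vector_mult_def)
      then show ?thesis using that by (simp add: qpolar_eq_sum)
    qed
    then have "\<forall>w. qform A (x + w) - qform A x - qform A w = 0"
      by (simp add: qpolar_commute[of A x] flip: qpolar_eq_diff)
    then show ?thesis using assms unfolding qform_nondegenerate_def by blast
  qed
  then have "\<exists>B. B ** G = mat 1" unfolding matrix_left_invertible_ker by simp
  then obtain B where "B ** G = mat 1" ..
  then have "det (B ** G) = 1" by simp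
  then have "det B * det G = 1" by (simp only: det_mul)
  then have "det G \<noteq> 0" by auto
  then show ?thesis unfolding G_def det_of_int by simp
qed

lemma matrix_eq_bilinear:
  fixes M N :: "int^'n^'n"
  assumes "\<And>x y. (\<Sum>r\<in>UNIV. x $ r * (M *v y) $ r) = (\<Sum>r\<in>UNIV. x $ r * (N *v y) $ r)"
  shows "M = N"
proof -
  have col: "(L *v axis c 1) $ r = L $ r $ c" for L :: "int^'n^'n" and r c
    using sum_axis_mult[of c "\<lambda>j. L $ r $ j"] by (simp add: matrix_vector_mult_def mult.commute)
  have "M $ r $ c = N $ r $ c" for r c
    using assms[of "axis r 1" "axis c 1"] by (simp add: sum_axis_mult col)
  then show ?thesis by (simp add: vec_eq_iff)
qed

text \<open>The matrix adds \<open>w_i u\<close> to \<open>w\<close>. As \<open>u_i = 0\<close>,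
  adding \<open>- w_i u\<close> undoes this, so its determinant is a unit of the integers.\<close>

lemma abs_det_transvection:
  fixes u :: "int^'n"
  assumes "u $ i = 0"
  shows "\<bar>det (\<chi> r c. (if r = c then 1 else 0) + u $ r * (if c = i then 1 else 0))\<bar> = 1"
proof -
  define E where "E u = (\<chi> r c. (if r = c then 1 else 0) + u $ r * (if c = i then 1 else 0))" for u :: "int^'n"
  have E: "E u *v w = w + w $ i *s u" for u w
  proof -
    have "(\<Sum>c\<in>UNIV. ((if r = c then 1 else 0) + u $ r * (if c = i then 1 else 0)) * w $ c) = w $ r + w $ i * u $ r" for r
    proof -
      have "(\<Sum>c\<in>UNIV. ((if r = c then 1 else 0) + u $ r * (if c = i then 1 else 0)) * w $ c) =
          (\<Sum>c\<in>UNIV. (if c = r then w $ c else 0) + (if c = i then w $ c * u $ r else 0))"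
        by (intro sum.cong) (auto simp: algebra_simps)
      then show ?thesis by (simp add: sum.distrib)
    qed
    then show ?thesis by (simp add: E_def matrix_vector_mult_def vec_eq_iff)
  qed
  have "E u ** E (- u) = mat 1"
    using assms by (simp add: matrix_eq E flip: matrix_vector_mul_assoc)
  then have "det (E u ** E (- u)) = 1" by simp
  then have "det (E u) * det (E (- u)) = 1" by (simp only: det_mul)
  then have "det (E u) = 1 \<or> det (E u) = - 1" using zmult_eq_1_iff by blast
  then show ?thesis unfolding E_def[symmetric] by auto
qed

text \<open>The columns of \<open>R\<close> are \<open>e\<close> and \<open>p\<close> times the unit
  vectors other than the \<open>i\<close>-th, that is, \<open>p\<close> times a basis of the lattice
  enlarged by \<open>e/p\<close>; \<open>A'\<close> is the form on that basis. Up to sign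
  \<open>det R\<close> is \<open>p^(n-1)\<close>, so comparing Gram determinants gives
  \<open>det (gram A) = p^2 det (gram A')\<close>. The last conjunct carries isotropic vectors of
  \<open>A\<close> over to \<open>A'\<close>.\<close>

lemma enlarge_step:
  fixes A :: "int^'n^'n" and p :: int
  assumes p: "prime p" and en: "enlarging p A e0" and G: "det (gram A) \<noteq> 0"
  shows "\<exists>R A' :: int^'n^'n. (\<forall>w. qform A (R *v w) = p\<^sup>2 * qform A' w) \<and> det (gram A') \<noteq> 0 \<and>
    \<bar>det (gram A')\<bar> < \<bar>det (gram A)\<bar> \<and> (\<forall>w. \<exists>k. k \<noteq> 0 \<and> (\<exists>z. R *v z = k *s w))"
proof -
  have e0: "\<not> vec_dvd p e0" "p\<^sup>2 dvd qform A e0" "\<And>g. p dvd qpolar A e0 g" using en by (auto simp: enlarging_def)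
  have p1: "p > 1" using p by (simp add: prime_gt_1_int)
  obtain i where i: "\<not> p dvd e0 $ i" using e0(1) by (auto simp: vec_dvd_def)
  have "coprime (e0 $ i) (p\<^sup>2)" using prime_imp_coprime[OF p i] by (simp add: coprime_commute)
  then obtain c where "[e0 $ i * c = 1] (mod p\<^sup>2)" using cong_solve_coprime_int by blast
  then have "p\<^sup>2 dvd e0 $ i * c - 1" by (simp add: cong_iff_dvd_diff)
  then obtain k where k: "e0 $ i * c - 1 = p\<^sup>2 * k" by (rule dvdE)
  \<comment> \<open>Scaling by an inverse modulo \<open>p^2\<close> and correcting by a multiple of
    \<open>p^2\<close> makes the \<open>i\<close>-th coordinate exactly 1. Then \<open>e\<close> and
    the other unit vectors form a basis, and the divisibilities of \<open>e0\<close>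
    persist.\<close>
  define e where "e = c *s e0 + (- (p\<^sup>2 * k)) *s axis i 1"
  have ei: "e $ i = 1" using k by (simp add: e_def axis_def mult.commute)
  have fe: "p\<^sup>2 dvd qform A e"
  proof -
    have "qform A e = qform A (axis i 1) * (- (p\<^sup>2 * k))\<^sup>2 + qpolar A (c *s e0) (axis i 1) * (- (p\<^sup>2 * k)) + c\<^sup>2 * qform A e0"
      unfolding e_def qform_line qform_scale ..
    moreover have "p\<^sup>2 dvd (- (p\<^sup>2 * k))\<^sup>2" by (simp add: power2_eq_square)
    ultimately show ?thesis using e0(2) by (simp add: dvd_diff)
  qed
  have Be: "p dvd qpolar A e g" for g
    using e0(3)[of g] by (simp add: e_def qpolar_bilinear power2_eq_square dvd_diff)
  define b where "b = gram A *v e"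
  have b: "p dvd b $ j" for j
  proof -
    have "qpolar A (axis j 1) e = b $ j"
      by (simp add: qpolar_eq_gram b_def sum_axis_mult)
    then show ?thesis using Be[of "axis j 1"] by (simp add: qpolar_commute)
  qed
  obtain fe' where fe': "qform A e = p\<^sup>2 * fe'" using fe by (rule dvdE)
  have "\<forall>j. \<exists>x. b $ j = p * x" using b by (auto elim: dvdE)
  then obtain b' where b': "\<And>j. b $ j = p * b' j" by metis
  \<comment> \<open>Matrices need not be symmetric, so the cross terms with the new basis vector are
    all put into row \<open>i\<close>, and the rest of column \<open>i\<close> is 0.\<close>
  define A' :: "int^'n^'n" where "A' = (\<chi> r c. if r = i then (if c = i then fe' else b' c) else if c = i then 0 else A $ r $ c)"
  define R :: "int^'n^'n" where "R = (\<chi> r c. if c = i then e $ r else if r = c then p else 0)"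
  define o' where "o' w = (\<chi> r. if r = i then 0 else w $ r)" for w :: "int^'n"
  have R: "R *v w = p *s o' w + w $ i *s e" for w
  proof -
    have "(\<Sum>c\<in>UNIV. (if c = i then e $ r else if r = c then p else 0) * w $ c) =
        (if r = i then 0 else p * w $ r) + w $ i * e $ r" for r
    proof -
      have "(\<Sum>c\<in>UNIV. (if c = i then e $ r else if r = c then p else 0) * w $ c) =
          (\<Sum>c\<in>UNIV. (if c = i then w $ i * e $ r else 0) + (if c = r then (if r = i then 0 else p * w $ r) else 0))"
        by (rule sum.cong) auto
      then show ?thesis by (simp add: sum.distrib)
    qed
    then show ?thesis by (simp add: R_def matrix_vector_mult_def vec_eq_iff o'_def)
  qed
  have fR: "qform A (R *v w) = p\<^sup>2 * qform A' w" for w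
  proof -
    have "p\<^sup>2 * qform A' w = (\<Sum>r\<in>UNIV. \<Sum>c\<in>UNIV. p\<^sup>2 * (A' $ r $ c * w $ r * w $ c))"
      by (simp add: qform_def sum_distrib_left)
    also have "\<dots> = (\<Sum>r\<in>UNIV. \<Sum>c\<in>UNIV. (if c = i then if r = i then qform A e * (w $ i)\<^sup>2 else 0 else 0) +
        (if r = i then p * w $ i * (o' w $ c * b $ c) else 0) + p\<^sup>2 * (A $ r $ c * o' w $ r * o' w $ c))"
      by (intro sum.cong refl) (auto simp: A'_def o'_def fe' b' power2_eq_square)
    also have "\<dots> = qform A e * (w $ i)\<^sup>2 + (\<Sum>r\<in>UNIV. if r = i then \<Sum>c\<in>UNIV. p * w $ i * (o' w $ c * b $ c) else 0) +
        p\<^sup>2 * qform A (o' w)"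
    proof -
      have "(\<Sum>r\<in>UNIV. \<Sum>c\<in>UNIV. (if r = i then p * w $ i * (o' w $ c * b $ c) else 0)) =
          (\<Sum>r\<in>UNIV. if r = i then \<Sum>c\<in>UNIV. p * w $ i * (o' w $ c * b $ c) else 0)"
        by (intro sum.cong refl) auto
      then show ?thesis by (simp add: sum.distrib qform_def sum_distrib_left)
    qed
    also have "(\<Sum>r\<in>UNIV. if r = i then \<Sum>c\<in>UNIV. p * w $ i * (o' w $ c * b $ c) else 0) = p * w $ i * qpolar A (o' w) e"
      by (simp add: qpolar_eq_gram b_def sum_distrib_left)
    also have "qform A e * (w $ i)\<^sup>2 + p * w $ i * qpolar A (o' w) e + p\<^sup>2 * qform A (o' w) = qform A (R *v w)"
      unfolding R qform_line by (simp add: qform_scale qpolar_bilinear)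
    finally show ?thesis ..
  qed
  have pR: "qpolar A (R *v x) (R *v y) = p\<^sup>2 * qpolar A' x y" for x y
    unfolding qpolar_eq_diff by (simp add: fR algebra_simps flip: matrix_vector_right_distrib)
  have tr: "(\<Sum>r\<in>UNIV. x $ r * (transpose R *v z) $ r) = (\<Sum>r\<in>UNIV. (R *v x) $ r * z $ r)" for x z
  proof -
    have "(\<Sum>r\<in>UNIV. x $ r * (transpose R *v z) $ r) = (\<Sum>r\<in>UNIV. \<Sum>c\<in>UNIV. x $ r * (R $ c $ r * z $ c))"
      by (simp add: matrix_vector_mult_def transpose_def sum_distrib_left)
    also have "\<dots> = (\<Sum>c\<in>UNIV. \<Sum>r\<in>UNIV. x $ r * (R $ c $ r * z $ c))" by (rule sum.swap)
    finally show ?thesis by (simp add: matrix_vector_mult_def sum_distrib_right sum_distrib_left mult_ac)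
  qed
  have "transpose R ** (gram A ** R) = (\<chi> r. p\<^sup>2 *s gram A' $ r)"
  proof (rule matrix_eq_bilinear)
    fix x y
    have "(\<Sum>r\<in>UNIV. x $ r * (transpose R ** (gram A ** R) *v y) $ r) = qpolar A (R *v x) (R *v y)"
      by (simp only: qpolar_eq_gram tr matrix_vector_mul_assoc[symmetric])
    also have "\<dots> = (\<Sum>r\<in>UNIV. x $ r * ((\<chi> r. p\<^sup>2 *s gram A' $ r) *v y) $ r)"
      unfolding pR by (simp add: qpolar_eq_gram matrix_vector_mult_def sum_distrib_left mult_ac)
    finally show "(\<Sum>r\<in>UNIV. x $ r * (transpose R ** (gram A ** R) *v y) $ r) =
        (\<Sum>r\<in>UNIV. x $ r * ((\<chi> r. p\<^sup>2 *s gram A' $ r) *v y) $ r)" .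
  qed
  then have "det (transpose R ** (gram A ** R)) = (p\<^sup>2) ^ CARD('n) * det (gram A')"
    by (simp add: det_rows_mul)
  moreover have "(p\<^sup>2) ^ CARD('n) = (p ^ CARD('n))\<^sup>2" by (simp only: mult.commute flip: power_mult)
  moreover have "det (transpose R ** (gram A ** R)) = (det R)\<^sup>2 * det (gram A)"
    unfolding det_mul det_transpose by (simp add: power2_eq_square)
  ultimately have det1: "(det R)\<^sup>2 * det (gram A) = (p ^ CARD('n))\<^sup>2 * det (gram A')" by (simp only:)
  have detR: "\<bar>det R\<bar> = p ^ (CARD('n) - 1)"
  proof -
    \<comment> \<open>\<open>R\<close> is a transvection times a diagonal matrix with one entry 1
      and the others \<open>p\<close>.\<close>
    define u where "u = e - axis i 1"
    define E where "E = (\<chi> r c. (if r = c then 1 else 0) + u $ r * (if c = i then 1 else 0))"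
    define D :: "int^'n^'n" where "D = (\<chi> r c. if r = c then (if r = i then 1 else p) else 0)"
    have "R = E ** D"
    proof -
      have "(\<Sum>k\<in>UNIV. ((if r = k then 1 else 0) + u $ r * (if k = i then 1 else 0)) * (if k = c then (if k = i then 1 else p) else 0)) =
          (if c = i then e $ r else if r = c then p else 0)" for r c
      proof -
        have "(\<Sum>k\<in>UNIV. ((if r = k then 1 else 0) + u $ r * (if k = i then 1 else 0)) * (if k = c then (if k = i then 1 else p) else 0)) =
            (\<Sum>k\<in>UNIV. if k = c then ((if r = c then 1 else 0) + u $ r * (if c = i then 1 else 0)) * (if c = i then 1 else p) else 0)"
          by (rule sum.cong[OF refl]) simp
        then show ?thesis using ei by (auto simp: u_def axis_def)
      qed
      then show ?thesis by (simp add: R_def E_def D_def matrix_matrix_mult_def vec_eq_iff)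
    qed
    moreover have "\<bar>det E\<bar> = 1" unfolding E_def by (rule abs_det_transvection) (simp add: u_def axis_def ei)
    moreover have "det D = p ^ (CARD('n) - 1)"
    proof -
      have "det D = (\<Prod>r\<in>UNIV. D $ r $ r)" by (rule det_diagonal) (simp add: D_def)
      also have "\<dots> = (\<Prod>r\<in>UNIV. if r = i then 1 else p)" by (simp add: D_def)
      also have "\<dots> = (\<Prod>r\<in>UNIV - {i}. p)" by (subst prod.remove[of _ i]) auto
      finally show ?thesis by simp
    qed
    ultimately show ?thesis using p1 by (simp add: det_mul abs_mult)
  qed
  have "p ^ CARD('n) = p * p ^ (CARD('n) - 1)"
    by (metis One_nat_def Suc_pred power_Suc zero_less_card_finite)
  moreover have "(det R)\<^sup>2 = (p ^ (CARD('n) - 1))\<^sup>2" using detR by (metis power2_abs)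
  ultimately have "(p ^ (CARD('n) - 1))\<^sup>2 * det (gram A) = (p ^ (CARD('n) - 1))\<^sup>2 * (p\<^sup>2 * det (gram A'))"
    using det1 by (simp add: power_mult_distrib mult_ac)
  then have det2: "det (gram A) = p\<^sup>2 * det (gram A')" using p1 by simp
  show ?thesis
  proof (rule exI[of _ R], rule exI[of _ A'], intro conjI allI)
    show "qform A (R *v w) = p\<^sup>2 * qform A' w" for w by (rule fR)
    show n0: "det (gram A') \<noteq> 0" using det2 G by auto
    have "1 * \<bar>det (gram A')\<bar> < p\<^sup>2 * \<bar>det (gram A')\<bar>"
      using n0 p1 by (intro mult_strict_right_mono one_less_power) auto
    then show "\<bar>det (gram A')\<bar> < \<bar>det (gram A)\<bar>" unfolding det2 abs_mult by simp
    fix w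
    \<comment> \<open>This vector is found by solving \<open>R z = p w\<close>, starting with
      coordinate \<open>i\<close>, where \<open>e\<close> has entry 1.\<close>
    have "R *v (\<chi> r. if r = i then p * w $ i else w $ r - w $ i * e $ r) = p *s w"
      unfolding R by (simp add: vec_eq_iff o'_def ei algebra_simps)
    then show "\<exists>k. k \<noteq> 0 \<and> (\<exists>z. R *v z = k *s w)" using p1 by (intro exI[of _ p]) auto
  qed
qed

lemma primitive_multiple:
  fixes e :: "int^'n" and p :: int
  assumes "p > 1" "e \<noteq> 0"
  shows "\<exists>e' k. e = k *s e' \<and> k \<noteq> 0 \<and> \<not> vec_dvd p e'"
  using assms(2)
proof (induction "nat (\<Sum>i\<in>UNIV. \<bar>e $ i\<bar>)" arbitrary: e rule: less_induct)
  case less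
  show ?case
  proof (cases "vec_dvd p e")
    case True
    then obtain u where u: "e = p *s u" by (rule vec_dvdE)
    have u0: "u \<noteq> 0" using less.prems u by auto
    have s: "(\<Sum>i\<in>UNIV. \<bar>e $ i\<bar>) = p * (\<Sum>i\<in>UNIV. \<bar>u $ i\<bar>)"
      using assms(1) by (simp add: u abs_mult sum_distrib_left)
    have "(\<Sum>i\<in>UNIV. \<bar>u $ i\<bar>) > 0"
    proof -
      obtain j where "u $ j \<noteq> 0" using u0 by (auto simp: vec_eq_iff)
      then show ?thesis by (intro sum_pos2[of _ j]) auto
    qed
    then have "1 * (\<Sum>i\<in>UNIV. \<bar>u $ i\<bar>) < (\<Sum>i\<in>UNIV. \<bar>e $ i\<bar>)"
      unfolding s using assms(1) by (intro mult_strict_right_mono)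
    then have "nat (\<Sum>i\<in>UNIV. \<bar>u $ i\<bar>) < nat (\<Sum>i\<in>UNIV. \<bar>e $ i\<bar>)"
      using \<open>(\<Sum>i\<in>UNIV. \<bar>u $ i\<bar>) > 0\<close> by simp
    from less.hyps[OF this u0] obtain e' k where "u = k *s e'" "k \<noteq> 0" "\<not> vec_dvd p e'" by blast
    then have "e = (p * k) *s e'" "p * k \<noteq> 0" "\<not> vec_dvd p e'" using u assms(1) by auto
    then show ?thesis by blast
  next
    case False
    then have "e = 1 *s e \<and> (1::int) \<noteq> 0 \<and> \<not> vec_dvd p e" by simp
    then show ?thesis by blast
  qed
qed

text \<open>Descent on the absolute Gram determinant; \<open>j\<close> counts the enlargements, each
  of which multiplies the represented numbers by \<open>p^2\<close>. When no enlarging vector is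
  left, \<open>no_enlarging_represents\<close> applies.\<close>

theorem represents_up_to_squares:
  fixes A :: "int^'n^'n" and p :: int
  assumes p: "prime p" and G: "det (gram A) \<noteq> 0"
    and dim: "CARD('n) \<ge> 4 \<or> (\<exists>e::int^'n. e \<noteq> 0 \<and> qform A e = 0)"
  shows "\<exists>j. \<forall>a K. \<exists>w. p ^ K dvd qform A w - p ^ (2 * j) * a"
  using G dim
proof (induction "nat \<bar>det (gram A)\<bar>" arbitrary: A rule: less_induct)
  case less
  have p1: "p > 1" using p by (simp add: prime_gt_1_int)
  show ?case
  proof (cases "\<exists>e. enlarging p A e")
    case True
    then obtain e where e: "enlarging p A e" by blast
    from enlarge_step[OF p e less.prems(1)] obtain R A' :: "int^'n^'n" where
      A': "\<forall>w. qform A (R *v w) = p\<^sup>2 * qform A' w" "det (gram A') \<noteq> 0"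
        "\<bar>det (gram A')\<bar> < \<bar>det (gram A)\<bar>" "\<forall>w. \<exists>k. k \<noteq> 0 \<and> (\<exists>z. R *v z = k *s w)"
      by (elim exE conjE)
    have "nat \<bar>det (gram A')\<bar> < nat \<bar>det (gram A)\<bar>" using A'(3) less.prems(1) by simp
    moreover have "CARD('n) \<ge> 4 \<or> (\<exists>e::int^'n. e \<noteq> 0 \<and> qform A' e = 0)"
      using less.prems(2)
    proof
      assume "\<exists>e::int^'n. e \<noteq> 0 \<and> qform A e = 0"
      then obtain e :: "int^'n" where e: "e \<noteq> 0" "qform A e = 0" by blast
      from spec[OF A'(4), of e] obtain k z where kz: "k \<noteq> 0" "R *v z = k *s e" by (elim exE conjE)
      have "z \<noteq> 0" using kz e(1) by auto
      moreover have "qform A' z = 0" using spec[OF A'(1), of z] e(2) p1 unfolding kz(2) by (simp add: qform_scale)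
      ultimately show ?thesis by blast
    qed simp
    ultimately obtain j where j: "\<And>a K. \<exists>w. p ^ K dvd qform A' w - p ^ (2 * j) * a"
      using less.hyps[OF _ A'(2)] by blast
    have "\<exists>w. p ^ K dvd qform A w - p ^ (2 * Suc j) * a" for a K
    proof -
      obtain w where "p ^ K dvd qform A' w - p ^ (2 * j) * a" using j by blast
      then have "p ^ K dvd p\<^sup>2 * (qform A' w - p ^ (2 * j) * a)" by simp
      moreover have "p\<^sup>2 * (qform A' w - p ^ (2 * j) * a) = qform A (R *v w) - p ^ (2 * Suc j) * a"
        unfolding spec[OF A'(1), of w] by (simp add: algebra_simps power2_eq_square)
      ultimately have "p ^ K dvd qform A (R *v w) - p ^ (2 * Suc j) * a" by (simp only:)
      then show ?thesis by blast
    qed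
    then show ?thesis by blast
  next
    case False
    have "CARD('n) \<ge> 4 \<or> (\<exists>e. \<not> vec_dvd p e \<and> qform A e = 0)"
      using less.prems(2)
    proof
      assume "\<exists>e::int^'n. e \<noteq> 0 \<and> qform A e = 0"
      then obtain e :: "int^'n" where e: "e \<noteq> 0" "qform A e = 0" by blast
      obtain e' k where "e = k *s e'" "k \<noteq> 0" "\<not> vec_dvd p e'" using primitive_multiple[OF p1 e(1)] by blast
      then show ?thesis using e(2) by (auto simp: qform_scale)
    qed simp
    then have "\<exists>w. p ^ K dvd qform A w - p ^ (2 * 0) * a" for a K
      using False by (simp only: mult_0_right power_0 mult_1) (rule no_enlarging_represents[OF p], auto)
    then show ?thesis by blast
  qed
qed

section \<open>Density of the represented integers\<close>

lemma qform_cong: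
  assumes "vec_dvd m (v - w)"
  shows "m dvd qform A v - qform A w"
proof -
  obtain u where "v - w = m *s u" using assms by (rule vec_dvdE)
  then have v: "v = w + m *s u" by (simp add: algebra_simps)
  have "qform A v - qform A w = m * (qform A u * m + qpolar A w u)"
    unfolding v qform_line by (simp add: algebra_simps power2_eq_square)
  then show ?thesis by simp
qed

lemma qpolar_cong:
  assumes "vec_dvd m (v - w)"
  shows "m dvd qpolar A v e - qpolar A w e"
proof -
  obtain u where "v - w = m *s u" using assms by (rule vec_dvdE)
  then have v: "v = w + m *s u" by (simp add: algebra_simps)
  show ?thesis unfolding v by (simp add: qpolar_bilinear)
qed

lemma chinese_remainder_vec:
  fixes m :: "'a \<Rightarrow> int" and u :: "'a \<Rightarrow> int^'n"
  assumes "finite P" and "\<And>p q. p \<in> P \<Longrightarrow> q \<in> P \<Longrightarrow> p \<noteq> q \<Longrightarrow> coprime (m p) (m q)"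
  shows "\<exists>v. \<forall>p\<in>P. vec_dvd (m p) (v - u p)"
  using assms
proof (induction P)
  case (insert p P)
  then obtain v where v: "\<forall>q\<in>P. vec_dvd (m q) (v - u q)" by blast
  define M where "M = (\<Prod>q\<in>P. m q)"
  have "coprime M (m p)" unfolding M_def using insert by (intro prod_coprime_left) auto
  then obtain s where "[M * s = 1] (mod m p)" using cong_solve_coprime_int by blast
  then have "m p dvd M * s - 1" by (simp add: cong_iff_dvd_diff)
  then obtain k where k: "M * s - 1 = m p * k" by (rule dvdE)
  define v' where "v' = v + (M * s) *s (u p - v)"
  have "v' - u p = m p *s (k *s (u p - v))"
  proof (subst vec_eq_iff, intro allI)
    fix i
    have "M * s = 1 + m p * k" using k by simp
    then show "(v' - u p) $ i = (m p *s (k *s (u p - v))) $ i"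
      by (simp add: v'_def algebra_simps)
  qed
  then have "vec_dvd (m p) (v' - u p)" by (simp only: vec_dvd_smult)
  moreover have "vec_dvd (m q) (v' - u q)" if q: "q \<in> P" for q
  proof -
    have "m q dvd M" unfolding M_def using insert q by (intro dvd_prodI) auto
    then have "vec_dvd (m q) ((M * s) *s (u p - v))" by (simp add: vec_dvd_def)
    then have "vec_dvd (m q) ((v - u q) + (M * s) *s (u p - v))" using v q by (intro vec_dvd_add) auto
    moreover have "(v - u q) + (M * s) *s (u p - v) = v' - u q" by (simp add: v'_def)
    ultimately show ?thesis by (simp only:)
  qed
  ultimately show ?case by blast
qed simp

lemma represents_all_moduli:
  fixes A :: "int^'n^'n" and m a :: int
  assumes loc: "\<And>p K a. prime (p::int) \<Longrightarrow> \<exists>v. p ^ K dvd qform A v - a" and m: "m > 0"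
  shows "\<exists>v. m dvd qform A v - a"
proof -
  let ?e = "\<lambda>p. p ^ multiplicity p m"
  have "\<forall>p\<in>prime_factors m. \<exists>v. ?e p dvd qform A v - a"
    by (intro ballI loc) (auto simp: prime_factors_dvd)
  then obtain u where u: "\<And>p. p \<in> prime_factors m \<Longrightarrow> ?e p dvd qform A (u p) - a" by metis
  have cop: "coprime (?e p) (?e q)" if "p \<in> prime_factors m" "q \<in> prime_factors m" "p \<noteq> q" for p q
    using that by (intro coprime_power_left_iff[THEN iffD2] disjI1) (auto intro!: primes_coprime simp: prime_factors_dvd)
  obtain v where v: "\<forall>p\<in>prime_factors m. vec_dvd (?e p) (v - u p)"
    using chinese_remainder_vec[of "prime_factors m" ?e u] cop by auto
  have "\<forall>p\<in>prime_factors m. [qform A v = a] (mod ?e p)"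
  proof
    fix p assume p: "p \<in> prime_factors m"
    have "?e p dvd (qform A v - qform A (u p)) + (qform A (u p) - a)"
      using qform_cong[OF bspec[OF v p], of A] u[OF p] by (rule dvd_add)
    then show "[qform A v = a] (mod ?e p)" by (simp add: cong_iff_dvd_diff)
  qed
  then have "[qform A v = a] (mod (\<Prod>p\<in>prime_factors m. ?e p))"
    using cop by (intro cong_cong_prod_coprime) auto
  moreover have "(\<Prod>p\<in>prime_factors m. ?e p) = m"
    using m by (subst prod_prime_factors) auto
  ultimately show ?thesis by (auto simp: cong_iff_dvd_diff)
qed

lemma prime_power_decompose:
  fixes p d :: int
  assumes "prime p" "\<not> p ^ Suc T dvd d"
  obtains \<tau> b where "d = p ^ \<tau> * b" "\<not> p dvd b" "\<tau> \<le> T"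
proof -
  have "d \<noteq> 0" using assms by auto
  then obtain b where b: "d = p ^ multiplicity p d * b" "\<not> p dvd b"
    using multiplicity_decompose'[of d p] assms(1) by (metis not_prime_unit)
  have "multiplicity p d \<le> T"
  proof (rule ccontr)
    assume "\<not> multiplicity p d \<le> T"
    then have "p ^ Suc T dvd p ^ multiplicity p d" by (intro le_imp_power_dvd) simp
    then show False using assms(2) b(1) by (metis dvd_mult2)
  qed
  then show thesis using b by (intro that)
qed

text \<open>A solution \<open>v\<close> of \<open>f v \<equiv> n\<close> that is too close to the hyperplane orthogonal to \<open>e\<close> is moved off it
  along \<open>e\<close>, and Hensel's lemma in the direction \<open>v\<close> restores the congruence.\<close>

lemma local_solution_off_hyperplane:
  fixes A :: "int^'n^'n" and p n :: int
  assumes p: "prime p" and U: "\<And>K. \<exists>v. p ^ K dvd qform A v - n"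
    and n: "\<not> p ^ T dvd n" and e: "\<not> p ^ K' dvd 2 * qform A e"
  defines "K \<equiv> T + 2 + K'"
  shows "\<exists>v. p ^ (2 * K) dvd qform A v - n \<and> \<not> p ^ K dvd qpolar A v e"
proof -
  obtain v1 where v1: "p ^ (2 * K) dvd qform A v1 - n" using U by blast
  show ?thesis
  proof (cases "p ^ K dvd qpolar A v1 e")
    case True
    \<comment> \<open>The shift \<open>p^j e\<close> changes \<open>B v e\<close> by
      \<open>2 p^j f e\<close>, which \<open>p^K\<close> does not divide because
      \<open>K = j + K'\<close>. It is also fine enough to keep the congruence modulo
      \<open>p^(2 \<tau> + 1)\<close> for all \<open>\<tau> <= T\<close>.\<close>
    define j where "j = T + 2"
    define v where "v = v1 + p ^ j *s e"
    define d where "d = qpolar A v v1"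
    have pw: "p ^ a dvd x" if "p ^ b dvd x" "a \<le> b" for a b x
      using that by (meson dvd_trans le_imp_power_dvd)
    have d: "d = 2 * (qform A v1 - n) + p ^ j * qpolar A v1 e + 2 * n"
      by (simp add: d_def v_def qpolar_bilinear qpolar_self qpolar_commute[of A e])
    \<comment> \<open>The derivative \<open>d\<close> in direction \<open>v1\<close> is close to
      \<open>2 n\<close>. The exponent is \<open>T + 1\<close> instead of \<open>T\<close> because
      at \<open>p = 2\<close> one factor may come from this 2.\<close>
    have nd: "\<not> p ^ Suc T dvd d"
    proof
      assume "p ^ Suc T dvd d"
      moreover have "p ^ Suc T dvd 2 * (qform A v1 - n)"
        by (intro dvd_mult pw[OF v1]) (simp add: K_def)
      moreover have "p ^ Suc T dvd p ^ j * qpolar A v1 e"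
        by (intro dvd_mult2 le_imp_power_dvd) (simp add: j_def)
      ultimately have "p ^ Suc T dvd d - 2 * (qform A v1 - n) - p ^ j * qpolar A v1 e"
        by (intro dvd_diff)
      then have "p ^ Suc T dvd 2 * n" unfolding d by simp
      then have "p ^ T dvd n"
      proof (cases "p = 2")
        case False
        then have "\<not> p dvd 2" using primes_dvd_imp_eq[OF p, of 2] by auto
        then have "coprime p 2" by (rule prime_imp_coprime[OF p])
        then have "coprime (p ^ Suc T) 2" by (subst coprime_power_left_iff) simp
        from coprime_dvd_mult_right_iff[OF this] have "p ^ Suc T dvd n" using \<open>p ^ Suc T dvd 2 * n\<close> by simp
        then show ?thesis by (rule pw) simp
      qed simp
      then show False using n by blast
    qed
    obtain \<tau> b where \<tau>: "d = p ^ \<tau> * b" "\<not> p dvd b" "\<tau> \<le> T" using prime_power_decompose[OF p nd] .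
    have "qform A v - n = (qform A v1 - n) + p ^ j * qpolar A v1 e + p ^ (2 * j) * qform A e"
    proof -
      have "p ^ (2 * j) = (p ^ j)\<^sup>2" by (metis power_mult mult.commute)
      then show ?thesis unfolding v_def qform_line by (simp only:) (simp add: algebra_simps)
    qed
    moreover have "p ^ (2 * \<tau> + 1) dvd qform A v1 - n" using \<tau>(3) by (intro pw[OF v1]) (simp add: K_def)
    moreover have "p ^ (2 * \<tau> + 1) dvd p ^ j * qpolar A v1 e"
    proof -
      have "p ^ j * p ^ K dvd p ^ j * qpolar A v1 e" using True by simp
      then have "p ^ (j + K) dvd p ^ j * qpolar A v1 e" by (simp only: power_add)
      then show ?thesis by (rule pw) (use \<tau>(3) in \<open>simp add: j_def K_def\<close>)
    qed
    moreover have "p ^ (2 * \<tau> + 1) dvd p ^ (2 * j) * qform A e"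
      using \<tau>(3) by (intro dvd_mult2 le_imp_power_dvd) (simp add: j_def)
    ultimately have "p ^ (2 * \<tau> + 1) dvd qform A v - n" by (simp only: dvd_add)
    from hensel_qform[OF p \<tau>(1)[unfolded d_def] \<tau>(2) this, of "2 * K"]
    obtain t where t: "p ^ (2 * K) dvd qform A (v + t *s v1) - n" by blast
    have "\<not> p ^ K dvd qpolar A (v + t *s v1) e"
    proof
      assume "p ^ K dvd qpolar A (v + t *s v1) e"
      moreover have "qpolar A (v + t *s v1) e = (1 + t) * qpolar A v1 e + p ^ j * (2 * qform A e)"
        by (simp add: v_def qpolar_bilinear qpolar_self algebra_simps)
      moreover have "p ^ K dvd (1 + t) * qpolar A v1 e" using True by simp
      ultimately have "p ^ K dvd p ^ j * (2 * qform A e)" by (simp only: dvd_add_right_iff)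
      moreover have "p ^ K = p ^ j * p ^ K'" by (simp add: K_def j_def power_add)
      moreover have "p ^ j \<noteq> 0" using p by auto
      ultimately have "p ^ K' dvd 2 * qform A e" by (simp only: dvd_mult_cancel_left) simp
      then show False using e by blast
    qed
    then show ?thesis using t by blast
  qed (use v1 in blast)
qed

section \<open>Three orthogonal directions\<close>

lemma nondegenerate_radical:
  fixes A :: "int^'n^'n" and w :: "int^'n"
  assumes "qform_nondegenerate A" and "\<And>g. qpolar A w g = 0"
  shows "w = 0"
proof -
  have g: "(gram A *v w) $ r = 0" for r
    using assms(2)[of "axis r 1"] unfolding qpolar_commute[of A w] by (simp add: qpolar_eq_gram sum_axis_mult)
  have "qpolar A g (vec_of_int w :: rat^'n) = 0" for g
  proof -
    have "(\<Sum>c\<in>UNIV. of_int (gram A $ r $ c) * (vec_of_int w :: rat^'n) $ c) = of_int ((gram A *v w) $ r)" for r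
      by (simp add: vec_of_int_def matrix_vector_mult_def)
    then show ?thesis using g by (simp add: qpolar_eq_sum)
  qed
  then have "\<forall>g. qform A (vec_of_int w + g) - qform A (vec_of_int w :: rat^'n) - qform A g = 0"
    by (simp add: qpolar_commute[of A "vec_of_int w"] flip: qpolar_eq_diff)
  then have "(vec_of_int w :: rat^'n) = 0" using assms(1) unfolding qform_nondegenerate_def by blast
  then show ?thesis by (simp add: vec_of_int_def vec_eq_iff)
qed

lemma two_generators_card:
  fixes e1 e2 :: "int^'n" and c :: int
  assumes c: "c \<noteq> 0" and gen: "\<And>v. \<exists>a b. c *s v = a *s e1 + b *s e2"
  shows "CARD('n) \<le> 2"
proof -
  let ?E = "{vec_of_int e1, vec_of_int e2} :: (rat^'n) set"
  have "axis i 1 \<in> vec.span ?E" for i :: 'n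
  proof -
    obtain a b where ab: "c *s axis i 1 = a *s e1 + b *s e2" using gen by blast
    have "(axis i 1 :: rat^'n) = (of_int a / of_int c) *s vec_of_int e1 + (of_int b / of_int c) *s vec_of_int e2"
    proof (subst vec_eq_iff, intro allI)
      fix r
      have "c * (axis i 1 :: int^'n) $ r = a * e1 $ r + b * e2 $ r"
        using arg_cong[OF ab, of "\<lambda>v. v $ r"] by simp
      then have "of_int (c * (axis i 1 :: int^'n) $ r) = (of_int (a * e1 $ r + b * e2 $ r) :: rat)" by (simp only:)
      moreover have "of_int ((axis i 1 :: int^'n) $ r) = (axis i 1 :: rat^'n) $ r" by (simp add: axis_def)
      ultimately show "(axis i 1 :: rat^'n) $ r = ((of_int a / of_int c) *s vec_of_int e1 + (of_int b / of_int c) *s vec_of_int e2) $ r"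
        using c by (simp add: vec_of_int_def field_simps)
    qed
    moreover have "(of_int a / of_int c) *s vec_of_int e1 + (of_int b / of_int c) *s vec_of_int e2 \<in> vec.span ?E"
      by (intro vec.span_add vec.span_scale vec.span_base) auto
    ultimately show ?thesis by simp
  qed
  then have "cart_basis \<subseteq> vec.span ?E" by (auto simp: cart_basis_def)
  then have "vec.span cart_basis \<subseteq> vec.span ?E" by (intro vec.span_minimal) auto
  then have "(UNIV :: (rat^'n) set) \<subseteq> vec.span ?E" by simp
  then have "vec.dim (UNIV :: (rat^'n) set) \<le> card ?E" by (intro vec.dim_le_card) auto
  also have "\<dots> \<le> 2" by (simp add: card_insert_if)
  finally show ?thesis by (simp add: vec_dim_card card_cart_basis)
qed

text \<open>Gram-Schmidt without denominators: \<open>pr e v\<close> is \<open>2 f e\<close> times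
  the orthogonal projection of \<open>v\<close> away from \<open>e\<close>. If the form vanished on
  the orthogonal complement of the vectors found so far, that complement would be orthogonal to
  everything, hence zero, and at most two vectors would span the space. The first application of
  \<open>key\<close> takes \<open>e1\<close> for both vectors.\<close>

lemma orthogonal_extension:
  fixes A :: "int^'n^'n"
  assumes nd: "qform_nondegenerate A" and card: "CARD('n) \<ge> 3" and e1: "qform A (e1 :: int^'n) \<noteq> 0"
  obtains e2 e3 :: "int^'n" where "qform A e2 \<noteq> 0" "qform A e3 \<noteq> 0" "qpolar A e1 e2 = 0"
    "qpolar A e1 e3 = 0" "qpolar A e2 e3 = 0"
proof -
  define pr where "pr e v = (2 * qform A e) *s v + (- qpolar A e v) *s e" for e v :: "int^'n"
  have pr: "qpolar A e (pr e v) = 0" for e v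
    by (simp add: pr_def qpolar_bilinear qpolar_self)
  have pr': "qpolar A g (pr e v) = 0" if "qpolar A g e = 0" "qpolar A g v = 0" for g e v
    using that by (simp add: pr_def qpolar_bilinear)
  have key: "\<exists>w. w \<in> S \<and> qform A w \<noteq> 0"
    if S: "\<And>x y. x \<in> S \<Longrightarrow> y \<in> S \<Longrightarrow> x + y \<in> S" and F: "\<And>v. F v \<in> S" "c \<noteq> 0"
      "\<And>v. \<exists>a b. c *s v = F v + a *s g1 + b *s g2"
      "\<And>w. w \<in> S \<Longrightarrow> qpolar A w g1 = 0" "\<And>w. w \<in> S \<Longrightarrow> qpolar A w g2 = 0" for S :: "(int^'n) set" and F c g1 g2
  proof (rule ccontr)
    assume "\<nexists>w. w \<in> S \<and> qform A w \<noteq> 0"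
    then have z: "qform A w = 0" if "w \<in> S" for w using that by blast
    have zp: "qpolar A x y = 0" if "x \<in> S" "y \<in> S" for x y
      using z[OF S[OF that]] z[OF that(1)] z[OF that(2)] by (simp add: qform_add)
    have "w = 0" if w: "w \<in> S" for w
    proof (rule nondegenerate_radical[OF nd])
      fix v
      obtain a b where "c *s v = F v + a *s g1 + b *s g2" using F(3) by blast
      then have "c * qpolar A w v = qpolar A w (F v + a *s g1 + b *s g2)"
        by (simp flip: qpolar_scale_right)
      also have "\<dots> = 0" using zp[OF w F(1)] F(4,5)[OF w] by (simp add: qpolar_bilinear)
      finally show "qpolar A w v = 0" using F(2) by simp
    qed
    then have "\<exists>a b. c *s v = a *s g1 + b *s g2" for v using F(1,3)[of v] by (metis add_0)
    then have "CARD('n) \<le> 2" using two_generators_card[OF F(2), of g1 g2] by blast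
    then show False using card by simp
  qed
  have "\<exists>w. w \<in> {w. qpolar A e1 w = 0} \<and> qform A w \<noteq> 0"
  proof (rule key[where F = "pr e1" and c = "2 * qform A e1" and ?g1.0 = e1 and ?g2.0 = e1])
    fix v
    have "(2 * qform A e1) *s v = pr e1 v + qpolar A e1 v *s e1 + 0 *s e1" by (simp add: pr_def vec_eq_iff)
    then show "\<exists>a b. (2 * qform A e1) *s v = pr e1 v + a *s e1 + b *s e1" by blast
  qed (use e1 pr in \<open>auto simp: qpolar_bilinear qpolar_commute[of A _ e1]\<close>)
  then obtain e2 where e2: "qpolar A e1 e2 = 0" "qform A e2 \<noteq> 0" by blast
  have "\<exists>w. w \<in> {w. qpolar A e1 w = 0 \<and> qpolar A e2 w = 0} \<and> qform A w \<noteq> 0"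
  proof (rule key[where F = "\<lambda>v. pr e2 (pr e1 v)" and c = "4 * qform A e1 * qform A e2" and ?g1.0 = e1 and ?g2.0 = e2])
    fix v
    have "(4 * qform A e1 * qform A e2) *s v =
        pr e2 (pr e1 v) + (2 * qform A e2 * qpolar A e1 v) *s e1 + qpolar A e2 (pr e1 v) *s e2"
      unfolding pr_def[of e2] by (simp add: pr_def[of e1 v] vec_eq_iff algebra_simps)
    then show "\<exists>a b. (4 * qform A e1 * qform A e2) *s v = pr e2 (pr e1 v) + a *s e1 + b *s e2" by blast
    show "pr e2 (pr e1 v) \<in> {w. qpolar A e1 w = 0 \<and> qpolar A e2 w = 0}"
      using pr pr'[OF e2(1) pr] by simp
  next
    fix w assume "w \<in> {w. qpolar A e1 w = 0 \<and> qpolar A e2 w = 0}"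
    then show "qpolar A w e1 = 0" "qpolar A w e2 = 0"
      by (simp_all add: qpolar_commute[of A w])
  qed (use e1 e2 in \<open>auto simp: qpolar_bilinear\<close>)
  then obtain e3 where e3: "qpolar A e1 e3 = 0" "qpolar A e2 e3 = 0" "qform A e3 \<noteq> 0" by blast
  show thesis by (rule that[OF e2(2) e3(3) e2(1) e3(1,2)])
qed

lemma qform_three_directions:
  fixes A :: "int^'n^'n"
  assumes "qpolar A e1 e2 = 0" "qpolar A e1 e3 = 0" "qpolar A e2 e3 = 0"
  shows "qform A (v + x *s e1 + y *s e2 + z *s e3) = qform A v + (qpolar A v e1 * x + qform A e1 * x\<^sup>2) +
    (qpolar A v e2 * y + qform A e2 * y\<^sup>2) + (qpolar A v e3 * z + qform A e3 * z\<^sup>2)"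
  using assms by (simp add: qform_line qpolar_bilinear)

text \<open>Here \<open>h = gcd (B v\<^sub>0 e\<^sub>1) R\<^sup>K\<close> and \<open>q = R\<^sup>K/h\<close> with \<open>R = \<Prod>P\<close>, so that \<open>M = h\<^sup>2 q\<^sup>2\<close>, and the values of the form at
  \<open>v\<^sub>0 + h q\<^sup>2 k e\<^sub>1 + 2 M l e\<^sub>2 + 2 M m e\<^sub>3\<close> run through \<open>f v\<^sub>0 + M\<close> times the values of a polynomial
  whose linear coefficient in \<open>k\<close> is prime to \<open>P\<close>.\<close>

lemma good_class_sparse:
  fixes A :: "int^'n^'n" and P :: "int set" and W K :: nat and e1 e2 e3 v0 :: "int^'n" and c :: int
  assumes orth: "qpolar A e1 e2 = 0" "qpolar A e1 e3 = 0" "qpolar A e2 e3 = 0"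
    and D: "qform A e1 > 0" "qform A e2 \<noteq> 0" "qform A e3 \<noteq> 0"
    and P: "finite P" "\<And>p. p \<in> P \<Longrightarrow> prime p"
    and PW: "\<And>p::int. prime p \<Longrightarrow> p \<le> int W \<Longrightarrow> p \<in> P"
    and PD: "\<And>p::int. prime p \<Longrightarrow> p dvd 2 * qform A e1 * qform A e2 * qform A e3 \<Longrightarrow> p \<in> P"
    and W: "W > 0"
    and v0: "\<And>p. p \<in> P \<Longrightarrow> \<not> p ^ K dvd qpolar A v0 e1"
  defines "M \<equiv> (\<Prod>P) ^ (2 * K)"
  assumes c: "M dvd qform A v0 - c" and \<epsilon>: "\<epsilon> > 0"
  shows "\<forall>\<^sub>F X in sequentially.
    real (card {n\<in>{1..int X}. M dvd n - c \<and> n \<notin> range (qform A :: int^'n \<Rightarrow> int)}) \<le> (96 / real W + \<epsilon>) * real X / of_int M"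
proof -
  define R where "R = \<Prod>P"
  define b1 where "b1 = qpolar A v0 e1"
  define h where "h = gcd b1 (R ^ K)"
  have P0: "p > 0" if "p \<in> P" for p using P(2)[OF that] by (simp add: prime_gt_0_int)
  have R0: "R > 0" unfolding R_def using P0 by (intro prod_pos) auto
  have h0: "h > 0" using R0 by (simp add: h_def)
  have hb: "h dvd b1" "h dvd R ^ K" by (simp_all add: h_def)
  obtain b where b: "b1 = h * b" using hb(1) by (rule dvdE)
  obtain q where q: "R ^ K = h * q" using hb(2) by (rule dvdE)
  have q0: "q > 0" using q R0 h0 by (metis zero_less_mult_pos zero_less_power)
  have M: "M = h\<^sup>2 * q\<^sup>2"
    unfolding M_def R_def[symmetric] by (metis power_even_eq q power_mult_distrib)
  have M0: "M > 0" using h0 q0 by (simp add: M)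
  \<comment> \<open>\<open>p^K\<close> divides \<open>R^K\<close> but not \<open>B v0 e1\<close>, so
    the gcd \<open>h\<close> does not absorb the whole power of \<open>p\<close>.\<close>
  have pq: "p dvd q" if p: "p \<in> P" for p
  proof (rule ccontr)
    assume "\<not> p dvd q"
    then have "coprime p q" using P(2)[OF p] by (intro prime_imp_coprime)
    then have cq: "coprime (p ^ K) q" by (cases "K = 0") auto
    have "p dvd R" unfolding R_def using P(1) p by (rule dvd_prodI)
    then have "p ^ K dvd h * q" unfolding q[symmetric] by (rule dvd_power_same)
    then have "p ^ K dvd h" using cq by (simp add: coprime_dvd_mult_left_iff)
    then have "p ^ K dvd b1" using hb(1) by (rule dvd_trans)
    then show False using v0[OF p] by (simp add: b1_def)
  qed
  \<comment> \<open>Otherwise \<open>h p\<close> would divide both arguments of the gcd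
    \<open>h\<close>, since \<open>p\<close> divides \<open>q\<close> as well.\<close>
  have pb: "\<not> p dvd b" if p: "p \<in> P" for p
  proof
    assume "p dvd b"
    then have "h * p dvd b1" by (simp add: b)
    moreover have "h * p dvd R ^ K" using pq[OF p] by (simp add: q)
    ultimately have "h * p dvd h * 1" unfolding h_def by simp
    then have "p dvd 1" using h0 by (simp only: dvd_mult_cancel_left)  simp
    then show False using P(2)[OF p] by (meson not_prime_unit)
  qed
  have inP: "p \<in> P" if pr: "prime p" "p dvd R" for p
  proof -
    obtain p' where p': "p' \<in> P" "p dvd p'"
      using pr(2) unfolding R_def prime_dvd_prod_iff[OF P(1) pr(1)] by blast
    then have "p = p'" using pr P(2) primes_dvd_imp_eq by blast
    then show ?thesis using p' by simp
  qed
  have RM: "p dvd R" if "prime p" "p dvd M" for p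
    using that unfolding M_def R_def[symmetric] by (rule prime_dvd_power)
  have P2: "2 \<in> P" by (rule PD) auto
  \<comment> \<open>These are the coefficients after division by \<open>M = h^2 q^2\<close>. The
    extra \<open>q\<close> in the step along \<open>e1\<close> makes \<open>a\<close> divisible by
    all of \<open>P\<close> while leaving \<open>b\<close> as linear coefficient; the steps
    \<open>2 M\<close> make the coefficients for \<open>e2\<close> and \<open>e3\<close>
    even.\<close>
  define a where "a = q\<^sup>2 * qform A e1"
  define a2 where "a2 = 4 * M * qform A e2"
  define a3 where "a3 = 4 * M * qform A e3"
  define b2 where "b2 = 2 * qpolar A v0 e2"
  define b3 where "b3 = 2 * qpolar A v0 e3"
  have pa: "p dvd a" if "p \<in> P" for p using pq[OF that] by (simp add: a_def power2_eq_square)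
  have val: "qform A v0 + M * ternary_poly a b a2 b2 a3 b3 x \<in> range (qform A)" for x
  proof -
    obtain k l m where x: "x = (k, l, m)" by (cases x)
    have "qform A (v0 + (h * q\<^sup>2 * k) *s e1 + (2 * M * l) *s e2 + (2 * M * m) *s e3) =
      qform A v0 + (b1 * (h * q\<^sup>2 * k) + qform A e1 * (h * q\<^sup>2 * k)\<^sup>2) +
      (qpolar A v0 e2 * (2 * M * l) + qform A e2 * (2 * M * l)\<^sup>2) + (qpolar A v0 e3 * (2 * M * m) + qform A e3 * (2 * M * m)\<^sup>2)"
      unfolding b1_def by (rule qform_three_directions[OF orth])
    also have "b1 * (h * q\<^sup>2 * k) + qform A e1 * (h * q\<^sup>2 * k)\<^sup>2 = M * (a * k\<^sup>2 + b * k)"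
      by (simp add: b M a_def algebra_simps power2_eq_square)
    also have "qpolar A v0 e2 * (2 * M * l) + qform A e2 * (2 * M * l)\<^sup>2 = M * (a2 * l\<^sup>2 + b2 * l)"
      by (simp add: a2_def b2_def algebra_simps power2_eq_square)
    also have "qpolar A v0 e3 * (2 * M * m) + qform A e3 * (2 * M * m)\<^sup>2 = M * (a3 * m\<^sup>2 + b3 * m)"
      by (simp add: a3_def b3_def algebra_simps power2_eq_square)
    finally have "qform A v0 + M * ternary_poly a b a2 b2 a3 b3 x = qform A (v0 + (h * q\<^sup>2 * k) *s e1 + (2 * M * l) *s e2 + (2 * M * m) *s e3)"
      by (simp add: x ternary_poly_def algebra_simps)
    then show ?thesis by (simp only: rangeI)
  qed
  have sparse: "\<forall>\<^sub>F X in sequentially.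
    real (card {N\<in>{1..int X}. N \<notin> range (ternary_poly a b a2 b2 a3 b3)}) \<le> (96 / real W + \<epsilon> / 2) * real X"
  proof (rule ternary_nonvalues_sparse)
    show "a > 0" using D q0 by (simp add: a_def)
    then have a0: "a \<noteq> 0" by simp
    show "even a" by (rule pa[OF P2])
    show "odd b" by (rule pb[OF P2])
    show "coprime a b"
    proof (rule coprime_intI[OF a0])
      fix p :: int assume p: "prime p" "p dvd a" "p dvd b"
      have "p \<in> P"
      proof (cases "p dvd q")
        case True
        then have "p dvd R ^ K" by (simp add: q)
        then show ?thesis using p(1) inP prime_dvd_power by blast
      next
        case False
        then have "\<not> p dvd q\<^sup>2" using p(1) prime_dvd_power by blast
        then have "p dvd qform A e1" using p by (simp add: a_def prime_dvd_mult_iff)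
        then show ?thesis using p(1) by (intro PD) auto
      qed
      then show False using pb p(3) by blast
    qed
    show "a2 \<noteq> 0" "a3 \<noteq> 0" using M0 D by (auto simp: a2_def a3_def)
    fix p :: int assume p: "prime p" "p dvd a2 * a3"
    have "p dvd 2 \<or> p dvd M \<or> p dvd qform A e2 \<or> p dvd qform A e3"
    proof -
      have "a2 * a3 = 2 * (2 * (2 * (2 * (M * (M * (qform A e2 * qform A e3))))))" by (simp add: a2_def a3_def)
      then show ?thesis using p by (auto simp only: prime_dvd_mult_iff)
    qed
    then have "p \<in> P"
    proof (elim disjE)
      assume "p dvd M" then show ?thesis using p(1) RM inP by blast
    qed (use p(1) in \<open>auto intro!: PD\<close>)
    then show "p dvd a" by (rule pa)
  next
    fix p :: int assume "prime p" "p \<le> int W"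
    then show "p dvd a" by (intro pa PW)
  qed (use W \<epsilon> in \<open>auto simp: a2_def a3_def b2_def b3_def\<close>)
  \<comment> \<open>For \<open>n >= 1\<close> the index \<open>N = (n - f v0) / M\<close> exceeds
    \<open>- C\<close>, so at most \<open>C\<close> indices are not positive. The same
    \<open>C\<close> covers the overshoot at the upper end.\<close>
  define C where "C = nat \<bar>qform A v0\<bar> + 1"
  define \<kappa> where "\<kappa> = 96 / real W + \<epsilon> / 2"
  have \<kappa>0: "\<kappa> \<ge> 0" using \<epsilon> by (simp add: \<kappa>_def)
  obtain X0 where X0: "\<And>X. X \<ge> X0 \<Longrightarrow> real (card {N\<in>{1..int X}. N \<notin> range (ternary_poly a b a2 b2 a3 b3)}) \<le> \<kappa> * real X"
    using sparse unfolding \<kappa>_def eventually_sequentially by blast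
  have bound: "real (card {n\<in>{1..int X}. M dvd n - c \<and> n \<notin> range (qform A :: int^'n \<Rightarrow> int)}) \<le>
      \<kappa> * (real X / of_int M + real C) + real C" if X: "X div nat M + C \<ge> X0" for X
  proof -
    let ?S = "{n\<in>{1..int X}. M dvd n - c \<and> n \<notin> range (qform A :: int^'n \<Rightarrow> int)}"
    let ?T = "{N\<in>{1..int (X div nat M + C)}. N \<notin> range (ternary_poly a b a2 b2 a3 b3)}"
    let ?g = "\<lambda>n. (n - qform A v0) div M"
    have n: "n = qform A v0 + M * ?g n" if "n \<in> ?S" for n
    proof -
      have "M dvd n - c" using that by simp
      then have "M dvd (n - c) - (qform A v0 - c)" using c by (rule dvd_diff)
      then have "M dvd n - qform A v0" by simp
      then show ?thesis by simp
    qed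
    have inj: "inj_on ?g ?S"
    proof (rule inj_onI)
      fix x y assume xy: "x \<in> ?S" "y \<in> ?S" "?g x = ?g y"
      have "x = qform A v0 + M * ?g y" using n[OF xy(1)] unfolding xy(3) .
      also have "\<dots> = y" by (rule n[OF xy(2), symmetric])
      finally show "x = y" .
    qed
    have "?g ` ?S \<subseteq> ?T \<union> {- int C<..0}"
    proof
      fix N assume "N \<in> ?g ` ?S"
      then obtain n where nS: "n \<in> ?S" and N: "N = ?g n" by blast
      have eq: "n = qform A v0 + M * N" unfolding N by (rule n[OF nS])
      have "N \<notin> range (ternary_poly a b a2 b2 a3 b3)" using val nS eq by auto
      moreover have "N > - int C"
      proof (rule ccontr)
        assume "\<not> N > - int C"
        then have "M * N \<le> M * (- int C)" using M0 by (intro mult_left_mono) auto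
        also have "\<dots> \<le> 1 * (- int C)" using M0 by (intro mult_right_mono_neg) auto
        finally have "n \<le> qform A v0 - int C" using eq by simp
        then show False using nS by (auto simp: C_def)
      qed
      moreover have "N \<le> int (X div nat M + C)"
      proof -
        have "M * N \<le> int X + int C" using eq nS by (auto simp: C_def)
        then have "M * N div M \<le> (int X + int C) div M" using M0 by (rule zdiv_mono1)
        then have "N \<le> (int X + int C) div M" using M0 by simp
        also have "\<dots> \<le> (int X + M * int C) div M" using M0 by (intro zdiv_mono1 add_mono) (auto simp: mult_le_cancel_right1)
        also have "\<dots> = int X div M + int C" using M0 by simp
        also have "int X div M = int (X div nat M)" using M0 by (simp add: zdiv_int)
        finally show ?thesis by simp
      qed
      ultimately show "N \<in> ?T \<union> {- int C<..0}" by auto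
    qed
    moreover have "finite (?T \<union> {- int C<..0})"
      by (intro finite_UnI finite_subset[of ?T "{1..int (X div nat M + C)}"]) auto
    ultimately have "card (?g ` ?S) \<le> card (?T \<union> {- int C<..0})" by (rule card_mono[rotated])
    also have "\<dots> \<le> card ?T + card {- int C<..0}" by (rule card_Un_le)
    also have "card {- int C<..0} = C" by simp
    finally have "card ?S \<le> card ?T + C" unfolding card_image[OF inj] .
    then have "real (card ?S) \<le> real (card ?T + C)" by (rule of_nat_mono)
    also have "\<dots> = real (card ?T) + real C" by (rule of_nat_add)
    also have "real (card ?T) \<le> \<kappa> * real (X div nat M + C)" by (rule X0[OF X])
    also have "\<dots> \<le> \<kappa> * (real X / of_int M + real C)"
    proof (rule mult_left_mono[OF _ \<kappa>0])
      have "real (X div nat M) \<le> real X / real (nat M)" by (rule of_nat_div_le_of_nat)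
      then show "real (X div nat M + C) \<le> real X / of_int M + real C" using M0 by simp
    qed
    finally show ?thesis by simp
  qed
  \<comment> \<open>From here on the additive constant is at most \<open>\<epsilon> / 2\<close>
    times \<open>X / M\<close>.\<close>
  define E where "E = (\<kappa> * real C + real C) * of_int M / (\<epsilon> / 2)"
  have "\<forall>\<^sub>F X in sequentially. X \<ge> nat M * X0" by (rule eventually_ge_at_top)
  moreover have "\<forall>\<^sub>F X in sequentially. real X \<ge> E"
    using filterlim_real_sequentially unfolding filterlim_at_top by blast
  ultimately show ?thesis
  proof eventually_elim
    case (elim X)
    have "X div nat M \<ge> X0" using elim(1) M0 by (simp add: less_eq_div_iff_mult_less_eq mult.commute)
    then have "X div nat M + C \<ge> X0" by simp
    from bound[OF this]
    have "real (card {n\<in>{1..int X}. M dvd n - c \<and> n \<notin> range (qform A :: int^'n \<Rightarrow> int)}) \<le>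
      \<kappa> * real X / of_int M + (\<kappa> * real C + real C)" by (simp add: algebra_simps)
    also have "\<kappa> * real C + real C \<le> \<epsilon> / 2 * real X / of_int M"
      using elim(2) M0 \<epsilon> by (simp add: E_def field_simps)
    also have "\<kappa> * real X / of_int M + \<epsilon> / 2 * real X / of_int M = (\<kappa> + \<epsilon> / 2) * real X / of_int M"
      by (simp add: distrib_right add_divide_distrib)
    also have "\<kappa> + \<epsilon> / 2 = 96 / real W + \<epsilon>" by (simp add: \<kappa>_def)
    finally show ?case by simp
  qed
qed

section \<open>Summation over residue classes\<close>

lemma card_multiples_le:
  fixes m :: int
  assumes "m > 0"
  shows "real (card {n\<in>{1..int X}. m dvd n}) \<le> real X / of_int m"
proof -
  have "{n\<in>{1..int X}. m dvd n} \<subseteq> (\<lambda>k. m * k) ` {1..int X div m}"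
  proof
    fix n assume n: "n \<in> {n\<in>{1..int X}. m dvd n}"
    then obtain k where k: "n = m * k" by (auto elim: dvdE)
    have "0 < m * k" using n k by auto
    then have "k \<ge> 1" using assms by (simp add: zero_less_mult_iff)
    moreover have "k = n div m" using k assms by simp
    then have "k \<le> int X div m" using n assms by (auto intro: zdiv_mono1)
    ultimately show "n \<in> (\<lambda>k. m * k) ` {1..int X div m}" using k by auto
  qed
  then have "card {n\<in>{1..int X}. m dvd n} \<le> card ((\<lambda>k. m * k) ` {1..int X div m})"
    by (intro card_mono) auto
  also have "\<dots> \<le> nat (int X div m)" using card_image_le[of "{1..int X div m}" "\<lambda>k. m * k"] by simp
  finally have "real (card {n\<in>{1..int X}. m dvd n}) \<le> real (nat (int X div m))" by simp
  also have "\<dots> = of_int (int X div m)" using assms by (simp add: pos_imp_zdiv_nonneg_iff)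
  also have "\<dots> \<le> real X / of_int m" using real_of_int_div4[of "int X" m] by simp
  finally show ?thesis .
qed

text \<open>The order of choices matters: \<open>W\<close> makes \<open>96 / W\<close> small,
  \<open>P\<close> depends on \<open>W\<close> and the three directions, and \<open>T\<close> makes
  the proportion \<open>card P / 2^T\<close> of integers divisible by some \<open>p^T\<close>
  negligible. Every other \<open>n\<close> is in a class modulo \<open>M\<close> that contains a
  value at a vector off the hyperplane orthogonal to \<open>e1\<close>, and there are at most
  \<open>M\<close> such classes, each missing a proportion at most \<open>\<epsilon> / 2\<close> of
  its integers.\<close>

theorem nonrepresented_sparse:
  fixes A :: "int^'n^'n"
  assumes nd: "qform_nondegenerate A" and card: "CARD('n) \<ge> 3"
    and U: "\<And>m a :: int. m > 0 \<Longrightarrow> \<exists>v. m dvd qform A v - a"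
    and e1: "qform A (e1 :: int^'n) > 0" and \<epsilon>: "\<epsilon> > 0"
  shows "\<forall>\<^sub>F X in sequentially. real (card {n\<in>{1..int X}. n \<notin> range (qform A :: int^'n \<Rightarrow> int)}) \<le> \<epsilon> * real X"
proof -
  have "qform A e1 \<noteq> 0" using e1 by simp
  from orthogonal_extension[OF nd card this] obtain e2 e3 :: "int^'n"
    where e: "qform A e2 \<noteq> 0" "qform A e3 \<noteq> 0" "qpolar A e1 e2 = 0" "qpolar A e1 e3 = 0" "qpolar A e2 e3 = 0" .
  obtain W0 :: nat where "96 / (\<epsilon> / 4) < real W0" using reals_Archimedean2 by blast
  then have W: "96 / real (Suc W0) \<le> \<epsilon> / 4" using \<epsilon> by (simp add: field_simps)
  define W where "W = Suc W0"
  define Dp where "Dp = 2 * qform A e1 * qform A e2 * qform A e3"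
  have Dp0: "Dp \<noteq> 0" using e e1 by (simp add: Dp_def)
  define P where "P = {p::int. prime p \<and> (p \<le> int W \<or> p dvd Dp)}"
  have finP: "finite P"
  proof (rule finite_subset)
    show "P \<subseteq> {0..int W} \<union> {p. p dvd Dp}" by (auto simp: P_def intro: prime_ge_0_int)
    show "finite ({0..int W} \<union> {p. p dvd Dp})" using finite_divisors_int[OF Dp0] by simp
  qed
  have primeP: "prime p" if "p \<in> P" for p using that by (simp add: P_def)
  have P2: "p \<ge> 2" if "p \<in> P" for p using primeP[OF that] by (rule prime_ge_2_int)
  obtain T where T: "real (card P) / (\<epsilon> / 4) < 2 ^ T" using real_arch_pow[of 2] by fastforce
  \<comment> \<open>\<open>p^K' >= 2^K' > K' = 2 f e1\<close>, so \<open>p^K'\<close> cannot divide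
    \<open>2 f e1\<close>.\<close>
  define K' where "K' = nat (2 * qform A e1)"
  define K where "K = T + 2 + K'"
  define M where "M = (\<Prod>P) ^ (2 * K)"
  have M0: "M > 0" unfolding M_def using P2 by (intro zero_less_power prod_pos) force
  define good where "good c \<longleftrightarrow> (\<exists>v0. M dvd qform A v0 - c \<and> (\<forall>p\<in>P. \<not> p ^ K dvd qpolar A v0 e1))" for c
  have good: "good n" if n: "\<And>p. p \<in> P \<Longrightarrow> \<not> p ^ T dvd n" for n
  proof -
    have "\<exists>v. p ^ (2 * K) dvd qform A v - n \<and> \<not> p ^ K dvd qpolar A v e1" if p: "p \<in> P" for p
      unfolding K_def
    proof (rule local_solution_off_hyperplane[OF primeP[OF p]])
      show "\<exists>v. p ^ K dvd qform A v - n" for K using P2[OF p] by (intro U) simp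
      show "\<not> p ^ T dvd n" by (rule n[OF p])
      show "\<not> p ^ K' dvd 2 * qform A e1"
      proof
        assume "p ^ K' dvd 2 * qform A e1"
        then have "p ^ K' \<le> 2 * qform A e1" using e1 by (intro zdvd_imp_le) auto
        moreover have "(2::int) ^ K' \<le> p ^ K'" using P2[OF p] by (intro power_mono) auto
        moreover have "int K' < 2 ^ K'" using less_exp[of K'] by (metis of_nat_less_iff of_nat_numeral of_nat_power)
        ultimately show False using e1 by (simp add: K'_def)
      qed
    qed
    then obtain u where u: "\<And>p. p \<in> P \<Longrightarrow> p ^ (2 * K) dvd qform A (u p) - n" "\<And>p. p \<in> P \<Longrightarrow> \<not> p ^ K dvd qpolar A (u p) e1"
      by metis
    have cop: "coprime (p ^ (2 * K)) (q ^ (2 * K))" if "p \<in> P" "q \<in> P" "p \<noteq> q" for p q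
    proof -
      have "coprime p q" using that primeP by (intro primes_coprime) auto
      then show ?thesis by simp
    qed
    obtain v where v: "\<forall>p\<in>P. vec_dvd (p ^ (2 * K)) (v - u p)"
      using chinese_remainder_vec[OF finP, of "\<lambda>p. p ^ (2 * K)" u] cop by blast
    have "\<forall>p\<in>P. [qform A v = n] (mod p ^ (2 * K))"
    proof
      fix p assume p: "p \<in> P"
      have "p ^ (2 * K) dvd (qform A v - qform A (u p)) + (qform A (u p) - n)"
        using qform_cong[OF bspec[OF v p], of A] u(1)[OF p] by (rule dvd_add)
      then show "[qform A v = n] (mod p ^ (2 * K))" by (simp add: cong_iff_dvd_diff)
    qed
    then have "[qform A v = n] (mod (\<Prod>p\<in>P. p ^ (2 * K)))" using cop by (intro cong_cong_prod_coprime) auto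
    moreover have "(\<Prod>p\<in>P. p ^ (2 * K)) = M" by (simp add: M_def prod_power_distrib)
    ultimately have "M dvd qform A v - n" by (simp add: cong_iff_dvd_diff)
    moreover have "\<not> p ^ K dvd qpolar A v e1" if p: "p \<in> P" for p
    proof
      assume "p ^ K dvd qpolar A v e1"
      moreover have "p ^ K dvd qpolar A v e1 - qpolar A (u p) e1"
      proof (rule dvd_trans)
        show "p ^ K dvd p ^ (2 * K)" by (intro le_imp_power_dvd) simp
        show "p ^ (2 * K) dvd qpolar A v e1 - qpolar A (u p) e1" by (rule qpolar_cong[OF bspec[OF v p]])
      qed
      ultimately have "p ^ K dvd qpolar A v e1 - (qpolar A v e1 - qpolar A (u p) e1)" by (rule dvd_diff)
      then show False using u(2)[OF p] by simp
    qed
    ultimately show ?thesis unfolding good_def by blast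
  qed
  let ?N = "\<lambda>X c. {n\<in>{1..int X}. M dvd n - c \<and> n \<notin> range (qform A :: int^'n \<Rightarrow> int)}"
  have ev: "\<forall>\<^sub>F X in sequentially. real (card (?N X c)) \<le> \<epsilon> / 2 * real X / of_int M" if c: "good c" for c
  proof -
    obtain v0 where v0: "M dvd qform A v0 - c" "\<And>p. p \<in> P \<Longrightarrow> \<not> p ^ K dvd qpolar A v0 e1"
      using c unfolding good_def by blast
    have "\<forall>\<^sub>F X in sequentially. real (card (?N X c)) \<le> (96 / real W + \<epsilon> / 4) * real X / of_int M"
      unfolding M_def
    proof (rule good_class_sparse[OF e(3,4,5) e1 e(1,2) finP primeP])
      show "(\<Prod>P) ^ (2 * K) dvd qform A v0 - c" using v0(1) by (simp only: M_def)
    qed (use v0(2) \<epsilon> in \<open>auto simp: P_def Dp_def W_def\<close>)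
    then show ?thesis
    proof eventually_elim
      case (elim X)
      have "(96 / real W + \<epsilon> / 4) * real X / of_int M \<le> \<epsilon> / 2 * real X / of_int M"
        using W M0 by (intro divide_right_mono mult_right_mono) (auto simp: W_def)
      then show ?case using elim by linarith
    qed
  qed
  have "\<forall>\<^sub>F X in sequentially. \<forall>c\<in>{c\<in>{0..<M}. good c}. real (card (?N X c)) \<le> \<epsilon> / 2 * real X / of_int M"
    using ev by (intro eventually_ball_finite) (auto intro: finite_subset[of _ "{0..<M}"])
  then show ?thesis
  proof eventually_elim
    case (elim X)
    let ?B = "\<lambda>p. {n\<in>{1..int X}. p ^ T dvd n}"
    let ?G = "{c\<in>{0..<M}. good c}"
    have sub: "{n\<in>{1..int X}. n \<notin> range (qform A :: int^'n \<Rightarrow> int)} \<subseteq> (\<Union>p\<in>P. ?B p) \<union> (\<Union>c\<in>?G. ?N X c)"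
    proof
      fix n assume n: "n \<in> {n\<in>{1..int X}. n \<notin> range (qform A :: int^'n \<Rightarrow> int)}"
      show "n \<in> (\<Union>p\<in>P. ?B p) \<union> (\<Union>c\<in>?G. ?N X c)"
      proof (cases "\<exists>p\<in>P. p ^ T dvd n")
        case True
        then show ?thesis using n by auto
      next
        case False
        then have "good n" using good by blast
        then obtain v0 where v0: "M dvd qform A v0 - n" "\<forall>p\<in>P. \<not> p ^ K dvd qpolar A v0 e1"
          unfolding good_def by blast
        have d: "M dvd n - n mod M" by (simp add: minus_mod_eq_mult_div)
        have "M dvd (qform A v0 - n) + (n - n mod M)" using v0(1) d by (rule dvd_add)
        then have "good (n mod M)" unfolding good_def using v0(2) by auto
        then have "n mod M \<in> ?G" using M0 by simp
        moreover have "n \<in> ?N X (n mod M)" using n d by simp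
        ultimately show ?thesis by blast
      qed
    qed
    have "card {n\<in>{1..int X}. n \<notin> range (qform A :: int^'n \<Rightarrow> int)} \<le> card ((\<Union>p\<in>P. ?B p) \<union> (\<Union>c\<in>?G. ?N X c))"
      by (rule card_mono[OF finite_subset[of _ "{1..int X}"] sub]) auto
    also have "\<dots> \<le> card (\<Union>p\<in>P. ?B p) + card (\<Union>c\<in>?G. ?N X c)" by (rule card_Un_le)
    also have "\<dots> \<le> (\<Sum>p\<in>P. card (?B p)) + (\<Sum>c\<in>?G. card (?N X c))"
    proof (rule add_mono)
      have "finite ?G" by (rule finite_subset[of _ "{0..<M}"]) auto
      then show "card (\<Union>c\<in>?G. ?N X c) \<le> (\<Sum>c\<in>?G. card (?N X c))" by (rule card_UN_le)
    qed (rule card_UN_le[OF finP])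
    finally have "real (card {n\<in>{1..int X}. n \<notin> range (qform A :: int^'n \<Rightarrow> int)}) \<le>
        (\<Sum>p\<in>P. real (card (?B p))) + (\<Sum>c\<in>?G. real (card (?N X c)))"
      by (simp only: of_nat_le_iff flip: of_nat_sum of_nat_add)
    also have "(\<Sum>p\<in>P. real (card (?B p))) \<le> (\<Sum>p\<in>P. real X / 2 ^ T)"
    proof (rule sum_mono)
      fix p assume p: "p \<in> P"
      have "(2::real) ^ T \<le> of_int p ^ T" using P2[OF p] by (intro power_mono) auto
      then have "real X / of_int (p ^ T) \<le> real X / 2 ^ T"
        using P2[OF p] by (intro divide_left_mono mult_pos_pos) auto
      moreover have "p ^ T > 0" using P2[OF p] by simp
      ultimately show "real (card (?B p)) \<le> real X / 2 ^ T" using card_multiples_le[of "p ^ T" X] by linarith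
    qed
    also have "(\<Sum>p\<in>P. real X / 2 ^ T) = real (card P) / 2 ^ T * real X" by simp
    also have "\<dots> \<le> \<epsilon> / 4 * real X"
      using T \<epsilon> by (intro mult_right_mono) (auto simp: field_simps)
    also have "(\<Sum>c\<in>?G. real (card (?N X c))) \<le> (\<Sum>c\<in>?G. \<epsilon> / 2 * real X / of_int M)"
      using elim by (intro sum_mono) blast
    also have "\<dots> = real (card ?G) * (\<epsilon> / 2 * real X / of_int M)" by simp
    also have "\<dots> \<le> of_int M * (\<epsilon> / 2 * real X / of_int M)"
    proof (rule mult_right_mono)
      have "card ?G \<le> card {0..<M}" by (intro card_mono) auto
      then have "real (card ?G) \<le> real (nat M)" by simp
      then show "real (card ?G) \<le> of_int M" using M0 by simp
    qed (use \<epsilon> M0 in simp)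
    also have "\<dots> = \<epsilon> / 2 * real X" using M0 by simp
    finally have "real (card {n\<in>{1..int X}. n \<notin> range (qform A :: int^'n \<Rightarrow> int)}) \<le> \<epsilon> / 4 * real X + \<epsilon> / 2 * real X" by simp
    also have "\<dots> \<le> \<epsilon> * real X" using \<epsilon> by (simp add: field_simps)
    finally show ?case .
  qed
qed

section \<open>The p-adic conditions\<close>

lemma padic_val_frac:
  assumes p: "prime p" and "a \<noteq> 0" "b \<noteq> 0"
  shows "padic_val p (of_int a / of_int b) = int (multiplicity (int p) a) - int (multiplicity (int p) b)"
proof -
  obtain x y where xy: "quotient_of (of_int a / of_int b) = (x, y)" by (cases "quotient_of (of_int a / of_int b :: rat)")
  have y: "y > 0" using quotient_of_denom_pos[OF xy] .
  have "of_int a / of_int b = (of_int x / of_int y :: rat)" using quotient_of_div[OF xy] .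
  then have "of_int (a * y) = (of_int (x * b) :: rat)" using assms y by (simp add: field_simps)
  then have eq: "a * y = x * b" by (simp only: of_int_eq_iff)
  then have x: "x \<noteq> 0" using assms y by auto
  have pe: "prime_elem (int p)" using p by simp
  have "multiplicity (int p) (a * y) = multiplicity (int p) (x * b)" by (simp add: eq)
  then have "multiplicity (int p) a + multiplicity (int p) y = multiplicity (int p) x + multiplicity (int p) b"
    using assms x y by (simp add: prime_elem_multiplicity_mult_distrib[OF pe])
  then show ?thesis by (simp add: padic_val_def xy)
qed

lemma rat_fracE:
  fixes q :: rat
  obtains a b where "q = of_int a / of_int b" "b > 0" "q \<noteq> 0 \<Longrightarrow> a \<noteq> 0"
proof -
  obtain a b where ab: "quotient_of q = (a, b)" by (cases "quotient_of q")
  have "q = of_int a / of_int b" "b > 0"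
    using quotient_of_div[OF ab] quotient_of_denom_pos[OF ab] .
  then show thesis by (intro that) auto
qed

lemma padic_abs_0 [simp]: "padic_abs p 0 = 0"
  by (simp add: padic_abs_def)

lemma padic_abs_nonneg [simp]: "padic_abs p q \<ge> 0"
  by (simp add: padic_abs_def)

lemma padic_abs_mult:
  assumes p: "prime p"
  shows "padic_abs p (x * y) = padic_abs p x * padic_abs p y"
proof (cases "x = 0 \<or> y = 0")
  case False
  obtain a b where x: "x = of_int a / of_int b" "b > 0" "a \<noteq> 0" using rat_fracE[of x] False by metis
  obtain c d where y: "y = of_int c / of_int d" "d > 0" "c \<noteq> 0" using rat_fracE[of y] False by metis
  have pe: "prime_elem (int p)" using p by simp
  have xy: "x * y = of_int (a * c) / of_int (b * d)" by (simp add: x y)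
  have "padic_val p (x * y) = padic_val p x + padic_val p y"
    unfolding xy using x y p
    by (subst padic_val_frac[OF p]) (auto simp: padic_val_frac[OF p] prime_elem_multiplicity_mult_distrib[OF pe])
  moreover have "real p \<noteq> 0" using p by auto
  ultimately show ?thesis
    using False power_int_add[of "real p" "- padic_val p x" "- padic_val p y"] by (simp add: padic_abs_def)
qed (auto simp: padic_abs_def)

lemma padic_abs_minus [simp]: "padic_abs p (- x) = padic_abs p x"
proof (cases "x = 0")
  case False
  obtain a b where ab: "quotient_of x = (a, b)" by (cases "quotient_of x")
  then have "quotient_of (- x) = (- a, b)" by (simp add: rat_uminus_code)
  then show ?thesis using ab by (simp add: padic_abs_def padic_val_def)
qed simp

lemma padic_abs_minus_commute: "padic_abs p (x - y) = padic_abs p (y - x)"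
  by (metis minus_diff_eq padic_abs_minus)

lemma padic_abs_ultrametric:
  assumes p: "prime p"
  shows "padic_abs p (x + y) \<le> max (padic_abs p x) (padic_abs p y)"
proof (cases "x = 0 \<or> y = 0 \<or> x + y = 0")
  case False
  obtain a b where x: "x = of_int a / of_int b" "b > 0" "a \<noteq> 0" using rat_fracE[of x] False by metis
  obtain c d where y: "y = of_int c / of_int d" "d > 0" "c \<noteq> 0" using rat_fracE[of y] False by metis
  let ?m = "multiplicity (int p)"
  have x': "x = of_int (a * d) / of_int (b * d)" and y': "y = of_int (c * b) / of_int (b * d)"
    and xy: "x + y = of_int (a * d + c * b) / of_int (b * d)"
    using x y by (simp_all add: field_simps)
  have bd: "b * d \<noteq> 0" "a * d \<noteq> 0" "c * b \<noteq> 0" using x y by auto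
  have s0: "a * d + c * b \<noteq> 0"
  proof
    assume "a * d + c * b = 0"
    then have "x + y = 0" unfolding xy by (simp only: of_int_0 div_0)
    then show False using False by simp
  qed
  have "min (?m (a * d)) (?m (c * b)) \<le> ?m (a * d + c * b)"
  proof (rule multiplicity_geI)
    show "int p ^ min (?m (a * d)) (?m (c * b)) dvd a * d + c * b"
      by (intro dvd_add multiplicity_dvd') auto
  qed (use s0 p in auto)
  then have "min (padic_val p x) (padic_val p y) \<le> padic_val p (x + y)"
  proof -
    have "padic_val p x = int (?m (a * d)) - int (?m (b * d))" by (subst x') (rule padic_val_frac[OF p bd(2,1)])
    moreover have "padic_val p y = int (?m (c * b)) - int (?m (b * d))" by (subst y') (rule padic_val_frac[OF p bd(3,1)])
    moreover have "padic_val p (x + y) = int (?m (a * d + c * b)) - int (?m (b * d))"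
      by (subst xy) (rule padic_val_frac[OF p s0 bd(1)])
    ultimately show ?thesis
      using \<open>min (?m (a * d)) (?m (c * b)) \<le> ?m (a * d + c * b)\<close> by linarith
  qed
  moreover have p1: "real p > 1" using prime_gt_1_nat[OF p] by simp
  ultimately have "real p powi (- padic_val p (x + y)) \<le> max (real p powi (- padic_val p x)) (real p powi (- padic_val p y))"
  proof -
    assume "min (padic_val p x) (padic_val p y) \<le> padic_val p (x + y)"
    then have "- padic_val p (x + y) \<le> - padic_val p x \<or> - padic_val p (x + y) \<le> - padic_val p y" by linarith
    then have "real p powi (- padic_val p (x + y)) \<le> real p powi (- padic_val p x) \<or>
        real p powi (- padic_val p (x + y)) \<le> real p powi (- padic_val p y)"
      using p1 by (auto intro: power_int_increasing)
    then show ?thesis by auto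
  qed
  then show ?thesis using False by (simp add: padic_abs_def)
qed (auto simp: max_def)

lemma padic_abs_triangle:
  assumes "prime p" shows "padic_abs p (x + y) \<le> padic_abs p x + padic_abs p y"
  using padic_abs_ultrametric[OF assms, of x y] padic_abs_nonneg[of p x] padic_abs_nonneg[of p y] by linarith

lemma padic_abs_add_le:
  assumes "prime p" "padic_abs p x \<le> c" "padic_abs p y \<le> c"
  shows "padic_abs p (x + y) \<le> c"
  using padic_abs_ultrametric[OF assms(1), of x y] assms(2,3) by linarith

lemma padic_abs_diff_le:
  assumes "prime p" "padic_abs p x \<le> c" "padic_abs p y \<le> c"
  shows "padic_abs p (x - y) \<le> c"
  using padic_abs_add_le[OF assms(1,2), of "- y"] assms(3) by simp

lemma padic_abs_sum_le:
  assumes "prime p" "\<And>i. i \<in> S \<Longrightarrow> padic_abs p (f i) \<le> c" "c \<ge> 0"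
  shows "padic_abs p (sum f S) \<le> c"
  using assms(2)
  by (induction S rule: infinite_finite_induct) (auto simp: assms(3) intro!: padic_abs_add_le[OF assms(1)])

lemma padic_abs_of_int_le_iff:
  assumes p: "prime p"
  shows "padic_abs p (of_int z) \<le> 1 / real p ^ K \<longleftrightarrow> int p ^ K dvd z"
proof (cases "z = 0")
  case False
  have v: "padic_val p (of_int z) = int (multiplicity (int p) z)"
    using padic_val_frac[OF p False, of 1] by simp
  have p1: "real p > 1" using prime_gt_1_nat[OF p] by simp
  have "padic_abs p (of_int z) = 1 / real p ^ multiplicity (int p) z"
    using False by (simp add: padic_abs_def v power_int_minus divide_inverse)
  then have "padic_abs p (of_int z) \<le> 1 / real p ^ K \<longleftrightarrow> real p ^ K \<le> real p ^ multiplicity (int p) z"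
    using p1 by (simp only:) (simp add: divide_simps)
  also have "\<dots> \<longleftrightarrow> K \<le> multiplicity (int p) z" using p1 by simp
  also have "\<dots> \<longleftrightarrow> int p ^ K dvd z"
    using False p by (intro power_dvd_iff_le_multiplicity[symmetric]) auto
  finally show ?thesis .
qed (use assms in simp)

lemma padic_abs_of_int_le_1: "prime p \<Longrightarrow> padic_abs p (of_int z) \<le> 1"
  using padic_abs_of_int_le_iff[of p z 0] by simp

text \<open>Nonzero absolute values are powers of \<open>p\<close>, so none lies strictly between 1
  and 2. This openness of the unit ball turns a condition on a limit into one on the tail of a
  sequence.\<close>

lemma padic_abs_le_1_iff:
  assumes p: "prime p"
  shows "padic_abs p q \<le> 1 \<longleftrightarrow> padic_abs p q < 2"
proof
  assume lt: "padic_abs p q < 2"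
  show "padic_abs p q \<le> 1"
  proof (cases "q = 0")
    case False
    have p2: "real p \<ge> 2" using p prime_ge_2_nat[of p] by simp
    have "- padic_val p q \<le> 0"
    proof (rule ccontr)
      assume "\<not> - padic_val p q \<le> 0"
      then have "real p powi 1 \<le> real p powi (- padic_val p q)" using p2 by (intro power_int_increasing) auto
      then show False using lt p2 False by (simp add: padic_abs_def)
    qed
    then have "real p powi (- padic_val p q) \<le> real p powi 0" using p2 by (intro power_int_increasing) auto
    then show ?thesis using False by (simp add: padic_abs_def)
  qed simp
qed simp

text \<open>The integers are dense in the unit ball: the reduced denominator is prime to
  \<open>p\<close> and hence invertible modulo \<open>p^K\<close>.\<close>

lemma padic_integral_approx:
  assumes p: "prime p" and q: "padic_abs p q \<le> 1"
  shows "\<exists>a::int. padic_abs p (q - of_int a) \<le> 1 / real p ^ K"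
proof -
  obtain x y where xy: "quotient_of q = (x, y)" by (cases "quotient_of q")
  have q': "q = of_int x / of_int y" and y: "y > 0" and cop: "coprime x y"
    using quotient_of_div[OF xy] quotient_of_denom_pos[OF xy] quotient_of_coprime[OF xy] by auto
  have ip: "prime (int p)" using p by simp
  have p1: "real p > 1" using prime_gt_1_nat[OF p] by simp
  have yq: "of_int y * q = of_int x" using q' y by simp
  have ny: "\<not> int p dvd y"
  proof
    assume py: "int p dvd y"
    have "padic_abs p (of_int x) = padic_abs p (of_int y) * padic_abs p q"
      unfolding yq[symmetric] by (rule padic_abs_mult[OF p])
    also have "\<dots> \<le> 1 / real p ^ 1 * 1"
      using py q padic_abs_of_int_le_iff[OF p, of y 1] by (intro mult_mono) auto
    finally have "int p dvd x" using padic_abs_of_int_le_iff[OF p, of x 1] by simp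
    then show False using cop py ip by (meson coprime_common_divisor not_prime_unit)
  qed
  then have "coprime y (int p ^ K)" using prime_imp_coprime[OF ip ny] by (simp add: coprime_commute)
  then obtain s where "[y * s = 1] (mod int p ^ K)" using cong_solve_coprime_int by blast
  then have s: "int p ^ K dvd y * s - 1" by (simp add: cong_iff_dvd_diff)
  define a where "a = s * x"
  have "of_int y * (q - of_int a) = (of_int ((1 - y * s) * x) :: rat)"
    using yq by (simp add: a_def algebra_simps)
  moreover have "int p ^ K dvd (1 - y * s) * x"
    using s by (metis dvd_mult2 dvd_minus_iff minus_diff_eq)
  ultimately have 1: "padic_abs p (of_int y * (q - of_int a)) \<le> 1 / real p ^ K"
    by (simp only: padic_abs_of_int_le_iff[OF p])
  have "padic_abs p (of_int y) = 1"
    using padic_val_frac[OF p, of y 1] y ny by (simp add: padic_abs_def not_dvd_imp_multiplicity_0)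
  then show ?thesis using 1 unfolding padic_abs_mult[OF p] by auto
qed

section \<open>Cauchy sequences and null sequences\<close>

lemma padic_CauchyD:
  assumes "padic_Cauchy p x" "e > 0"
  obtains N where "\<And>m k. m \<ge> N \<Longrightarrow> k \<ge> N \<Longrightarrow> padic_abs p (x m - x k) < e"
  using assms unfolding padic_Cauchy_def by blast

lemma padic_Cauchy_bounded:
  assumes p: "prime p" and x: "padic_Cauchy p x"
  obtains C where "C > 0" "\<And>k. padic_abs p (x k) \<le> C"
proof -
  obtain N where N: "\<And>m k. m \<ge> N \<Longrightarrow> k \<ge> N \<Longrightarrow> padic_abs p (x m - x k) < 1"
    using padic_CauchyD[OF x, of 1] by auto
  define C where "C = Max ((\<lambda>k. padic_abs p (x k)) ` {..N}) + 1"
  have le: "padic_abs p (x k) \<le> C - 1" if "k \<le> N" for k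
    unfolding C_def using that by (simp add: Max_ge)
  then have C: "C \<ge> 1" using padic_abs_nonneg[of p "x N"] order_trans[OF padic_abs_nonneg le[of N]] by simp
  have "padic_abs p (x k) \<le> C" for k
  proof (cases "k \<le> N")
    case False
    have "padic_abs p (x N + (x k - x N)) \<le> padic_abs p (x N) + padic_abs p (x k - x N)"
      by (rule padic_abs_triangle[OF p])
    then show ?thesis using le[of N] N[of k N] False by simp
  qed (use le in fastforce)
  then show thesis using C by (intro that[of C]) auto
qed

lemma padic_Cauchy_const [simp]: "padic_Cauchy p (\<lambda>k. c)"
  by (auto simp: padic_Cauchy_def)

lemma padic_Cauchy_add:
  assumes p: "prime p" and x: "padic_Cauchy p x" and y: "padic_Cauchy p y"
  shows "padic_Cauchy p (\<lambda>k. x k + y k)"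
  unfolding padic_Cauchy_def
proof (intro allI impI)
  fix e :: real assume e: "e > 0"
  obtain N where N: "\<And>m k. m \<ge> N \<Longrightarrow> k \<ge> N \<Longrightarrow> padic_abs p (x m - x k) < e" by (rule padic_CauchyD[OF x e]) blast
  obtain N' where N': "\<And>m k. m \<ge> N' \<Longrightarrow> k \<ge> N' \<Longrightarrow> padic_abs p (y m - y k) < e" by (rule padic_CauchyD[OF y e]) blast
  have "padic_abs p (x m + y m - (x k + y k)) < e" if "m \<ge> max N N'" "k \<ge> max N N'" for m k
  proof -
    have "padic_abs p ((x m - x k) + (y m - y k)) \<le> max (padic_abs p (x m - x k)) (padic_abs p (y m - y k))"
      by (rule padic_abs_ultrametric[OF p])
    also have "\<dots> < e" using N N' that by simp
    finally show ?thesis by (simp add: algebra_simps)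
  qed
  then show "\<exists>N. \<forall>m\<ge>N. \<forall>k\<ge>N. padic_abs p (x m + y m - (x k + y k)) < e" by blast
qed

lemma padic_Cauchy_mult:
  assumes p: "prime p" and x: "padic_Cauchy p x" and y: "padic_Cauchy p y"
  shows "padic_Cauchy p (\<lambda>k. x k * y k)"
  unfolding padic_Cauchy_def
proof (intro allI impI)
  fix e :: real assume e: "e > 0"
  obtain C where C: "C > 0" "\<And>k. padic_abs p (x k) \<le> C" using padic_Cauchy_bounded[OF p x] by blast
  obtain C' where C': "C' > 0" "\<And>k. padic_abs p (y k) \<le> C'" using padic_Cauchy_bounded[OF p y] by blast
  have e1: "e / C' > 0" "e / C > 0" using e C C' by auto
  obtain N where N: "\<And>m k. m \<ge> N \<Longrightarrow> k \<ge> N \<Longrightarrow> padic_abs p (x m - x k) < e / C'" by (rule padic_CauchyD[OF x e1(1)]) blast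
  obtain N' where N': "\<And>m k. m \<ge> N' \<Longrightarrow> k \<ge> N' \<Longrightarrow> padic_abs p (y m - y k) < e / C" by (rule padic_CauchyD[OF y e1(2)]) blast
  have "padic_abs p (x m * y m - x k * y k) < e" if "m \<ge> max N N'" "k \<ge> max N N'" for m k
  proof -
    have "x m * y m - x k * y k = (x m - x k) * y m + x k * (y m - y k)" by (simp add: algebra_simps)
    then have "padic_abs p (x m * y m - x k * y k) \<le>
        max (padic_abs p (x m - x k) * padic_abs p (y m)) (padic_abs p (x k) * padic_abs p (y m - y k))"
      using padic_abs_ultrametric[OF p, of "(x m - x k) * y m" "x k * (y m - y k)"] by (simp add: padic_abs_mult[OF p])
    also have "\<dots> \<le> max (padic_abs p (x m - x k) * C') (C * padic_abs p (y m - y k))"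
      using C C' by (intro max.mono mult_mono) auto
    also have "\<dots> < e"
      using N[of m k] N'[of m k] that C C' by (simp add: field_simps)
    finally show ?thesis .
  qed
  then show "\<exists>N. \<forall>m\<ge>N. \<forall>k\<ge>N. padic_abs p (x m * y m - x k * y k) < e" by blast
qed

lemma padic_Cauchy_minus:
  assumes p: "prime p" and x: "padic_Cauchy p x"
  shows "padic_Cauchy p (\<lambda>k. - x k)"
  using padic_Cauchy_mult[OF p padic_Cauchy_const[of p "- 1"] x] by simp

lemma padic_Cauchy_sum:
  assumes p: "prime p" and "\<And>i. i \<in> S \<Longrightarrow> padic_Cauchy p (f i)"
  shows "padic_Cauchy p (\<lambda>k. \<Sum>i\<in>S. f i k)"
  using assms(2)
  by (induction S rule: infinite_finite_induct) (auto intro!: padic_Cauchy_add[OF p])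

lemma padic_null_iff: "x \<in> padic_null p \<longleftrightarrow> (\<forall>e>0. \<exists>N. \<forall>k\<ge>N. padic_abs p (x k) < e)"
  by (simp add: padic_null_def LIMSEQ_iff)

lemma padic_null_Cauchy:
  assumes p: "prime p" and x: "x \<in> padic_null p"
  shows "padic_Cauchy p x"
  unfolding padic_Cauchy_def
proof (intro allI impI)
  fix e :: real assume e: "e > 0"
  then obtain N where N: "\<forall>k\<ge>N. padic_abs p (x k) < e" using x unfolding padic_null_iff by blast
  have "padic_abs p (x m - x k) < e" if "m \<ge> N" "k \<ge> N" for m k
    using padic_abs_ultrametric[OF p, of "x m" "- x k"] N that by (auto simp: max_def split: if_splits intro: le_less_trans)
  then show "\<exists>N. \<forall>m\<ge>N. \<forall>k\<ge>N. padic_abs p (x m - x k) < e" by blast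
qed

lemma padic_null_add:
  assumes p: "prime p" and "x \<in> padic_null p" "y \<in> padic_null p"
  shows "(\<lambda>k. x k + y k) \<in> padic_null p"
proof -
  have 0: "(\<lambda>k. padic_abs p (x k) + padic_abs p (y k)) \<longlonglongrightarrow> 0 + 0"
    using assms(2,3) unfolding padic_null_def by (intro tendsto_add) auto
  have "(\<lambda>k. padic_abs p (x k + y k)) \<longlonglongrightarrow> 0"
  proof (rule Lim_null_comparison)
    show "\<forall>\<^sub>F k in sequentially. norm (padic_abs p (x k + y k)) \<le> padic_abs p (x k) + padic_abs p (y k)"
      using padic_abs_triangle[OF p] by simp
  qed (use 0 in simp)
  then show ?thesis by (simp add: padic_null_def)
qed

lemma padic_null_mult:
  assumes p: "prime p" and x: "padic_Cauchy p x" and y: "y \<in> padic_null p"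
  shows "(\<lambda>k. x k * y k) \<in> padic_null p"
proof -
  obtain C where C: "C > 0" "\<And>k. padic_abs p (x k) \<le> C" using padic_Cauchy_bounded[OF p x] by blast
  have 0: "(\<lambda>k. C * padic_abs p (y k)) \<longlonglongrightarrow> C * 0"
    using y unfolding padic_null_def by (intro tendsto_mult) auto
  have "(\<lambda>k. padic_abs p (x k * y k)) \<longlonglongrightarrow> 0"
  proof (rule Lim_null_comparison)
    show "\<forall>\<^sub>F k in sequentially. norm (padic_abs p (x k * y k)) \<le> C * padic_abs p (y k)"
      using C(2) by (simp add: padic_abs_mult[OF p] mult_right_mono)
  qed (use 0 in simp)
  then show ?thesis by (simp add: padic_null_def)
qed

lemma padic_null_minus: "x \<in> padic_null p \<Longrightarrow> (\<lambda>k. - x k) \<in> padic_null p"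
  by (simp add: padic_null_def)

lemma padic_Cauchy_ring_simps [simp]:
  "carrier (padic_Cauchy_ring p) = {x. padic_Cauchy p x}"
  "x \<otimes>\<^bsub>padic_Cauchy_ring p\<^esub> y = (\<lambda>k. x k * y k)"
  "\<one>\<^bsub>padic_Cauchy_ring p\<^esub> = (\<lambda>k. 1)"
  "\<zero>\<^bsub>padic_Cauchy_ring p\<^esub> = (\<lambda>k. 0)"
  "x \<oplus>\<^bsub>padic_Cauchy_ring p\<^esub> y = (\<lambda>k. x k + y k)"
  by (simp_all add: padic_Cauchy_ring_def)

lemma padic_Cauchy_cring:
  assumes p: "prime p"
  shows "cring (padic_Cauchy_ring p)"
proof (rule cringI)
  show "abelian_group (padic_Cauchy_ring p)"
  proof (rule abelian_groupI)
    fix x assume "x \<in> carrier (padic_Cauchy_ring p)"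
    then show "\<exists>y\<in>carrier (padic_Cauchy_ring p). y \<oplus>\<^bsub>padic_Cauchy_ring p\<^esub> x = \<zero>\<^bsub>padic_Cauchy_ring p\<^esub>"
      by (intro bexI[of _ "\<lambda>k. - x k"]) (auto intro: padic_Cauchy_minus[OF p])
  qed (auto intro: padic_Cauchy_add[OF p] simp: algebra_simps)
  show "comm_monoid (padic_Cauchy_ring p)"
    by (rule comm_monoidI) (auto intro: padic_Cauchy_mult[OF p] simp: algebra_simps)
qed (auto simp: algebra_simps)

lemma padic_null_ideal:
  assumes p: "prime p"
  shows "ideal (padic_null p) (padic_Cauchy_ring p)"
proof (rule idealI)
  interpret R: cring "padic_Cauchy_ring p" by (rule padic_Cauchy_cring[OF p])
  show "ring (padic_Cauchy_ring p)" by (rule R.ring_axioms)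
  have neg: "\<ominus>\<^bsub>padic_Cauchy_ring p\<^esub> x = (\<lambda>k. - x k)" if "padic_Cauchy p x" for x
    by (rule R.minus_equality) (use that padic_Cauchy_minus[OF p that] in auto)
  show "subgroup (padic_null p) (add_monoid (padic_Cauchy_ring p))"
  proof (rule group.subgroupI)
    show "group (add_monoid (padic_Cauchy_ring p))" by (rule R.a_group)
    show "padic_null p \<noteq> {}" by (auto simp: padic_null_def intro!: exI[of _ "\<lambda>k. 0"])
    fix x assume x: "x \<in> padic_null p"
    have "inv\<^bsub>add_monoid (padic_Cauchy_ring p)\<^esub> x = (\<lambda>k. - x k)"
      using neg[OF padic_null_Cauchy[OF p x]] by (simp add: a_inv_def)
    then show "inv\<^bsub>add_monoid (padic_Cauchy_ring p)\<^esub> x \<in> padic_null p"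
      using padic_null_minus[OF x] by simp
  qed (auto intro: padic_null_Cauchy[OF p] padic_null_add[OF p])
  fix a x assume ax: "a \<in> padic_null p" "x \<in> carrier (padic_Cauchy_ring p)"
  then show "x \<otimes>\<^bsub>padic_Cauchy_ring p\<^esub> a \<in> padic_null p" by (auto intro: padic_null_mult[OF p])
  then show "a \<otimes>\<^bsub>padic_Cauchy_ring p\<^esub> x \<in> padic_null p" by (simp add: mult.commute)
qed

section \<open>Classes of Cauchy sequences and values of the form on them\<close>

definition padic_class :: "nat \<Rightarrow> (nat \<Rightarrow> rat) \<Rightarrow> (nat \<Rightarrow> rat) set" where
  "padic_class p x = padic_null p +>\<^bsub>padic_Cauchy_ring p\<^esub> x"

lemma padic_class_altdef: "padic_class p x = {y. (\<lambda>k. y k - x k) \<in> padic_null p}"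
proof -
  have "padic_class p x = (\<Union>z\<in>padic_null p. {\<lambda>k. z k + x k})"
    by (simp add: padic_class_def a_r_coset_def')
  also have "\<dots> = {y. (\<lambda>k. y k - x k) \<in> padic_null p}"
  proof (intro equalityI subsetI)
    fix y assume "y \<in> {y. (\<lambda>k. y k - x k) \<in> padic_null p}"
    then show "y \<in> (\<Union>z\<in>padic_null p. {\<lambda>k. z k + x k})"
      by (intro UN_I[of "\<lambda>k. y k - x k"]) auto
  qed auto
  finally show ?thesis .
qed

lemma padic_class_eq_iff:
  assumes p: "prime p"
  shows "padic_class p x = padic_class p y \<longleftrightarrow> (\<lambda>k. x k - y k) \<in> padic_null p"
proof
  assume "padic_class p x = padic_class p y"
  moreover have "x \<in> padic_class p x" by (simp add: padic_class_altdef padic_null_def)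
  ultimately show "(\<lambda>k. x k - y k) \<in> padic_null p" by (simp add: padic_class_altdef)
next
  assume d: "(\<lambda>k. x k - y k) \<in> padic_null p"
  have "(\<lambda>k. z k - x k) \<in> padic_null p \<longleftrightarrow> (\<lambda>k. z k - y k) \<in> padic_null p" for z
    using padic_null_add[OF p d, of "\<lambda>k. z k - x k"] padic_null_add[OF p padic_null_minus[OF d], of "\<lambda>k. z k - y k"]
    by (auto simp: algebra_simps)
  then show "padic_class p x = padic_class p y" by (simp add: padic_class_altdef)
qed

lemma padic_field_carrier: "carrier (padic_field p) = padic_class p ` {x. padic_Cauchy p x}"
  by (auto simp: padic_field_def FactRing_def A_RCOSETS_def' padic_class_def)

lemma padic_field_zero: "\<zero>\<^bsub>padic_field p\<^esub> = padic_class p (\<lambda>k. 0)"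
  by (simp add: padic_field_def FactRing_def padic_class_altdef)

lemma padic_class_hom:
  assumes p: "prime p"
  shows "ring_hom_cring (padic_Cauchy_ring p) (padic_field p) (padic_class p)"
proof -
  interpret I: ideal "padic_null p" "padic_Cauchy_ring p" by (rule padic_null_ideal[OF p])
  have "padic_class p = a_r_coset (padic_Cauchy_ring p) (padic_null p)" by (simp add: padic_class_def fun_eq_iff)
  then show ?thesis unfolding padic_field_def
    using I.rcos_ring_hom_cring[OF padic_Cauchy_cring[OF p]] by simp
qed

lemma padic_abs_convergent:
  assumes p: "prime p" and x: "padic_Cauchy p x"
  shows "convergent (\<lambda>k. padic_abs p (x k))"
proof -
  have tri: "padic_abs p y - padic_abs p z \<le> padic_abs p (y - z)" for y z
    using padic_abs_triangle[OF p, of "y - z" z] by simp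
  have "Cauchy (\<lambda>k. padic_abs p (x k))"
    unfolding Cauchy_iff
  proof (intro allI impI)
    fix e :: real assume "e > 0"
    then obtain N where N: "\<And>m k. m \<ge> N \<Longrightarrow> k \<ge> N \<Longrightarrow> padic_abs p (x m - x k) < e" using padic_CauchyD[OF x] by blast
    have "norm (padic_abs p (x m) - padic_abs p (x k)) < e" if "m \<ge> N" "k \<ge> N" for m k
      using tri[of "x m" "x k"] tri[of "x k" "x m"] N[OF that] padic_abs_minus_commute[of p "x k" "x m"] by auto
    then show "\<exists>N. \<forall>m\<ge>N. \<forall>n\<ge>N. norm (padic_abs p (x m) - padic_abs p (x n)) < e" by blast
  qed
  then show ?thesis by (simp add: Cauchy_convergent_iff)
qed

text \<open>A limit at most 1 forces absolute values below 2 eventually, hence at most 1.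
  Conversely, members of one class differ by a null sequence, so their absolute values share a
  limit.\<close>

lemma padic_class_int_iff:
  assumes p: "prime p" and x: "padic_Cauchy p x"
  shows "padic_class p x \<in> padic_int p \<longleftrightarrow> (\<forall>\<^sub>F k in sequentially. padic_abs p (x k) \<le> 1)"
proof
  assume "padic_class p x \<in> padic_int p"
  then obtain r where r: "r \<le> 1" "\<forall>y\<in>padic_class p x. (\<lambda>k. padic_abs p (y k)) \<longlonglongrightarrow> r"
    by (auto simp: padic_int_def)
  have "x \<in> padic_class p x" by (simp add: padic_class_altdef padic_null_def)
  then have "(\<lambda>k. padic_abs p (x k)) \<longlonglongrightarrow> r" using r by blast
  then have "\<forall>\<^sub>F k in sequentially. padic_abs p (x k) < 2" using r by (intro order_tendstoD(2)) auto
  then show "\<forall>\<^sub>F k in sequentially. padic_abs p (x k) \<le> 1" by (simp only: padic_abs_le_1_iff[OF p])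
next
  assume ev: "\<forall>\<^sub>F k in sequentially. padic_abs p (x k) \<le> 1"
  obtain r where r: "(\<lambda>k. padic_abs p (x k)) \<longlonglongrightarrow> r"
    using padic_abs_convergent[OF p x] by (auto simp: convergent_def)
  have "r \<le> 1" by (rule tendsto_upperbound[OF r ev]) simp
  moreover have "(\<lambda>k. padic_abs p (y k)) \<longlonglongrightarrow> r" if y: "y \<in> padic_class p x" for y
  proof -
    have d: "(\<lambda>k. padic_abs p (y k - x k)) \<longlonglongrightarrow> 0" using y by (simp add: padic_class_altdef padic_null_def)
    have "(\<lambda>k. padic_abs p (y k) - padic_abs p (x k)) \<longlonglongrightarrow> 0"
    proof (rule tendsto_0_le[OF d, of _ 1])
      have "norm (padic_abs p (y k) - padic_abs p (x k)) \<le> norm (padic_abs p (y k - x k)) * 1" for k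
        using padic_abs_triangle[OF p, of "y k - x k" "x k"] padic_abs_triangle[OF p, of "x k - y k" "y k"]
          padic_abs_minus_commute[of p "x k" "y k"] by simp
      then show "\<forall>\<^sub>F k in sequentially. norm (padic_abs p (y k) - padic_abs p (x k)) \<le> norm (padic_abs p (y k - x k)) * 1"
        by simp
    qed
    from tendsto_add[OF this r] show ?thesis by simp
  qed
  ultimately show "padic_class p x \<in> padic_int p"
    using x by (auto simp: padic_int_def padic_field_carrier)
qed

lemma padic_Cauchy_ring_finsum:
  assumes p: "prime p" and f: "\<And>i. i \<in> S \<Longrightarrow> padic_Cauchy p (f i)"
  shows "finsum (padic_Cauchy_ring p) f S = (\<lambda>k. \<Sum>i\<in>S. f i k)"
proof -
  interpret R: cring "padic_Cauchy_ring p" by (rule padic_Cauchy_cring[OF p])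
  show ?thesis using f
  proof (induction S rule: infinite_finite_induct)
    case (insert i S)
    then have "finsum (padic_Cauchy_ring p) f (insert i S) = f i \<oplus>\<^bsub>padic_Cauchy_ring p\<^esub> finsum (padic_Cauchy_ring p) f S"
      by (intro R.finsum_insert) auto
    then show ?case using insert by simp
  qed (simp_all add: R.finsum_infinite)
qed

lemma padic_class_int_multiple:
  fixes a :: int
  assumes p: "prime p"
  shows "[a] \<cdot>\<^bsub>padic_field p\<^esub> \<one>\<^bsub>padic_field p\<^esub> = padic_class p (\<lambda>k. of_int a)"
proof -
  interpret h: ring_hom_cring "padic_Cauchy_ring p" "padic_field p" "padic_class p" by (rule padic_class_hom[OF p])
  have one: "\<one>\<^bsub>padic_field p\<^esub> = padic_class p (\<lambda>k. 1)" using h.hom_one by simp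
  have nat: "[n] \<cdot>\<^bsub>padic_field p\<^esub> \<one>\<^bsub>padic_field p\<^esub> = padic_class p (\<lambda>k. of_nat n)" for n :: nat
  proof (induction n)
    case 0
    then show ?case using h.hom_zero by simp
  next
    case (Suc n)
    have "padic_class p (\<lambda>k. of_nat n + 1) = padic_class p (\<lambda>k. of_nat n) \<oplus>\<^bsub>padic_field p\<^esub> padic_class p (\<lambda>k. 1)"
      using h.hom_add[of "\<lambda>k. of_nat n" "\<lambda>k. 1"] by simp
    then show ?case using Suc by (simp add: one add.commute)
  qed
  show ?thesis
  proof (cases "a \<ge> 0")
    case True
    then show ?thesis using nat[of "nat a"] by (simp add: add_pow_int_ge)
  next
    case False
    have "\<ominus>\<^bsub>padic_field p\<^esub> padic_class p (\<lambda>k. of_nat (nat (- a))) = padic_class p (\<lambda>k. of_int a)"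
    proof (rule h.S.minus_equality)
      show "padic_class p (\<lambda>k. of_int a) \<oplus>\<^bsub>padic_field p\<^esub> padic_class p (\<lambda>k. of_nat (nat (- a))) = \<zero>\<^bsub>padic_field p\<^esub>"
        using h.hom_add[of "\<lambda>k. of_int a" "\<lambda>k. of_nat (nat (- a))"] h.hom_zero False by simp
      show "padic_class p (\<lambda>k. of_nat (nat (- a))) \<in> carrier (padic_field p)"
        "padic_class p (\<lambda>k. of_int a) \<in> carrier (padic_field p)"
        by (auto simp: padic_field_carrier)
    qed
    then show ?thesis using nat[of "nat (- a)"] False by (simp add: add_pow_int_lt)
  qed
qed

lemma ring_qform_padic:
  fixes A :: "int^'n^'n"
  assumes p: "prime p" and w: "\<And>i. padic_Cauchy p (w i)"
  shows "ring_qform (padic_field p) (padic_coeffs p A) (\<lambda>i. padic_class p (w i)) =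
    padic_class p (\<lambda>k. qform A (\<chi> i. w i k))"
proof -
  interpret h: ring_hom_cring "padic_Cauchy_ring p" "padic_field p" "padic_class p" by (rule padic_class_hom[OF p])
  define t where "t i j = (\<lambda>k. of_int (A $ i $ j) * w i k * w j k)" for i j
  have t: "padic_Cauchy p (t i j)" for i j
    unfolding t_def by (intro padic_Cauchy_mult[OF p] w padic_Cauchy_const)
  have t': "padic_class p (t i j) = padic_coeffs p A i j \<otimes>\<^bsub>padic_field p\<^esub> padic_class p (w i) \<otimes>\<^bsub>padic_field p\<^esub> padic_class p (w j)" for i j
  proof -
    have "padic_class p (\<lambda>k. of_int (A $ i $ j) * w i k) = padic_class p (\<lambda>k. of_int (A $ i $ j)) \<otimes>\<^bsub>padic_field p\<^esub> padic_class p (w i)"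
      using h.hom_mult[of "\<lambda>k. of_int (A $ i $ j)" "w i"] w by simp
    moreover have "padic_class p (t i j) = padic_class p (\<lambda>k. of_int (A $ i $ j) * w i k) \<otimes>\<^bsub>padic_field p\<^esub> padic_class p (w j)"
      using h.hom_mult[of "\<lambda>k. of_int (A $ i $ j) * w i k" "w j"] w
      by (simp add: t_def padic_Cauchy_mult[OF p])
    ultimately show ?thesis by (simp add: padic_coeffs_def padic_class_int_multiple[OF p])
  qed
  have s: "padic_Cauchy p (\<lambda>k. \<Sum>j\<in>UNIV. t i j k)" for i by (rule padic_Cauchy_sum[OF p t])
  have "padic_class p (\<lambda>k. qform A (\<chi> i. w i k)) = padic_class p (\<lambda>k. \<Sum>i\<in>UNIV. \<Sum>j\<in>UNIV. t i j k)"
    by (simp add: qform_def t_def)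
  also have "\<dots> = padic_class p (finsum (padic_Cauchy_ring p) (\<lambda>i k. \<Sum>j\<in>UNIV. t i j k) UNIV)"
    using s by (simp add: padic_Cauchy_ring_finsum[OF p])
  also have "\<dots> = finsum (padic_field p) (padic_class p \<circ> (\<lambda>i k. \<Sum>j\<in>UNIV. t i j k)) UNIV"
    using s by (intro h.hom_finsum) auto
  also have "padic_class p \<circ> (\<lambda>i k. \<Sum>j\<in>UNIV. t i j k) = (\<lambda>i. finsum (padic_field p) (\<lambda>j. padic_class p (t i j)) UNIV)"
  proof
    fix i
    have "(\<lambda>k. \<Sum>j\<in>UNIV. t i j k) = finsum (padic_Cauchy_ring p) (t i) UNIV"
      using t by (simp add: padic_Cauchy_ring_finsum[OF p])
    then have "padic_class p (\<lambda>k. \<Sum>j\<in>UNIV. t i j k) = finsum (padic_field p) (padic_class p \<circ> t i) UNIV"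
      using t h.hom_finsum[of "t i" UNIV] by (simp add: Pi_def)
    then show "(padic_class p \<circ> (\<lambda>i k. \<Sum>j\<in>UNIV. t i j k)) i = finsum (padic_field p) (\<lambda>j. padic_class p (t i j)) UNIV"
      by (simp add: comp_def)
  qed
  finally show ?thesis by (simp add: ring_qform_def t')
qed

text \<open>With \<open>u = v - w\<close> the difference is \<open>B w u + f u\<close>; each term is
  an integer times two integral coordinates, one of which has absolute value at most
  \<open>e\<close>.\<close>

lemma padic_abs_qform_diff_le:
  fixes A :: "int^'n^'n" and v w :: "rat^'n"
  assumes p: "prime p" and w: "\<And>i. padic_abs p (w $ i) \<le> 1"
    and d: "\<And>i. padic_abs p (v $ i - w $ i) \<le> e" and e: "0 \<le> e" "e \<le> 1"
  shows "padic_abs p (qform A v - qform A w) \<le> e"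
proof -
  define u where "u = v - w"
  have v: "v = w + u" by (simp add: u_def)
  have u: "padic_abs p (u $ i) \<le> e" for i using d by (simp add: u_def)
  have m: "padic_abs p (of_int a * (x * y)) \<le> e" if "padic_abs p x \<le> 1" "padic_abs p y \<le> e" for a x y
  proof -
    have "padic_abs p (of_int a) * (padic_abs p x * padic_abs p y) \<le> 1 * (1 * e)"
      using that e padic_abs_of_int_le_1[OF p] by (intro mult_mono) auto
    then show ?thesis by (simp add: padic_abs_mult[OF p])
  qed
  have u1: "padic_abs p (u $ i) \<le> 1" for i using u[of i] e by simp
  have "padic_abs p (qpolar A w u) \<le> e"
    unfolding qpolar_def distrib_left using w u e
    by (intro padic_abs_sum_le[OF p] padic_abs_add_le[OF p]) (auto intro!: m simp: mult.commute[of "u $ _"])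
  moreover have "padic_abs p (qform A u) \<le> e"
    unfolding qform_def mult.assoc using u u1 e by (intro padic_abs_sum_le[OF p] m) auto
  ultimately have "padic_abs p (qpolar A w u + qform A u) \<le> e" by (rule padic_abs_add_le[OF p])
  then show ?thesis by (simp add: v qform_add)
qed

lemma padic_small_power:
  fixes e :: real
  assumes "prime p" "e > 0"
  obtains K where "1 / real p ^ K < e"
proof -
  have "real p > 1" using prime_gt_1_nat[OF assms(1)] by simp
  then obtain K where "1 / e < real p ^ K" using real_arch_pow by blast
  then have "1 / real p ^ K < e" using assms \<open>real p > 1\<close> by (simp add: field_simps)
  then show thesis by (rule that)
qed

section \<open>Representation by p-adic integers in terms of sequences\<close>

definition integrally_represents :: "nat \<Rightarrow> int^'n^'n \<Rightarrow> (nat \<Rightarrow> rat) \<Rightarrow> bool" where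
  "integrally_represents p A x \<longleftrightarrow> (\<exists>w. (\<forall>i. w i \<in> padic_int p) \<and>
     ring_qform (padic_field p) (padic_coeffs p A) w = padic_class p x)"

lemma integrally_represents_iff:
  fixes A :: "int^'n^'n"
  assumes p: "prime p"
  shows "integrally_represents p A x \<longleftrightarrow>
    (\<exists>w. (\<forall>i. padic_Cauchy p (w i) \<and> (\<forall>\<^sub>F k in sequentially. padic_abs p (w i k) \<le> 1)) \<and>
      (\<lambda>k. qform A (\<chi> i. w i k) - x k) \<in> padic_null p)"
proof
  assume "integrally_represents p A x"
  then obtain W where W: "\<And>i. W i \<in> padic_int p" "ring_qform (padic_field p) (padic_coeffs p A) W = padic_class p x"
    by (auto simp: integrally_represents_def)
  have "\<forall>i. \<exists>w. padic_Cauchy p w \<and> W i = padic_class p w"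
  proof
    fix i
    have "W i \<in> carrier (padic_field p)" using W(1)[of i] by (simp add: padic_int_def)
    then show "\<exists>w. padic_Cauchy p w \<and> W i = padic_class p w" by (auto simp: padic_field_carrier)
  qed
  then obtain w where w: "\<And>i. padic_Cauchy p (w i)" "\<And>i. W i = padic_class p (w i)" by metis
  have "W = (\<lambda>i. padic_class p (w i))" using w(2) by auto
  then have "(\<lambda>k. qform A (\<chi> i. w i k) - x k) \<in> padic_null p"
    using W(2) by (simp add: ring_qform_padic[OF p w(1)] padic_class_eq_iff[OF p])
  moreover have "\<forall>\<^sub>F k in sequentially. padic_abs p (w i k) \<le> 1" for i
    using W(1)[of i] padic_class_int_iff[OF p w(1)[of i]] w(2)[of i] by simp
  ultimately show "\<exists>w. (\<forall>i. padic_Cauchy p (w i) \<and> (\<forall>\<^sub>F k in sequentially. padic_abs p (w i k) \<le> 1)) \<and>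
      (\<lambda>k. qform A (\<chi> i. w i k) - x k) \<in> padic_null p" using w(1) by blast
next
  assume "\<exists>w. (\<forall>i. padic_Cauchy p (w i) \<and> (\<forall>\<^sub>F k in sequentially. padic_abs p (w i k) \<le> 1)) \<and>
      (\<lambda>k. qform A (\<chi> i. w i k) - x k) \<in> padic_null p"
  then obtain w where w: "\<And>i. padic_Cauchy p (w i)" "\<And>i. \<forall>\<^sub>F k in sequentially. padic_abs p (w i k) \<le> 1"
      "(\<lambda>k. qform A (\<chi> i. w i k) - x k) \<in> padic_null p" by blast
  have "ring_qform (padic_field p) (padic_coeffs p A) (\<lambda>i. padic_class p (w i)) = padic_class p x"
    using w(3) by (simp add: ring_qform_padic[OF p w(1)] padic_class_eq_iff[OF p])
  moreover have "padic_class p (w i) \<in> padic_int p" for i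
    using w(2) padic_class_int_iff[OF p w(1)[of i]] by simp
  ultimately show "integrally_represents p A x"
    unfolding integrally_represents_def by (intro exI[of _ "\<lambda>i. padic_class p (w i)"]) simp
qed

lemma padic_universal_iff:
  assumes p: "prime p"
  shows "padic_universal p (padic_coeffs p A) \<longleftrightarrow>
    (\<forall>x. padic_Cauchy p x \<longrightarrow> (\<forall>\<^sub>F k in sequentially. padic_abs p (x k) \<le> 1) \<longrightarrow> x \<notin> padic_null p \<longrightarrow>
      integrally_represents p A x)"
proof -
  have 0: "padic_class p x = \<zero>\<^bsub>padic_field p\<^esub> \<longleftrightarrow> x \<in> padic_null p" for x
    by (simp add: padic_field_zero padic_class_eq_iff[OF p])
  have PI: "padic_int p = padic_class p ` {x. padic_Cauchy p x \<and> (\<forall>\<^sub>F k in sequentially. padic_abs p (x k) \<le> 1)}"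
  proof (intro equalityI subsetI)
    fix X assume X: "X \<in> padic_int p"
    then obtain x where x: "padic_Cauchy p x" "X = padic_class p x" by (auto simp: padic_int_def padic_field_carrier)
    then show "X \<in> padic_class p ` {x. padic_Cauchy p x \<and> (\<forall>\<^sub>F k in sequentially. padic_abs p (x k) \<le> 1)}"
      using X padic_class_int_iff[OF p x(1)] by auto
  qed (auto simp: padic_class_int_iff[OF p])
  define rep where "rep X \<longleftrightarrow> (\<exists>w. (\<forall>i. w i \<in> padic_int p) \<and> ring_qform (padic_field p) (padic_coeffs p A) w = X)" for X
  have "padic_universal p (padic_coeffs p A) \<longleftrightarrow> (\<forall>X\<in>padic_int p. X \<noteq> \<zero>\<^bsub>padic_field p\<^esub> \<longrightarrow> rep X)"
    by (auto simp: padic_universal_def rep_def)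
  also have "\<dots> \<longleftrightarrow> (\<forall>x\<in>{x. padic_Cauchy p x \<and> (\<forall>\<^sub>F k in sequentially. padic_abs p (x k) \<le> 1)}.
      padic_class p x \<noteq> \<zero>\<^bsub>padic_field p\<^esub> \<longrightarrow> rep (padic_class p x))"
    unfolding PI by simp
  finally show ?thesis by (simp add: 0 integrally_represents_def rep_def imp_conjL)
qed

text \<open>The representing sequences are frozen at one late index, and their coordinates are
  rounded to integers modulo \<open>p^K\<close>; this moves the value of the form by at most
  \<open>p^(-K)\<close>.\<close>

lemma integrally_represents_int:
  fixes A :: "int^'n^'n" and a :: int
  assumes p: "prime p" and r: "integrally_represents p A (\<lambda>k. of_int a)"
  shows "\<exists>v. int p ^ K dvd qform A v - a"
proof -
  obtain w where w: "\<And>i. \<forall>\<^sub>F k in sequentially. padic_abs p (w i k) \<le> 1"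
      "(\<lambda>k. qform A (\<chi> i. w i k) - of_int a) \<in> padic_null p"
    using r unfolding integrally_represents_iff[OF p] by blast
  have p1: "real p > 1" using prime_gt_1_nat[OF p] by simp
  define e where "e = 1 / real p ^ K"
  have e: "e > 0" "e \<le> 1" using p1 by (auto simp: e_def)
  have "\<forall>\<^sub>F k in sequentially. \<forall>i. padic_abs p (w i k) \<le> 1" using w(1) by (intro eventually_all_finite)
  moreover have "\<forall>\<^sub>F k in sequentially. padic_abs p (qform A (\<chi> i. w i k) - of_int a) < e"
    using w(2) e(1) unfolding padic_null_iff eventually_sequentially by blast
  ultimately have "\<forall>\<^sub>F k in sequentially. (\<forall>i. padic_abs p (w i k) \<le> 1) \<and> padic_abs p (qform A (\<chi> i. w i k) - of_int a) < e"
    by (rule eventually_conj)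
  then obtain k where k: "\<And>i. padic_abs p (w i k) \<le> 1" "padic_abs p (qform A (\<chi> i. w i k) - of_int a) < e"
    by (auto simp: eventually_sequentially)
  have "\<forall>i. \<exists>b::int. padic_abs p (w i k - of_int b) \<le> e"
    using padic_integral_approx[OF p k(1)] unfolding e_def by blast
  then obtain b where b: "\<And>i. padic_abs p (w i k - of_int (b i)) \<le> e" by metis
  define v where "v = (\<chi> i. b i)"
  have "padic_abs p (qform A (vec_of_int v) - qform A (\<chi> i. w i k)) \<le> e"
    using k(1) b e by (intro padic_abs_qform_diff_le[OF p]) (auto simp: v_def vec_of_int_def padic_abs_minus_commute[of p "of_int _"])
  then have "padic_abs p ((qform A (vec_of_int v) - qform A (\<chi> i. w i k)) + (qform A (\<chi> i. w i k) - of_int a)) \<le> e"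
    using k(2) by (intro padic_abs_add_le[OF p]) auto
  then have "padic_abs p (of_int (qform A v - a)) \<le> 1 / real p ^ K"
    by (simp add: qform_of_int e_def)
  then show ?thesis using padic_abs_of_int_le_iff[OF p] by blast
qed

lemma padic_integer_approximations:
  assumes p: "prime p" and x: "padic_Cauchy p x" and ev: "\<forall>\<^sub>F k in sequentially. padic_abs p (x k) \<le> 1"
  shows "\<exists>a::nat \<Rightarrow> int. \<forall>K. \<forall>\<^sub>F k in sequentially. padic_abs p (x k - of_int (a K)) \<le> 1 / real p ^ K"
proof -
  have p1: "real p > 1" using prime_gt_1_nat[OF p] by simp
  have "\<exists>a::int. \<forall>\<^sub>F k in sequentially. padic_abs p (x k - of_int a) \<le> 1 / real p ^ K" for K
  proof -
    have "0 < 1 / real p ^ K" using p1 by simp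
    then obtain N where N: "\<And>m k. m \<ge> N \<Longrightarrow> k \<ge> N \<Longrightarrow> padic_abs p (x m - x k) < 1 / real p ^ K"
      by (rule padic_CauchyD[OF x]) blast
    obtain N' where N': "\<And>k. k \<ge> N' \<Longrightarrow> padic_abs p (x k) \<le> 1" using ev by (auto simp: eventually_sequentially)
    define n where "n = max N N'"
    obtain a :: int where a: "padic_abs p (x n - of_int a) \<le> 1 / real p ^ K"
      using padic_integral_approx[OF p N'[of n]] by (auto simp: n_def)
    have "padic_abs p (x k - of_int a) \<le> 1 / real p ^ K" if "k \<ge> n" for k
    proof -
      have "padic_abs p ((x k - x n) + (x n - of_int a)) \<le> 1 / real p ^ K"
        using N[of k n] that a by (intro padic_abs_add_le[OF p]) (auto simp: n_def)
      then show ?thesis by simp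
    qed
    then show ?thesis by (auto simp: eventually_sequentially)
  qed
  then show ?thesis by metis
qed

text \<open>Koenig's lemma on the tree of residue classes: a class modulo \<open>q^k\<close> is
  \<open>good\<close> if it contains solutions of every precision, and one of its finitely many
  subclasses inherits this. The conclusion speaks of a solution \<open>u\<close> near
  \<open>w k\<close>, because \<open>F\<close> is not assumed to depend on residues only.\<close>

lemma compactness_mod_powers:
  fixes F :: "int^'n \<Rightarrow> nat \<Rightarrow> bool" and q :: int
  assumes q: "q > 0" and sol: "\<And>K. \<exists>w. F w K"
    and mono: "\<And>w K L. F w K \<Longrightarrow> L \<le> K \<Longrightarrow> F w L"
  shows "\<exists>w::nat \<Rightarrow> int^'n. \<forall>k. vec_dvd (q ^ k) (w (Suc k) - w k) \<and> (\<exists>u. vec_dvd (q ^ k) (u - w k) \<and> F u k)"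
proof -
  define good where "good k w \<longleftrightarrow> (\<forall>K. \<exists>u. vec_dvd (q ^ k) (u - w) \<and> F u K)" for k w
  have step: "\<exists>w'. good (Suc k) w' \<and> vec_dvd (q ^ k) (w' - w)" if g: "good k w" for k w
  proof (rule ccontr)
    assume no: "\<nexists>w'. good (Suc k) w' \<and> vec_dvd (q ^ k) (w' - w)"
    let ?B = "{v::int^'n. \<forall>i. v $ i \<in> {0..<q}}"
    have finB: "finite ?B"
    proof (rule ccontr)
      assume "infinite ?B"
      then have "card ?B = 0" by simp
      then show False using card_int_box[of q, where 'n = 'n] q by simp
    qed
    have "\<forall>b. \<exists>K. \<forall>u. vec_dvd (q ^ Suc k) (u - (w + q ^ k *s b)) \<longrightarrow> \<not> F u K"
    proof
      fix b
      have "vec_dvd (q ^ k) ((w + q ^ k *s b) - w)" by simp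
      then have "\<not> good (Suc k) (w + q ^ k *s b)" using no by blast
      then show "\<exists>K. \<forall>u. vec_dvd (q ^ Suc k) (u - (w + q ^ k *s b)) \<longrightarrow> \<not> F u K" unfolding good_def by blast
    qed
    then obtain Kb where Kb: "\<And>b u. vec_dvd (q ^ Suc k) (u - (w + q ^ k *s b)) \<Longrightarrow> \<not> F u (Kb b)" by metis
    \<comment> \<open>If no subclass were good, each would fail at some precision, and at the
      largest of these \<open>w\<close> itself would have no solution.\<close>
    define L where "L = Max (insert 0 (Kb ` ?B))"
    obtain u where u: "vec_dvd (q ^ k) (u - w)" "F u L" using g unfolding good_def by blast
    obtain c where c: "u - w = q ^ k *s c" using u(1) by (rule vec_dvdE)
    define b where "b = (\<chi> i. c $ i mod q)"
    have bB: "b \<in> ?B" using q by (simp add: b_def)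
    have "u - (w + q ^ k *s b) = q ^ Suc k *s (\<chi> i. c $ i div q)"
    proof (subst vec_eq_iff, intro allI)
      fix i
      define r d where "r = c $ i mod q" and "d = c $ i div q"
      have cr: "c $ i = r + q * d" by (simp add: r_def d_def)
      have "u $ i - w $ i = q ^ k * c $ i" using arg_cong[OF c, of "\<lambda>v. v $ i"] by simp
      then have "u $ i - w $ i = q ^ k * (r + q * d)" unfolding cr .
      then show "(u - (w + q ^ k *s b)) $ i = (q ^ Suc k *s (\<chi> i. c $ i div q)) $ i"
        by (simp add: b_def algebra_simps flip: r_def d_def)
    qed
    then have "vec_dvd (q ^ Suc k) (u - (w + q ^ k *s b))" by (simp only: vec_dvd_smult)
    then have "\<not> F u (Kb b)" by (rule Kb)
    moreover have "Kb b \<le> L" unfolding L_def using finB bB by (intro Max_ge) auto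
    ultimately show False using mono[OF u(2)] by blast
  qed
  have "good 0 0" unfolding good_def using sol by (auto simp: vec_dvd_def)
  then have "\<exists>w. \<forall>k. good k (w k) \<and> vec_dvd (q ^ k) (w (Suc k) - w k)"
    using step by (intro dependent_nat_choice) auto
  then obtain w where w: "\<And>k. good k (w k)" "\<And>k. vec_dvd (q ^ k) (w (Suc k) - w k)" by blast
  have "\<exists>u. vec_dvd (q ^ k) (u - w k) \<and> F u k" for k using w(1)[of k] unfolding good_def by blast
  then show ?thesis using w(2) by blast
qed

text \<open>The residues \<open>a K\<close> of the limit of \<open>x\<close> turn representation of
  \<open>c x\<close> into a tree of integer congruences, and the coherent branch is a vector of
  p-adic integers. The factor \<open>c\<close> is 1 for universality and \<open>p^(2 j)\<close> for
  the ADC property.\<close>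

lemma represents_padic_limit:
  fixes A :: "int^'n^'n"
  assumes p: "prime p" and rep: "\<And>a K. \<exists>w. int p ^ K dvd qform A w - c * a"
    and x: "padic_Cauchy p x" and ev: "\<forall>\<^sub>F k in sequentially. padic_abs p (x k) \<le> 1"
  shows "\<exists>w::nat \<Rightarrow> int^'n. (\<forall>i. padic_Cauchy p (\<lambda>k. of_int (w k $ i))) \<and>
    (\<lambda>k. of_int (qform A (w k)) - of_int c * x k) \<in> padic_null p"
proof -
  have ip: "int p > 0" using prime_gt_0_nat[OF p] by simp
  have p1: "real p > 1" using prime_gt_1_nat[OF p] by simp
  obtain a :: "nat \<Rightarrow> int" where a: "\<And>K. \<forall>\<^sub>F k in sequentially. padic_abs p (x k - of_int (a K)) \<le> 1 / real p ^ K"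
    using padic_integer_approximations[OF p x ev] by blast
  have mon: "1 / real p ^ K \<le> 1 / real p ^ L" if "L \<le> K" for K L
    using p1 that by (intro divide_left_mono power_increasing) auto
  have aK: "int p ^ L dvd a K - a L" if LK: "L \<le> K" for K L
  proof -
    have "\<forall>\<^sub>F k in sequentially. padic_abs p (x k - of_int (a K)) \<le> 1 / real p ^ K \<and> padic_abs p (x k - of_int (a L)) \<le> 1 / real p ^ L"
      by (intro eventually_conj a)
    then obtain k where k: "padic_abs p (x k - of_int (a K)) \<le> 1 / real p ^ K" "padic_abs p (x k - of_int (a L)) \<le> 1 / real p ^ L"
      by (auto simp: eventually_sequentially)
    have "padic_abs p ((x k - of_int (a L)) - (x k - of_int (a K))) \<le> 1 / real p ^ L"
      by (rule padic_abs_diff_le[OF p]) (use k mon[OF LK] in linarith)+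
    then have "padic_abs p (of_int (a K - a L)) \<le> 1 / real p ^ L" by simp
    then show ?thesis using padic_abs_of_int_le_iff[OF p] by blast
  qed
  define F where "F w K \<longleftrightarrow> int p ^ K dvd qform A w - c * a K" for w K
  have "\<exists>w::nat \<Rightarrow> int^'n. \<forall>k. vec_dvd (int p ^ k) (w (Suc k) - w k) \<and> (\<exists>u. vec_dvd (int p ^ k) (u - w k) \<and> F u k)"
  proof (rule compactness_mod_powers[OF ip])
    show "\<exists>w. F w K" for K unfolding F_def by (rule rep)
    fix w K L assume "F w K" and LK: "L \<le> K"
    then have "int p ^ L dvd qform A w - c * a K" unfolding F_def by (meson dvd_trans le_imp_power_dvd)
    moreover have "int p ^ L dvd c * (a K - a L)" using aK[OF LK] by simp
    ultimately have "int p ^ L dvd (qform A w - c * a K) + c * (a K - a L)" by (rule dvd_add)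
    then show "F w L" unfolding F_def by (simp add: algebra_simps)
  qed
  then obtain w :: "nat \<Rightarrow> int^'n" where w: "\<And>k. vec_dvd (int p ^ k) (w (Suc k) - w k)"
      "\<And>k. \<exists>u. vec_dvd (int p ^ k) (u - w k) \<and> F u k" by blast
  have far: "vec_dvd (int p ^ N) (w (N + k) - w N)" for N k
  proof (induction k)
    case (Suc k)
    have "vec_dvd (int p ^ N) (w (Suc (N + k)) - w (N + k))"
      using w(1)[of "N + k"] unfolding vec_dvd_def by (meson dvd_trans le_add1 le_imp_power_dvd)
    from vec_dvd_add[OF this Suc] show ?case by simp
  qed (simp add: vec_dvd_def)
  have C: "padic_Cauchy p (\<lambda>k. of_int (w k $ i))" for i
    unfolding padic_Cauchy_def
  proof (intro allI impI)
    fix e :: real assume "e > 0"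
    then obtain N where N: "1 / real p ^ N < e" using padic_small_power[OF p] by blast
    have "padic_abs p (of_int (w m $ i) - of_int (w k $ i)) < e" if "m \<ge> N" "k \<ge> N" for m k
    proof -
      have "int p ^ N dvd (w m - w N) $ i" "int p ^ N dvd (w k - w N) $ i"
        using far[of N "m - N"] far[of N "k - N"] that by (auto simp: vec_dvd_def)
      then have "int p ^ N dvd (w m - w N) $ i - (w k - w N) $ i" by (rule dvd_diff)
      then have "padic_abs p (of_int (w m $ i - w k $ i)) \<le> 1 / real p ^ N"
        by (simp only: padic_abs_of_int_le_iff[OF p]) simp
      then show ?thesis using N by simp
    qed
    then show "\<exists>N. \<forall>m\<ge>N. \<forall>k\<ge>N. padic_abs p (of_int (w m $ i) - of_int (w k $ i)) < e" by blast
  qed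
  have "(\<lambda>k. of_int (qform A (w k)) - of_int c * x k) \<in> padic_null p"
    unfolding padic_null_iff
  proof (intro allI impI)
    fix e :: real assume "e > 0"
    then obtain K where K: "1 / real p ^ K < e" using padic_small_power[OF p] by blast
    obtain N where N: "\<And>k. k \<ge> N \<Longrightarrow> padic_abs p (x k - of_int (a K)) \<le> 1 / real p ^ K"
      using a[of K] by (auto simp: eventually_sequentially)
    have "padic_abs p (of_int (qform A (w k)) - of_int c * x k) < e" if k: "k \<ge> max N K" for k
    proof -
      obtain u where u: "vec_dvd (int p ^ k) (u - w k)" "F u k" using w(2) by blast
      have "int p ^ k dvd qform A (w k) - c * a k"
      proof -
        obtain z where "u - w k = int p ^ k *s z" using u(1) by (rule vec_dvdE)
        then have uz: "u = w k + int p ^ k *s z" by (simp add: algebra_simps)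
        have "qform A (w k) - c * a k = (qform A u - c * a k) - int p ^ k * (qform A z * int p ^ k + qpolar A (w k) z)"
          unfolding uz qform_line by (simp add: algebra_simps power2_eq_square)
        then show ?thesis using u(2) unfolding F_def by (simp only: dvd_diff dvd_triv_left)
      qed
      moreover have "int p ^ K dvd int p ^ k" using k by (intro le_imp_power_dvd) simp
      ultimately have "int p ^ K dvd qform A (w k) - c * a k" by (rule dvd_trans[rotated])
      moreover have "int p ^ K dvd c * (a k - a K)" using aK[of K k] k by simp
      ultimately have "int p ^ K dvd (qform A (w k) - c * a k) + c * (a k - a K)" by (rule dvd_add)
      then have "padic_abs p (of_int ((qform A (w k) - c * a k) + c * (a k - a K))) \<le> 1 / real p ^ K"
        by (simp only: padic_abs_of_int_le_iff[OF p])
      moreover have "padic_abs p (of_int c * (x k - of_int (a K))) \<le> 1 / real p ^ K"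
      proof -
        have "padic_abs p (of_int c) * padic_abs p (x k - of_int (a K)) \<le> 1 * (1 / real p ^ K)"
          using N[of k] k padic_abs_of_int_le_1[OF p] by (intro mult_mono) auto
        then show ?thesis by (simp add: padic_abs_mult[OF p])
      qed
      ultimately have "padic_abs p (of_int ((qform A (w k) - c * a k) + c * (a k - a K)) - of_int c * (x k - of_int (a K))) \<le> 1 / real p ^ K"
        by (rule padic_abs_diff_le[OF p])
      moreover have "of_int ((qform A (w k) - c * a k) + c * (a k - a K)) - of_int c * (x k - of_int (a K)) =
          of_int (qform A (w k)) - of_int c * x k" by (simp add: algebra_simps)
      ultimately have "padic_abs p (of_int (qform A (w k)) - of_int c * x k) \<le> 1 / real p ^ K" by (simp only:)
      then show ?thesis using K by simp
    qed
    then show "\<exists>N. \<forall>k\<ge>N. padic_abs p (of_int (qform A (w k)) - of_int c * x k) < e" by blast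
  qed
  then show ?thesis using C by blast
qed

lemma qform_vec_of_int: "qform A (\<chi> i. of_int (v $ i)) = of_int (qform A v)"
  using qform_of_int[of A v] by (simp add: vec_of_int_def)

lemma padic_universalI:
  fixes A :: "int^'n^'n"
  assumes p: "prime p" and rep: "\<And>a K. \<exists>w. int p ^ K dvd qform A w - a"
  shows "padic_universal p (padic_coeffs p A)"
  unfolding padic_universal_iff[OF p] integrally_represents_iff[OF p]
proof (intro allI impI)
  fix x assume x: "padic_Cauchy p x" "\<forall>\<^sub>F k in sequentially. padic_abs p (x k) \<le> 1"
  obtain w :: "nat \<Rightarrow> int^'n" where w: "\<And>i. padic_Cauchy p (\<lambda>k. of_int (w k $ i))"
      "(\<lambda>k. of_int (qform A (w k)) - of_int 1 * x k) \<in> padic_null p"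
    using represents_padic_limit[OF p, of A 1 x] rep x by auto
  show "\<exists>w. (\<forall>i. padic_Cauchy p (w i) \<and> (\<forall>\<^sub>F k in sequentially. padic_abs p (w i k) \<le> 1)) \<and>
      (\<lambda>k. qform A (\<chi> i. w i k) - x k) \<in> padic_null p"
    by (intro exI[of _ "\<lambda>i k. of_int (w k $ i)"])
       (use w padic_abs_of_int_le_1[OF p] in \<open>simp add: qform_vec_of_int\<close>)
qed

lemma padic_universalD:
  fixes A :: "int^'n^'n" and a :: int
  assumes p: "prime p" and u: "padic_universal p (padic_coeffs p A)"
  shows "\<exists>w. int p ^ K dvd qform A w - a"
proof (cases "a = 0")
  case True
  then have "int p ^ K dvd qform A 0 - a" by simp
  then show ?thesis by blast
next
  case False
  have "(\<lambda>k. of_int a) \<notin> padic_null p"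
  proof
    assume "(\<lambda>k. of_int a) \<in> padic_null p"
    then have "(\<lambda>k::nat. padic_abs p (of_int a)) \<longlonglongrightarrow> 0" by (simp add: padic_null_def)
    then have "padic_abs p (of_int a) = 0" by (simp add: LIMSEQ_const_iff)
    then show False using False prime_gt_0_nat[OF p] by (simp add: padic_abs_def)
  qed
  then have "integrally_represents p A (\<lambda>k. of_int a)"
    using u padic_abs_of_int_le_1[OF p] unfolding padic_universal_iff[OF p] by simp
  then show ?thesis by (rule integrally_represents_int[OF p])
qed

text \<open>Universality concerns nonzero elements; zero is the value at the zero vector.\<close>

lemma padic_universal_imp_ADC:
  fixes A :: "int^'n^'n"
  assumes p: "prime p" and u: "padic_universal p (padic_coeffs p A)"
  shows "padic_ADC p (padic_coeffs p A)"
  unfolding padic_ADC_def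
proof (intro ballI impI)
  fix x assume x: "x \<in> padic_int p"
  show "\<exists>w. (\<forall>i. w i \<in> padic_int p) \<and> ring_qform (padic_field p) (padic_coeffs p A) w = x"
  proof (cases "x = \<zero>\<^bsub>padic_field p\<^esub>")
    case True
    have "integrally_represents p A (\<lambda>k. 0)"
      unfolding integrally_represents_iff[OF p]
    proof (intro exI[of _ "\<lambda>i k. 0"] conjI allI)
      have "(\<chi> i::'n. 0) = (0 :: rat^'n)" by (simp add: vec_eq_iff)
      then show "(\<lambda>k. qform A (\<chi> i. 0) - 0) \<in> padic_null p" by (simp add: padic_null_def)
    qed simp_all
    then show ?thesis using True by (simp add: integrally_represents_def padic_field_zero)
  next
    case False
    then show ?thesis using u x unfolding padic_universal_def by blast
  qed
qed

text \<open>An integral vector representing \<open>p^(2 j) a\<close>, divided by \<open>p^j\<close>,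
  represents \<open>a\<close> over the p-adic field, and the ADC property makes it integral.\<close>

lemma padic_ADC_represents:
  fixes A :: "int^'n^'n" and a :: int
  assumes p: "prime p" and adc: "padic_ADC p (padic_coeffs p A)"
    and rep: "\<And>a K. \<exists>w. int p ^ K dvd qform A w - int p ^ (2 * j) * a"
  shows "\<exists>w. int p ^ K dvd qform A w - a"
proof -
  have p0: "(of_nat p :: rat) \<noteq> 0" using prime_gt_0_nat[OF p] by simp
  have ev: "\<forall>\<^sub>F k in sequentially. padic_abs p (of_int a) \<le> 1" using padic_abs_of_int_le_1[OF p] by simp
  obtain w :: "nat \<Rightarrow> int^'n" where w: "\<And>i. padic_Cauchy p (\<lambda>k. of_int (w k $ i))"
      "(\<lambda>k. of_int (qform A (w k)) - of_int (int p ^ (2 * j)) * of_int a) \<in> padic_null p"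
    using represents_padic_limit[OF p, of A "int p ^ (2 * j)" "\<lambda>k. of_int a"] rep ev by auto
  define s :: rat where "s = 1 / of_nat p ^ j"
  define v where "v i = (\<lambda>k. s * of_int (w k $ i))" for i
  have v: "padic_Cauchy p (v i)" for i unfolding v_def by (intro padic_Cauchy_mult[OF p] w padic_Cauchy_const)
  have "(\<lambda>k. s\<^sup>2 * (of_int (qform A (w k)) - of_int (int p ^ (2 * j)) * of_int a)) \<in> padic_null p"
    by (intro padic_null_mult[OF p] w(2) padic_Cauchy_const)
  moreover have "s\<^sup>2 * (of_int (qform A (w k)) - of_int (int p ^ (2 * j)) * of_int a) = qform A (\<chi> i. v i k) - of_int a" for k
  proof -
    have "(\<chi> i. v i k) = s *s vec_of_int (w k)" by (simp add: v_def vec_of_int_def vec_eq_iff)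
    then have "qform A (\<chi> i. v i k) = s\<^sup>2 * of_int (qform A (w k))" by (simp add: qform_scale qform_of_int)
    moreover have "s\<^sup>2 * of_int (int p ^ (2 * j)) = 1"
      using p0 by (simp add: s_def power_divide mult.commute[of 2] power_mult)
    ultimately show ?thesis by (simp add: right_diff_distrib flip: mult.assoc)
  qed
  ultimately have "ring_qform (padic_field p) (padic_coeffs p A) (\<lambda>i. padic_class p (v i)) = padic_class p (\<lambda>k. of_int a)"
    by (simp add: ring_qform_padic[OF p v] padic_class_eq_iff[OF p])
  moreover have "\<forall>i. padic_class p (v i) \<in> carrier (padic_field p)" using v by (auto simp: padic_field_carrier)
  ultimately have "\<exists>v. (\<forall>i. v i \<in> carrier (padic_field p)) \<and>
      ring_qform (padic_field p) (padic_coeffs p A) v = padic_class p (\<lambda>k. of_int a)"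
    by (intro exI[of _ "\<lambda>i. padic_class p (v i)"] conjI)
  moreover have "padic_class p (\<lambda>k. of_int a) \<in> padic_int p"
    using ev by (simp add: padic_class_int_iff[OF p])
  ultimately have "integrally_represents p A (\<lambda>k. of_int a)"
    using adc unfolding padic_ADC_def integrally_represents_def by simp
  then show ?thesis by (rule integrally_represents_int[OF p])
qed

section \<open>Comparison of the conditions\<close>

lemma qform_uminus: "qform (- A) v = - qform A v"
  by (simp add: qform_def sum_negf)

lemma qform_nondegenerate_uminus: "qform_nondegenerate A \<Longrightarrow> qform_nondegenerate (- A)"
  unfolding qform_nondegenerate_def
proof (intro allI impI)
  fix v :: "rat^'a"
  assume nd: "\<forall>v::rat^'a. (\<forall>w. qform A (v + w) - qform A v - qform A w = 0) \<longrightarrow> v = 0"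
    and v: "\<forall>w. qform (- A) (v + w) - qform (- A) v - qform (- A) w = 0"
  have "qform A (v + w) - qform A v - qform A w = 0" for w
    using spec[OF v, of w] by (simp add: qform_uminus)
  then show "v = 0" using nd by blast
qed

lemma represented_uminus: "represented (- A) = uminus ` represented A"
proof -
  have "range (qform (- A) :: int^'a \<Rightarrow> int) = uminus ` range (qform A)"
    by (auto simp: qform_uminus image_image)
  then show ?thesis by (auto simp: represented_def)
qed

lemma nondegenerate_nonzero_value:
  fixes A :: "int^'n^'n"
  assumes "qform_nondegenerate A"
  shows "\<exists>e::int^'n. qform A e \<noteq> 0"
proof (rule ccontr)
  assume "\<nexists>e::int^'n. qform A e \<noteq> 0"
  then have "qpolar A (axis undefined 1) g = 0" for g :: "int^'n" by (simp add: qpolar_eq_diff)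
  then have "axis undefined 1 = (0 :: int^'n)" by (rule nondegenerate_radical[OF assms])
  then show False by (simp add: axis_eq_0_iff)
qed

section \<open>One-sided densities\<close>

lemma density_positive:
  fixes A :: "int^'n^'n"
  assumes nd: "qform_nondegenerate A" and card: "CARD('n) \<ge> 3"
    and U: "\<And>m a :: int. m > 0 \<Longrightarrow> \<exists>v. m dvd qform A v - a"
    and e1: "qform A (e1 :: int^'n) > 0"
  shows "(\<lambda>N. real (card (represented A \<inter> {1..int N})) / real N) \<longlonglongrightarrow> 1"
proof (rule LIMSEQ_I)
  fix r :: real assume r: "r > 0"
  let ?S = "\<lambda>N. {n\<in>{1..int N}. n \<notin> range (qform A :: int^'n \<Rightarrow> int)}"
  have "\<forall>\<^sub>F N in sequentially. real (card (?S N)) \<le> r / 2 * real N"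
    using r U by (intro nonrepresented_sparse[OF nd card _ e1]) auto
  then obtain N0 where N0: "\<And>N. N \<ge> N0 \<Longrightarrow> real (card (?S N)) \<le> r / 2 * real N"
    by (auto simp: eventually_sequentially)
  have "norm (real (card (represented A \<inter> {1..int N})) / real N - 1) < r" if N: "N \<ge> max N0 1" for N
  proof -
    have eq: "represented A \<inter> {1..int N} = {1..int N} - ?S N" by (auto simp: represented_def)
    have finS: "finite (?S N)" by (rule finite_subset[of _ "{1..int N}"]) auto
    have "card ({1..int N} - ?S N) = card {1..int N} - card (?S N)"
      by (rule card_Diff_subset[OF finS]) auto
    then have "card (represented A \<inter> {1..int N}) = N - card (?S N)" unfolding eq by simp
    moreover have "card (?S N) \<le> card {1..int N}" by (rule card_mono) auto
    then have "card (?S N) \<le> N" by simp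
    ultimately have c: "real (card (represented A \<inter> {1..int N})) = real N - real (card (?S N))"
      by (simp only: of_nat_diff)
    have "real (card (represented A \<inter> {1..int N})) / real N - 1 = - (real (card (?S N)) / real N)"
      unfolding c using N by (simp add: diff_divide_distrib)
    then have "norm (real (card (represented A \<inter> {1..int N})) / real N - 1) = real (card (?S N)) / real N" by simp
    also have "\<dots> \<le> r / 2" using N0[of N] N by (simp add: field_simps)
    finally show ?thesis using r by simp
  qed
  then show "\<exists>no. \<forall>N\<ge>no. norm (real (card (represented A \<inter> {1..int N})) / real N - 1) < r" by blast
qed

lemma density_negative:
  fixes A :: "int^'n^'n"
  assumes nd: "qform_nondegenerate A" and card: "CARD('n) \<ge> 3"
    and U: "\<And>m a :: int. m > 0 \<Longrightarrow> \<exists>v. m dvd qform A v - a"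
    and e1: "qform A (e1 :: int^'n) < 0"
  shows "(\<lambda>N. real (card (represented A \<inter> {- int N..-1})) / real N) \<longlonglongrightarrow> 1"
proof -
  have U': "\<exists>v. m dvd qform (- A) v - a" if m: "m > 0" for m a :: int
  proof -
    obtain v where "m dvd qform A v - (- a)" using U[OF m, of "- a"] by blast
    then have "m dvd - (qform A v - (- a))" by (simp only: dvd_minus_iff)
    then have "m dvd qform (- A) v - a" by (simp add: qform_uminus)
    then show ?thesis by blast
  qed
  have e1': "qform (- A) e1 > 0" using e1 by (simp add: qform_uminus)
  have "(\<lambda>N. real (card (represented (- A) \<inter> {1..int N})) / real N) \<longlonglongrightarrow> 1"
    by (rule density_positive[OF qform_nondegenerate_uminus[OF nd] card U' e1'])
  moreover have "card (represented (- A) \<inter> {1..int N}) = card (represented A \<inter> {- int N..-1})" for N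
  proof -
    have "represented (- A) \<inter> {1..int N} = uminus ` (represented A \<inter> {- int N..-1})"
      by (force simp: represented_uminus)
    then show ?thesis by (simp add: card_image)
  qed
  ultimately show ?thesis by simp
qed

lemma card_represented_split:
  "card (represented A \<inter> {- int N..int N}) = card (represented A \<inter> {- int N..-1}) + card (represented A \<inter> {1..int N})"
proof -
  have "0 \<notin> represented A" by (simp add: represented_def)
  then have "x \<le> - 1 \<or> 1 \<le> x" if "x \<in> represented A" for x using that by (cases "x = 0") auto
  then have "represented A \<inter> {- int N..int N} = (represented A \<inter> {- int N..-1}) \<union> (represented A \<inter> {1..int N})"
    by force
  then show ?thesis by (simp add: card_Un_disjoint disjoint_iff)
qed

text \<open>Each sign that occurs among the values is represented with full density on its side; the
  indefinite density is the mean of the two one-sided ones.\<close>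

theorem density_one:
  fixes A :: "int^'n^'n"
  assumes nd: "qform_nondegenerate A" and card: "CARD('n) \<ge> 3"
    and U: "\<And>m a :: int. m > 0 \<Longrightarrow> \<exists>v. m dvd qform A v - a"
  shows "has_density (represented A) 1"
proof -
  have pos: "(\<lambda>N. real (card (represented A \<inter> {1..int N})) / real N) \<longlonglongrightarrow> 1"
    if np: "\<not> negative_set (represented A)"
  proof -
    obtain x where x: "x \<in> represented A" "x > 0" using np by (auto simp: negative_set_def)
    then obtain e :: "int^'n" where "x = qform A e" by (auto simp: represented_def)
    then have "qform A e > 0" using x by simp
    from density_positive[OF nd card _ this] show ?thesis using U by blast
  qed
  have neg: "(\<lambda>N. real (card (represented A \<inter> {- int N..-1})) / real N) \<longlonglongrightarrow> 1"
    if np: "\<not> positive_set (represented A)"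
  proof -
    obtain x where x: "x \<in> represented A" "x < 0" using np by (auto simp: positive_set_def)
    then obtain e :: "int^'n" where "x = qform A e" by (auto simp: represented_def)
    then have "qform A e < 0" using x by simp
    from density_negative[OF nd card _ this] show ?thesis using U by blast
  qed
  obtain e :: "int^'n" where "qform A e \<noteq> 0" using nondegenerate_nonzero_value[OF nd] by blast
  then have e: "qform A e \<in> represented A" "qform A e \<noteq> 0" by (auto simp: represented_def)
  have "(\<lambda>N. real (card (represented A \<inter> {- int N..int N})) / (2 * real N)) \<longlonglongrightarrow> 1"
    if "\<not> positive_set (represented A)" "\<not> negative_set (represented A)"
  proof -
    have "(\<lambda>N. (real (card (represented A \<inter> {- int N..-1})) / real N + real (card (represented A \<inter> {1..int N})) / real N) / 2) \<longlonglongrightarrow> (1 + 1) / 2"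
      by (intro tendsto_intros pos neg that) simp
    then show ?thesis by (simp add: card_represented_split add_divide_distrib mult.commute)
  qed
  moreover have "\<not> negative_set (represented A)" if "positive_set (represented A)"
    using that e unfolding positive_set_def negative_set_def by force
  ultimately show ?thesis unfolding has_density_def using pos neg by auto
qed

lemma card_residue_class_ge:
  fixes m a :: int
  assumes "m > 0"
  shows "k \<le> card {n\<in>{1..m * int k}. m dvd n - a}"
proof -
  \<comment> \<open>\<open>(a - 1) mod m + 1\<close> is the representative of \<open>a\<close>
    between 1 and \<open>m\<close>; shifting it gives one element in each of the \<open>k\<close>
    blocks of length \<open>m\<close>.\<close>
  let ?g = "\<lambda>j::nat. (a - 1) mod m + 1 + m * int j"
  have "inj_on ?g {..<k}" using assms by (auto intro!: inj_onI)
  moreover have "?g ` {..<k} \<subseteq> {n\<in>{1..m * int k}. m dvd n - a}"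
  proof
    fix n assume "n \<in> ?g ` {..<k}"
    then obtain j where j: "j < k" "n = ?g j" by blast
    have r: "0 \<le> (a - 1) mod m" "(a - 1) mod m < m" using assms by auto
    have "m * (int j + 1) \<le> m * int k" using j(1) assms by (intro mult_left_mono) auto
    then have "n \<le> m * int k" using j(2) r by (simp add: algebra_simps)
    moreover have "1 \<le> n" using j(2) r assms by simp
    moreover have "m dvd n - a"
    proof -
      have "n - a = m * int j - m * ((a - 1) div m)"
        using j(2) minus_mod_eq_mult_div[of "a - 1" m] by simp
      then show ?thesis by simp
    qed
    ultimately show "n \<in> {n\<in>{1..m * int k}. m dvd n - a}" by simp
  qed
  moreover have "finite {n\<in>{1..m * int k}. m dvd n - a}"
    by (rule finite_subset[of _ "{1..m * int k}"]) auto
  ultimately have "card {..<k} \<le> card {n\<in>{1..m * int k}. m dvd n - a}"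
    by (rule card_inj_on_le)
  then show ?thesis by simp
qed

lemma card_avoiding_class_le:
  fixes m a :: int and S :: "int set"
  assumes m: "m > 0" and S: "\<And>n. n \<in> S \<Longrightarrow> \<not> m dvd n - a"
  shows "card (S \<inter> {1..m * int k}) + k \<le> nat m * k"
proof -
  have fin: "finite {n\<in>{1..m * int k}. m dvd n - a}" by (rule finite_subset[of _ "{1..m * int k}"]) auto
  have "card (S \<inter> {1..m * int k}) + card {n\<in>{1..m * int k}. m dvd n - a} =
      card ((S \<inter> {1..m * int k}) \<union> {n\<in>{1..m * int k}. m dvd n - a})"
    using S fin by (intro card_Un_disjoint[symmetric]) auto
  also have "\<dots> \<le> card {1..m * int k}" by (intro card_mono) auto
  also have "\<dots> = nat m * k" using m by (simp add: nat_mult_distrib)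
  finally show ?thesis using card_residue_class_ge[OF m, of k a] by linarith
qed

text \<open>A missed class removes one of every \<open>m\<close> integers on each side of 0, on the
  negative side as the class of \<open>- a\<close> after reflection. Along multiples of
  \<open>m\<close> the proportion is thus at most \<open>1 - 1/m\<close> under any of the three
  normalisations.\<close>

theorem density_one_represents:
  fixes A :: "int^'n^'n" and m a :: int
  assumes d: "has_density (represented A) 1" and m: "m > 0"
  shows "\<exists>v. m dvd qform A v - a"
proof (rule ccontr)
  assume "\<nexists>v. m dvd qform A v - a"
  then have no: "\<not> m dvd n - a" if "n \<in> represented A" for n using that by (auto simp: represented_def)
  have no': "\<not> m dvd n - (- a)" if "n \<in> uminus ` represented A" for n
  proof
    assume "m dvd n - (- a)"
    moreover obtain n' where n': "n = - n'" "n' \<in> represented A" using \<open>n \<in> uminus ` represented A\<close> by blast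
    ultimately have "m dvd - (n' - a)" by simp
    then have "m dvd n' - a" by (simp only: dvd_minus_iff)
    then show False using no[OF n'(2)] by blast
  qed
  define M where "M = nat m"
  have M: "int M = m" "M > 0" using m by (auto simp: M_def)
  have b1: "card (represented A \<inter> {1..int (M * k)}) + k \<le> M * k" for k
    using card_avoiding_class_le[of m "represented A" a k] no m by (simp add: M_def)
  have b2: "card (represented A \<inter> {- int (M * k)..-1}) + k \<le> M * k" for k
  proof -
    have "uminus ` represented A \<inter> {1..int (M * k)} = uminus ` (represented A \<inter> {- int (M * k)..-1})" by force
    then have "card (uminus ` represented A \<inter> {1..int (M * k)}) = card (represented A \<inter> {- int (M * k)..-1})"
      by (simp add: card_image)
    moreover have "card (uminus ` represented A \<inter> {1..int (M * k)}) + k \<le> M * k"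
      using card_avoiding_class_le[of m "uminus ` represented A" "- a" k] no' m by (simp add: M_def)
    ultimately show ?thesis by simp
  qed
  \<comment> \<open>Only whole blocks of length \<open>M\<close> are counted, and
    \<open>Suc k\<close> keeps the denominator from vanishing.\<close>
  have sub: "filterlim (\<lambda>k. M * Suc k) sequentially sequentially"
    using M by (intro filterlim_subseq strict_monoI) auto
  have bound: "x \<le> 1 - 1 / real M" if x: "(\<lambda>N. f N) \<longlonglongrightarrow> x" and f: "\<And>k. f (M * Suc k) \<le> 1 - 1 / real M"
    for f :: "nat \<Rightarrow> real" and x
  proof (rule tendsto_upperbound)
    show "(\<lambda>k. f (M * Suc k)) \<longlonglongrightarrow> x" by (rule filterlim_compose[OF x sub])
  qed (use f in auto)
  have frac: "real c / real (M * Suc k) \<le> 1 - 1 / real M" if "c + Suc k \<le> M * Suc k" for c k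
  proof -
    have "real c + real (Suc k) \<le> real (M * Suc k)" using that by (metis of_nat_add of_nat_le_iff)
    then have "real c / real (M * Suc k) \<le> (real (M * Suc k) - real (Suc k)) / real (M * Suc k)"
      by (intro divide_right_mono) auto
    also have "\<dots> = 1 - 1 / real M"
    proof -
      have "(x * y - y) / (x * y) = 1 - 1 / x" if "x > 0" "y > 0" for x y :: real
        using that by (simp add: field_simps)
      then show ?thesis using M unfolding of_nat_mult by simp
    qed
    finally show ?thesis .
  qed
  have f1: "real (card (represented A \<inter> {1..int (M * Suc k)})) / real (M * Suc k) \<le> 1 - 1 / real M" for k
    by (rule frac[OF b1])
  have f2: "real (card (represented A \<inter> {- int (M * Suc k)..-1})) / real (M * Suc k) \<le> 1 - 1 / real M" for k
    by (rule frac[OF b2])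
  have f3: "real (card (represented A \<inter> {- int (M * Suc k)..int (M * Suc k)})) / (2 * real (M * Suc k)) \<le> 1 - 1 / real M" for k
  proof -
    have "real (card (represented A \<inter> {- int (M * Suc k)..int (M * Suc k)})) / (2 * real (M * Suc k)) =
      (real (card (represented A \<inter> {- int (M * Suc k)..-1})) / real (M * Suc k) + real (card (represented A \<inter> {1..int (M * Suc k)})) / real (M * Suc k)) / 2"
      unfolding card_represented_split of_nat_add by (simp only: add_divide_distrib divide_divide_eq_left mult.commute)
    moreover have "(u + v) / 2 \<le> c" if "u \<le> c" "v \<le> c" for u v c :: real using that by simp
    ultimately show ?thesis using f1[of k] f2[of k] by (simp only:)
  qed
  have "1 \<le> 1 - 1 / real M"
  proof -
    consider (pos) "(\<lambda>N. real (card (represented A \<inter> {1..int N})) / real N) \<longlonglongrightarrow> 1"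
      | (neg) "(\<lambda>N. real (card (represented A \<inter> {- int N..-1})) / real N) \<longlonglongrightarrow> 1"
      | (indef) "(\<lambda>N. real (card (represented A \<inter> {- int N..int N})) / (2 * real N)) \<longlonglongrightarrow> 1"
      using d unfolding has_density_def by (auto split: if_splits)
    then show ?thesis
    proof cases
      case pos show ?thesis by (rule bound[OF pos]) (rule f1)
    next
      case neg show ?thesis by (rule bound[OF neg]) (rule f2)
    next
      case indef show ?thesis by (rule bound[OF indef]) (rule f3)
    qed
  qed
  then show False using M by simp
qed

lemma isotropic_integral:
  fixes A :: "int^'n^'n"
  assumes "qform_isotropic A"
  shows "\<exists>e::int^'n. e \<noteq> 0 \<and> qform A e = 0"
proof -
  obtain v :: "rat^'n" where v: "v \<noteq> 0" "qform A v = 0" using assms by (auto simp: qform_isotropic_def)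
  define d where "d i = snd (quotient_of (v $ i))" for i
  define D where "D = (\<Prod>i\<in>UNIV. d i)"
  have d: "d i > 0" for i unfolding d_def by (metis quotient_of_denom_pos prod.collapse)
  have D: "D > 0" unfolding D_def using d by (intro prod_pos) auto
  have "\<exists>z. of_int D * v $ i = of_int z" for i
  proof -
    obtain x where x: "v $ i = of_int x / of_int (d i)"
      unfolding d_def by (metis quotient_of_div prod.collapse)
    define P where "P = (\<Prod>j\<in>UNIV - {i}. d j)"
    have "D = d i * P" unfolding D_def P_def by (rule prod.remove) auto
    then have "of_int D * v $ i = of_int (P * x)" using d[of i] by (simp add: x)
    then show ?thesis by blast
  qed
  then obtain z where z: "\<And>i. of_int D * v $ i = of_int (z i)" by metis
  define e where "e = (\<chi> i. z i)"
  have e: "vec_of_int e = of_int D *s v" by (simp add: e_def vec_of_int_def vec_eq_iff z)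
  have "of_int (qform A e) = (0 :: rat)" unfolding qform_of_int[symmetric] e qform_scale v(2) by simp
  then have "qform A e = 0" by simp
  moreover have "e \<noteq> 0"
  proof
    assume "e = 0"
    then have "of_int D *s v = 0" using e by (simp add: vec_of_int_def vec_eq_iff)
    then show False using v(1) D by simp
  qed
  ultimately show ?thesis by blast
qed

theorem theorem1p11:
  fixes A :: "int^'n^'n"
  assumes "CARD('n) \<ge> 3"
    and "qform_nondegenerate A"
    and "CARD('n) = 3 \<Longrightarrow> qform_isotropic A"
  shows "((locally_universal A \<longleftrightarrow> locally_ADC A) \<and>
          (locally_ADC A \<longleftrightarrow> has_density (represented A) 1)) \<and>
         (qform_maximal A \<longrightarrow> has_density (represented A) 1)"
proof -
  have dim: "CARD('n) \<ge> 4 \<or> (\<exists>e::int^'n. e \<noteq> 0 \<and> qform A e = 0)"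
    using assms(1,3) isotropic_integral[of A] by (cases "CARD('n) = 3") auto
  \<comment> \<open>Surjectivity modulo prime powers, stated for natural primes to match the p-adic
    definitions; \<open>Ui\<close> restates it for prime integers.\<close>
  define U where "U \<longleftrightarrow> (\<forall>p K a. prime (p::nat) \<longrightarrow> (\<exists>v. int p ^ K dvd qform A v - a))"
  have Ui: "\<exists>v. p ^ K dvd qform A v - a" if u: U and pr: "prime p" for p a :: int and K
  proof -
    have p: "prime (nat p)" "int (nat p) = p" using pr by (auto simp: prime_ge_0_int)
    from u p(1) have "\<exists>v. int (nat p) ^ K dvd qform A v - a" unfolding U_def by blast
    then show ?thesis unfolding p(2) .
  qed
  have dens: "has_density (represented A) 1" if u: U
  proof (rule density_one[OF assms(2,1)])
    fix m a :: int assume m: "m > 0"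
    show "\<exists>v. m dvd qform A v - a" by (rule represents_all_moduli[OF Ui[OF u] m])
  qed
  have dens': U if d: "has_density (represented A) 1"
    unfolding U_def
  proof (intro allI impI)
    fix p :: nat and K :: nat and a :: int assume "prime p"
    then show "\<exists>v. int p ^ K dvd qform A v - a"
      by (intro density_one_represents[OF d]) (simp add: prime_gt_0_nat)
  qed
  have univ: "locally_universal A \<longleftrightarrow> U"
  proof
    assume "locally_universal A"
    then show U unfolding U_def locally_universal_def by (auto intro: padic_universalD)
  next
    assume U
    then show "locally_universal A" unfolding U_def locally_universal_def
      by (intro allI impI padic_universalI) simp_all
  qed
  have adc: U if l: "locally_ADC A"
    unfolding U_def
  proof (intro allI impI)
    fix p :: nat and K :: nat and a :: int assume p: "prime p"
    then have ip: "prime (int p)" by simp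
    from represents_up_to_squares[OF ip nondegenerate_det_gram[OF assms(2)] dim]
    obtain j where j: "\<forall>a K. \<exists>w. int p ^ K dvd qform A w - int p ^ (2 * j) * a" ..
    have "padic_ADC p (padic_coeffs p A)" using l p unfolding locally_ADC_def by blast
    then show "\<exists>v. int p ^ K dvd qform A v - a"
      by (rule padic_ADC_represents[OF p]) (rule j[rule_format])
  qed
  have adc': "locally_ADC A" if "locally_universal A"
    using that unfolding locally_universal_def locally_ADC_def by (auto intro: padic_universal_imp_ADC)
  have max: U if m: "qform_maximal A"
    unfolding U_def
  proof (intro allI impI)
    fix p :: nat and K :: nat and a :: int assume "prime p"
    then have p: "prime (int p)" by simp
    show "\<exists>v. int p ^ K dvd qform A v - a"
    proof (rule no_enlarging_represents[OF p])
      show "\<not> enlarging (int p) A e" for e by (rule maximal_no_enlarging[OF m p])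
      show "CARD('n) \<ge> 4 \<or> (\<exists>e. \<not> vec_dvd (int p) e \<and> qform A e = 0)"
        using dim
      proof
        assume "\<exists>e::int^'n. e \<noteq> 0 \<and> qform A e = 0"
        then obtain e :: "int^'n" where e: "e \<noteq> 0" "qform A e = 0" by blast
        obtain e' k where "e = k *s e'" "k \<noteq> 0" "\<not> vec_dvd (int p) e'"
          using primitive_multiple[OF prime_gt_1_int[OF p] e(1)] by blast
        then show ?thesis using e(2) by (auto simp: qform_scale)
      qed simp
    qed
  qed
  show ?thesis using dens dens' univ adc adc' max by blast
qed

end
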